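(* The Bézout invariants distinguish all the naive homotopy classes of rational functions: the map $$ \Big( \coprod_{n\geq 0} (\pi_0^{\mathrm{N}} \mathcal{F}_n)(k) , \oplus^{\mathrm{N}} \Big) \xrightarrow{\coprod_{n\geq0} \pi_0^{\mathrm{N}} \mathrm{B\acute{e}z}_n} \Big(\coprod_{n\geq 0} (\pi_0^{\mathrm{N}} \mathcal{S}_n)(k), \oplus \Big)$$ is an isomorphism of graded monoids.
   Context: Let $k$ be a field. For $n\geq 0$, $\mathcal{F}_n$ is the scheme of pointed degree $n$ rational functions: for a ring $R$, an $R$-point is a pair $(A,B)$ of polynomials in $R[X]$, written $\frac{A}{B}$, with $A$ monic of degree $n$, $\deg B<n$ and $\mathrm{res}_{n,n}(A,B)\in R^\times$; equivalently there is a unique Bézout relation $AU+BV=1$ with $\deg U\leq n-2$, $\deg V\leq n-1$. The monoid law $\oplus^{\mathrm{N}}$ on $\coprod_n \mathcal{F}_n$: given $\frac{A_i}{B_i}\in\mathcal{F}_{n_i}(R)$ with Bézout relations $A_iU_i+B_iV_i=1$, define $\begin{bmatrix}A_3 & -V_3\\ B_3 & U_3\end{bmatrix} := \begin{bmatrix}A_1 & -V_1\\ B_1 & U_1\end{bmatrix}\begin{bmatrix}A_2 & -V_2\\ B_2 & U_2\end{bmatrix}$ and set $\frac{A_1}{B_1}\oplus^{\mathrm{N}}\frac{A_2}{B_2}:=\frac{A_3}{B_3}\in\mathcal{F}_{n_1+n_2}(R)$. $\mathcal{S}_n$ is the scheme of non-degenerate $n\times n$ symmetric matrices, with monoid law the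 block (orthogonal) sum $\oplus$. The Bézout morphism $\mathrm{B\acute{e}z}_n:\mathcal{F}_n\to\mathcal{S}_n$ sends $\frac{A}{B}$ to the symmetric matrix $[c_{p,q}]_{1\leq p,q\leq n}$ where $\frac{A(X)B(Y)-A(Y)B(X)}{X-Y}=\sum_{p,q} c_{p,q}X^{p-1}Y^{q-1}$. For a functor $\mathcal{G}$ from $k$-algebras to sets, $(\pi_0^{\mathrm{N}}\mathcal{G})(R)$ is the coequalizer of the two maps $\mathcal{G}(R[T])\rightrightarrows\mathcal{G}(R)$ given by evaluation at $T=0$ and $T=1$ (naive homotopy classes); morphisms induce maps on $\pi_0^{\mathrm{N}}$ and $\oplus^{\mathrm{N}}$, $\oplus$ descend to these sets. Note $\coprod_n(\pi_0^{\mathrm{N}}\mathcal{F}_n)(k)$ is the set of pointed naive homotopy classes of pointed endomorphisms of $\mathbf{P}^1$ over $k$ (base point $\infty=[1:0]$). *)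

theory Defs
  imports "HOL-Computational_Algebra.Polynomial" "Jordan_Normal_Form.Determinant"
begin

(* R-points of F_n, for a commutative ring R (type 'a), as pairs (A,B) of polynomials in R[X].
   The condition "res_{n,n}(A,B) is a unit" is expressed by the (equivalent) existence of a
   Bezout relation A U + B V = 1 with deg U <= n-2, deg V <= n-1 (for n >= 1; for n = 0 the
   only point is 1/0, whose resultant is the empty determinant 1). *)
definition bez_bounds :: "nat \<Rightarrow> 'a::comm_ring_1 poly \<Rightarrow> 'a poly \<Rightarrow> bool" where
  "bez_bounds n U V \<longleftrightarrow> (U = 0 \<or> degree U + 2 \<le> n) \<and> (V = 0 \<or> degree V + 1 \<le> n)"

definition ratfun :: "nat \<Rightarrow> 'a::comm_ring_1 poly \<times> 'a poly \<Rightarrow> bool" where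
  "ratfun n f \<longleftrightarrow> (case f of (A, B) \<Rightarrow>
      lead_coeff A = 1 \<and> degree A = n \<and> (B = 0 \<or> degree B < n) \<and>
      (n = 0 \<or> (\<exists>U V. A * U + B * V = 1 \<and> bez_bounds n U V)))"

(* The unique Bezout coefficients (U,V) of a point A/B of F_n, n = deg A.
   For n = 0 (the point 1/0) the associated matrix is the identity, i.e. (U,V) = (1,0). *)
definition bez_UV :: "'a::comm_ring_1 poly \<times> 'a poly \<Rightarrow> 'a poly \<times> 'a poly" where
  "bez_UV f = (case f of (A, B) \<Rightarrow>
      if degree A = 0 then (1, 0)
      else (THE (U, V). A * U + B * V = 1 \<and> bez_bounds (degree A) U V))"

(* The monoid law: [A3 -V3; B3 U3] = [A1 -V1; B1 U1] * [A2 -V2; B2 U2]; only the first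
   column (A3, B3) is retained. *)
definition oplusN :: "'a::comm_ring_1 poly \<times> 'a poly \<Rightarrow> 'a poly \<times> 'a poly \<Rightarrow> 'a poly \<times> 'a poly" where
  "oplusN f g = (case f of (A1, B1) \<Rightarrow> case g of (A2, B2) \<Rightarrow>
      (case bez_UV f of (U1, V1) \<Rightarrow> (A1 * A2 - V1 * B2, B1 * A2 + U1 * B2)))"

definition symnd :: "nat \<Rightarrow> 'a::comm_ring_1 mat \<Rightarrow> bool" where
  "symnd n M \<longleftrightarrow> M \<in> carrier_mat n n \<and> transpose_mat M = M \<and> det M dvd 1"

definition osum :: "'a::comm_ring_1 mat \<Rightarrow> 'a mat \<Rightarrow> 'a mat" where
  "osum M N = four_block_mat M (0\<^sub>m (dim_row M) (dim_col N)) (0\<^sub>m (dim_row N) (dim_col M)) N"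

(* Bivariate polynomials R[X,Y] are represented as R[X][Y] = 'a poly poly (outer variable Y).
   bez_poly A B = (A(X)B(Y) - A(Y)B(X)) / (X - Y)  (exact division; X - Y is monic up to sign
   in Y, so the quotient is unique). *)
definition bez_poly :: "'a::comm_ring_1 poly \<Rightarrow> 'a poly \<Rightarrow> 'a poly poly" where
  "bez_poly A B = (THE Q. Q * ([:[:0, 1:]:] - [:0, 1:]) =
      [:A:] * map_poly (\<lambda>b. [:b:]) B - map_poly (\<lambda>a. [:a:]) A * [:B:])"

(* Bez_n(A/B) = [c_{p,q}], c_{p,q} the coefficient of X^(p-1) Y^(q-1) (here 0-indexed) *)
definition Bez :: "nat \<Rightarrow> 'a::comm_ring_1 poly \<times> 'a poly \<Rightarrow> 'a mat" where
  "Bez n f = (case f of (A, B) \<Rightarrow>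
      mat n n (\<lambda>(p, q). coeff (coeff (bez_poly A B) q) p))"

definition ev_pt :: "'a::comm_ring_1 \<Rightarrow> 'a poly poly \<times> 'a poly poly \<Rightarrow> 'a poly \<times> 'a poly" where
  "ev_pt t f = (case f of (A, B) \<Rightarrow> (map_poly (\<lambda>c. poly c t) A, map_poly (\<lambda>c. poly c t) B))"

definition ev_mat :: "'a::comm_ring_1 \<Rightarrow> 'a poly mat \<Rightarrow> 'a mat" where
  "ev_mat t M = map_mat (\<lambda>c. poly c t) M"

(* naive homotopy relations on F_n(k) and S_n(k): the equivalence relation generated by
   h(0) ~ h(1) for h in F_n(k[T]) (resp. S_n(k[T])); pi_0^N is the quotient by it. *)
definition htpF :: "nat \<Rightarrow> 'k::field poly \<times> 'k poly \<Rightarrow> 'k poly \<times> 'k poly \<Rightarrow> bool" where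
  "htpF n = equivclp (\<lambda>f g. \<exists>h. ratfun n h \<and> f = ev_pt 0 h \<and> g = ev_pt 1 h)"

definition htpS :: "nat \<Rightarrow> 'k::field mat \<Rightarrow> 'k mat \<Rightarrow> bool" where
  "htpS n = equivclp (\<lambda>M N. \<exists>H. symnd n H \<and> M = ev_mat 0 H \<and> N = ev_mat 1 H)"

end

theory Submission
  imports Defs "Jordan_Normal_Form.Char_Poly"
begin

text \<open>Over k[T], a symmetric matrix with unit determinant is SL-congruent to an orthogonal sum of
blocks [u] and [[f, c], [c, 0]] with constant units u, c: either there is an isotropic primitive vector,
or Hermite's reduction argument yields a vector whose value is a unit. Moving f to 1 turns the second
kind of block into the diagonal form with entries 1 and -c^2, so the two ends of a homotopy of symmetric
matrices are described by one and the same word of units.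

On the other side, the Euclidean algorithm deforms every rational function into the sum of
X/a for the letters a of such a word, and the Bezout matrix of this sum is congruent to the
corresponding diagonal matrix. Surjectivity and additivity follow. For injectivity it
remains to see that two words describing the same form give homotopic rational functions. This is a
chain equivalence: by induction on the dimension one passes from one decomposition of the form to the
other by changing two letters at a time, and such a change lifts to rational functions because
the Bezout map from degree 2 functions to symmetric 2 x 2 matrices has a polynomial section. Working with actual
bases rather than isometry classes avoids Witt cancellation, which fails in characteristic 2.\<close>

section \<open>Congruence of symmetric matrices\<close>

text \<open>Naive homotopies preserve the determinant exactly, because the units of k[T] are
  constants; hence all congruences below have determinant 1. A letter a of a word may then not be
  replaced by a x^2 on its own: the square has to be absorbed by another letter, and much of the
  chain equivalence is this bookkeeping. In characteristic 2 a block [[f, c], [c, 0]] takes only the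
  values f x^2, so it has no orthogonal basis over k[T] unless f is a unit. This is why a word is
  attached to a list of blocks and not to a diagonal matrix. In a block over k[T] only f can vary
  with T; the word forgets it, and the letter -c^2 is then dictated by the determinant. Two notions
  of base change are kept apart. Producing a homotopy from M to \<open>congr P M\<close> requires a
  polynomial path from 1 to P; comparing the words of one form requires only det P = 1.\<close>

definition congr :: "'a::comm_ring_1 mat \<Rightarrow> 'a mat \<Rightarrow> 'a mat" where
  "congr P M = P\<^sup>T * M * P"

definition lift_mat :: "'a::comm_ring_1 mat \<Rightarrow> 'a poly mat" where
  "lift_mat = map_mat (\<lambda>c. [:c:])"

text \<open>One path based at 1 suffices, with no zigzags, since such paths can be multiplied
  pointwise. The coefficients lie in a domain and not only in a field because splittings are made
  over k[T] and specialized afterwards.\<close>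

definition conn :: "nat \<Rightarrow> 'a::idom mat \<Rightarrow> bool" where
  "conn n P \<longleftrightarrow> (\<exists>Q\<in>carrier_mat n n. det Q = 1 \<and> ev_mat 0 Q = 1\<^sub>m n \<and> ev_mat 1 Q = P)"

definition mat1 :: "'a \<Rightarrow> 'a mat" where "mat1 a = mat 1 1 (\<lambda>_. a)"

definition mat2 :: "'a \<Rightarrow> 'a \<Rightarrow> 'a \<Rightarrow> 'a \<Rightarrow> 'a mat" where
  "mat2 a b c d = mat 2 2 (\<lambda>(i, j). if i = 0 then (if j = 0 then a else b) else (if j = 0 then c else d))"

section \<open>Matrices of size one and two\<close>

lemma less_2_cases_nat: "i < (2::nat) \<longleftrightarrow> i = 0 \<or> i = 1" by auto

lemma mat1_carrier[simp]: "mat1 a \<in> carrier_mat 1 1" "dim_row (mat1 a) = 1" "dim_col (mat1 a) = 1"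
  "mat1 a $$ (0, 0) = a"
  by (auto simp: mat1_def)

lemma mat2_carrier[simp]: "mat2 a b c d \<in> carrier_mat 2 2" "dim_row (mat2 a b c d) = 2" "dim_col (mat2 a b c d) = 2"
  "mat2 a b c d $$ (0, 0) = a" "mat2 a b c d $$ (0, Suc 0) = b" "mat2 a b c d $$ (Suc 0, 0) = c" "mat2 a b c d $$ (Suc 0, Suc 0) = d"
  by (auto simp: mat2_def)

lemma mat1_eq: "M \<in> carrier_mat 1 1 \<Longrightarrow> M = mat1 (M $$ (0, 0))"
  by (rule eq_matI) auto

lemma mat2_eq: "M \<in> carrier_mat 2 2 \<Longrightarrow> M = mat2 (M $$ (0, 0)) (M $$ (0, 1)) (M $$ (1, 0)) (M $$ (1, 1))"
  by (rule eq_matI) (auto simp: less_2_cases_nat)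

lemma mat2_inject[simp]: "mat2 a b c d = mat2 a' b' c' d' \<longleftrightarrow> a = a' \<and> b = b' \<and> c = c' \<and> d = d'"
  by (metis mat2_carrier(4-7))

lemma mat1_mult[simp]: "mat1 a * mat1 b = mat1 (a * b :: 'a::comm_ring_1)"
  by (rule eq_matI) (auto simp: scalar_prod_def)

lemma mat2_mult[simp]: "mat2 a b c d * mat2 a' b' c' d' =
    mat2 (a * a' + b * c') (a * b' + b * d') (c * a' + d * c') (c * b' + d * d' :: 'a::comm_ring_1)"
proof (rule eq_matI)
  have [simp]: "{0..<2::nat} = {0, 1}" by auto
  fix i j
  assume "i < dim_row (mat2 (a * a' + b * c') (a * b' + b * d') (c * a' + d * c') (c * b' + d * d'))"
    "j < dim_col (mat2 (a * a' + b * c') (a * b' + b * d') (c * a' + d * c') (c * b' + d * d'))"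
  then show "(mat2 a b c d * mat2 a' b' c' d') $$ (i, j) =
      mat2 (a * a' + b * c') (a * b' + b * d') (c * a' + d * c') (c * b' + d * d') $$ (i, j)"
    by (auto simp: less_2_cases_nat scalar_prod_def)
qed auto

lemma mat1_transpose[simp]: "transpose_mat (mat1 a) = mat1 a"
  by (rule eq_matI) auto

lemma mat2_transpose[simp]: "transpose_mat (mat2 a b c d) = mat2 a c b d"
  by (rule eq_matI) (auto simp: less_2_cases_nat)

lemma mat1_det[simp]: "det (mat1 a) = (a :: 'a::comm_ring_1)"
  by (subst det_single) auto

lemma mat1_map[simp]: "map_mat f (mat1 a) = mat1 (f a)"
  by (rule eq_matI) auto

lemma mat2_map[simp]: "map_mat f (mat2 a b c d) = mat2 (f a) (f b) (f c) (f d)"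
  by (rule eq_matI) (auto simp: less_2_cases_nat)

lemma mat2_one: "1\<^sub>m 2 = mat2 1 0 0 (1::'a::comm_ring_1)"
  by (rule eq_matI) (auto simp: less_2_cases_nat)

lemma mat1_one: "1\<^sub>m 1 = mat1 (1::'a::comm_ring_1)"
  by (rule eq_matI) auto

lemma mat1_minus[simp]: "mat1 a - mat1 b = mat1 (a - b)"
  by (rule eq_matI) auto

lemma mat2_block: "four_block_mat (mat1 a) (mat1 b) (mat1 c) (mat1 d) = mat2 a b c (d::'a::comm_ring_1)"
  by (rule eq_matI) (auto simp: less_2_cases_nat)

lemma mat2_det[simp]: "det (mat2 a b c d) = (a * d - b * c :: 'a::idom)"
  unfolding mat2_block[symmetric]
  by (subst det_four_block_mat[of _ 1]) (auto simp: mult.commute mat1_minus)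

section \<open>Orthogonal sums\<close>

lemma osum_carrier[simp]: "M \<in> carrier_mat m m \<Longrightarrow> N \<in> carrier_mat n n \<Longrightarrow> osum M N \<in> carrier_mat (m + n) (m + n)"
  by (auto simp: osum_def)

lemma osum_dim[simp]: "dim_row (osum M N) = dim_row M + dim_row N" "dim_col (osum M N) = dim_col M + dim_col N"
  by (auto simp: osum_def)

lemma osum_mat1_mat1: "osum (mat1 a) (mat1 b) = mat2 a 0 0 (b::'a::comm_ring_1)"
  unfolding osum_def by (rule eq_matI) (auto simp: less_2_cases_nat)

lemma osum_assoc: "osum (osum A B) C = osum A (osum B C)"
  unfolding osum_def using assoc_four_block_mat[of A B C, symmetric] .

lemma osum_0_right[simp]: "osum N (0\<^sub>m 0 0) = N"
  unfolding osum_def by (rule eq_matI) auto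

lemma osum_one: "osum (1\<^sub>m m) (1\<^sub>m n) = 1\<^sub>m (m + n)"
  unfolding osum_def by (rule eq_matI) auto

lemma osum_transpose: "M \<in> carrier_mat m m \<Longrightarrow> N \<in> carrier_mat n n \<Longrightarrow>
    transpose_mat (osum M N) = osum (M\<^sup>T) (N\<^sup>T)"
  unfolding osum_def by (subst transpose_four_block_mat) auto

lemma osum_mult: "M \<in> carrier_mat m m \<Longrightarrow> N \<in> carrier_mat n n \<Longrightarrow> M' \<in> carrier_mat m m \<Longrightarrow> N' \<in> carrier_mat n n \<Longrightarrow>
    osum M N * osum M' N' = osum (M * M') (N * N')"
  unfolding osum_def by (subst mult_four_block_mat) auto

lemma osum_det: "M \<in> carrier_mat m m \<Longrightarrow> N \<in> carrier_mat n n \<Longrightarrow> det (osum M N) = det M * det (N :: 'a::idom mat)"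
  unfolding osum_def by (subst det_four_block_mat_upper_right_zero) auto

lemma osum_map: "M \<in> carrier_mat m m \<Longrightarrow> N \<in> carrier_mat n n \<Longrightarrow> f 0 = 0 \<Longrightarrow>
    map_mat f (osum M N) = osum (map_mat f M) (map_mat f N)"
  unfolding osum_def by (subst map_four_block_mat) (auto simp: map_mat_def intro!: cong_four_block_mat)

lemma osum_inject: "M \<in> carrier_mat m m \<Longrightarrow> N \<in> carrier_mat n n \<Longrightarrow> M' \<in> carrier_mat m m \<Longrightarrow> N' \<in> carrier_mat n n \<Longrightarrow>
    osum M N = osum M' N' \<longleftrightarrow> M = M' \<and> N = N'"
proof (intro iffI conjI)
  assume *: "M \<in> carrier_mat m m" "N \<in> carrier_mat n n" "M' \<in> carrier_mat m m" "N' \<in> carrier_mat n n"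
    "osum M N = osum M' N'"
  then have e: "osum M N $$ (i, j) = osum M' N' $$ (i, j)" for i j by simp
  show "M = M'"
  proof (rule eq_matI)
    fix i j assume "i < dim_row M'" "j < dim_col M'"
    then show "M $$ (i, j) = M' $$ (i, j)" using e[of i j] * by (auto simp: osum_def)
  qed (use * in auto)
  show "N = N'"
  proof (rule eq_matI)
    fix i j assume "i < dim_row N'" "j < dim_col N'"
    then show "N $$ (i, j) = N' $$ (i, j)" using e[of "m+i" "m+j"] * by (auto simp: osum_def)
  qed (use * in auto)
qed auto

section \<open>Evaluation of families and constant families\<close>

lemma ev_mat_carrier[simp]: "M \<in> carrier_mat m n \<Longrightarrow> ev_mat t M \<in> carrier_mat m n"
  by (auto simp: ev_mat_def)

lemma ev_mat_dim[simp]: "dim_row (ev_mat t M) = dim_row M" "dim_col (ev_mat t M) = dim_col M"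
  by (auto simp: ev_mat_def)

lemma lift_mat_carrier[simp]: "lift_mat M \<in> carrier_mat m n \<longleftrightarrow> M \<in> carrier_mat m n"
  by (auto simp: lift_mat_def)

lemma ev_lift_mat[simp]: "ev_mat t (lift_mat M) = M"
  by (rule eq_matI) (auto simp: ev_mat_def lift_mat_def)

lemma ev_mat_mult: "M \<in> carrier_mat m n \<Longrightarrow> N \<in> carrier_mat n k \<Longrightarrow> ev_mat t (M * N) = ev_mat t M * ev_mat t N"
  unfolding ev_mat_def by (rule semiring_hom.mat_hom_mult[OF poly_hom.semiring_hom_axioms])

lemma ev_mat_transpose: "ev_mat t (M\<^sup>T) = transpose_mat (ev_mat t M)"
  by (rule eq_matI) (auto simp: ev_mat_def)

lemma ev_mat_one[simp]: "ev_mat t (1\<^sub>m n) = 1\<^sub>m n"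
  unfolding ev_mat_def by (rule semiring_hom.mat_hom_one[OF poly_hom.semiring_hom_axioms])

lemma ev_mat_det[simp]: "det (ev_mat t M) = poly (det M) t"
  unfolding ev_mat_def by (rule comm_ring_hom.hom_det[OF poly_hom.comm_ring_hom_axioms])

lemma ev_mat_osum: "M \<in> carrier_mat m m \<Longrightarrow> N \<in> carrier_mat n n \<Longrightarrow> ev_mat t (osum M N) = osum (ev_mat t M) (ev_mat t N)"
  unfolding ev_mat_def by (rule osum_map) auto

lemma ev_mat_mat1[simp]: "ev_mat t (mat1 a) = mat1 (poly a t)" by (simp add: ev_mat_def)
lemma ev_mat_mat2[simp]: "ev_mat t (mat2 a b c d) = mat2 (poly a t) (poly b t) (poly c t) (poly d t)" by (simp add: ev_mat_def)

interpretation const_hom: comm_ring_hom "\<lambda>c. [:c:]" by unfold_locales (auto simp: one_pCons)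

lemma lift_mat_det[simp]: "det (lift_mat M) = [:det M:]"
  unfolding lift_mat_def by (rule const_hom.hom_det)

lemma lift_mat_transpose: "lift_mat (M\<^sup>T) = transpose_mat (lift_mat M)"
  by (rule eq_matI) (auto simp: lift_mat_def)

section \<open>Congruence and nondegeneracy\<close>

lemma congr_carrier[simp]: "P \<in> carrier_mat m n \<Longrightarrow> M \<in> carrier_mat m m \<Longrightarrow> congr P M \<in> carrier_mat n n"
  by (auto simp: congr_def)

lemma congr_one[simp]: "M \<in> carrier_mat n n \<Longrightarrow> congr (1\<^sub>m n) M = M"
  by (auto simp: congr_def)

lemma congr_mult: assumes "P \<in> carrier_mat m n" "Q \<in> carrier_mat n k" "M \<in> carrier_mat m m"
  shows "congr (P * Q) M = congr Q (congr P M)"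
proof -
  have "transpose_mat (P * Q) = Q\<^sup>T * P\<^sup>T" using assms by (auto simp: transpose_mult)
  moreover have "Q\<^sup>T * P\<^sup>T * M = Q\<^sup>T * (P\<^sup>T * M)"
    by (rule assoc_mult_mat[of _ k n _ m _ m]) (use assms in auto)
  moreover have "Q\<^sup>T * (P\<^sup>T * M) * (P * Q) = Q\<^sup>T * (P\<^sup>T * M * (P * Q))"
    by (rule assoc_mult_mat[of _ k n _ m _ k]) (use assms in auto)
  moreover have "P\<^sup>T * M * (P * Q) = P\<^sup>T * M * P * Q"
    by (rule assoc_mult_mat[of _ n m _ n _ k, symmetric]) (use assms in auto)
  moreover have "Q\<^sup>T * (P\<^sup>T * M * P * Q) = Q\<^sup>T * (P\<^sup>T * M * P) * Q"
    by (rule assoc_mult_mat[of _ k n _ n _ k, symmetric]) (use assms in auto)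
  ultimately show ?thesis unfolding congr_def by metis
qed

lemma congr_osum: "P \<in> carrier_mat m m \<Longrightarrow> Q \<in> carrier_mat n n \<Longrightarrow> M \<in> carrier_mat m m \<Longrightarrow> N \<in> carrier_mat n n \<Longrightarrow>
    congr (osum P Q) (osum M N) = osum (congr P M) (congr Q N)"
  unfolding congr_def
  by (simp add: osum_transpose osum_mult[of _ m _ n])

lemma ev_congr: "P \<in> carrier_mat m n \<Longrightarrow> M \<in> carrier_mat m m \<Longrightarrow> ev_mat t (congr P M) = congr (ev_mat t P) (ev_mat t M)"
  unfolding congr_def
  by (simp add: ev_mat_mult[of "P\<^sup>T" n m "M * P" n] ev_mat_mult[of M m m P n] ev_mat_transpose
      assoc_mult_mat[of "transpose_mat (ev_mat t P)" n m "ev_mat t M" m "ev_mat t P" n])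

lemma congr_sym: "P \<in> carrier_mat m n \<Longrightarrow> M \<in> carrier_mat m m \<Longrightarrow> M\<^sup>T = M \<Longrightarrow> transpose_mat (congr P M) = congr P M"
  unfolding congr_def
  by (simp add: transpose_mult[of "P\<^sup>T" n m "M * P" n] transpose_mult[of M m m P n] assoc_mult_mat[of "P\<^sup>T" n m M m P n])

lemma congr_det: "P \<in> carrier_mat n n \<Longrightarrow> M \<in> carrier_mat n n \<Longrightarrow> det (congr P M) = det P * det P * det (M::'a::idom mat)"
  unfolding congr_def by (simp add: det_mult[of _ n] det_transpose)

lemma SL_inv: assumes "P \<in> carrier_mat n n" "det P = (1::'a::idom)"
  obtains Q where "Q \<in> carrier_mat n n" "det Q = 1" "P * Q = 1\<^sub>m n" "Q * P = 1\<^sub>m n"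
proof
  show 1: "adj_mat P \<in> carrier_mat n n" "P * adj_mat P = 1\<^sub>m n" "adj_mat P * P = 1\<^sub>m n"
    using adj_mat[OF assms(1)] assms(2) by auto
  then have "det P * det (adj_mat P) = 1" using assms det_mult[of P n "adj_mat P"] by auto
  then show "det (adj_mat P) = 1" using assms by simp
qed

lemma symnd_congr: "symnd n M \<Longrightarrow> P \<in> carrier_mat n n \<Longrightarrow> det P dvd (1::'a::idom) \<Longrightarrow> symnd n (congr P M)"
  unfolding symnd_def using congr_det[of P n M] congr_sym[of P n n M]
  by (metis congr_carrier is_unit_mult_iff)

lemma symnd_osum: "symnd m M \<Longrightarrow> symnd n N \<Longrightarrow> symnd (m + n) (osum M (N::'a::idom mat))"
  unfolding symnd_def by (auto simp: osum_transpose osum_det is_unit_mult_iff)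

lemma poly_dvd_one: "p dvd 1 \<Longrightarrow> poly p t dvd (1::'a::comm_ring_1)"
  by (metis dvdE dvdI poly_1 poly_mult)

lemma symnd_ev: "symnd n M \<Longrightarrow> symnd n (ev_mat t M)"
  unfolding symnd_def by (metis ev_mat_carrier ev_mat_det ev_mat_transpose poly_dvd_one)

lemma symnd_lift: "symnd n M \<Longrightarrow> symnd n (lift_mat (M :: 'a::idom mat))"
  unfolding symnd_def by (simp add: is_unit_const_poly_iff lift_mat_transpose[symmetric] del: transpose_transpose)

lemma symnd_osumD: "M \<in> carrier_mat m m \<Longrightarrow> N \<in> carrier_mat n n \<Longrightarrow> symnd (m + n) (osum M (N::'a::idom mat)) \<Longrightarrow> symnd m M \<and> symnd n N"
  unfolding symnd_def using osum_inject[of "M\<^sup>T" m "N\<^sup>T" n M N]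
  by (auto simp: osum_transpose osum_det is_unit_mult_iff)

section \<open>Polynomial paths in the special linear group\<close>

lemma conn_carrier: "conn n P \<Longrightarrow> P \<in> carrier_mat n n"
  by (auto simp: conn_def)

lemma conn_det: "conn n P \<Longrightarrow> det P = 1"
  unfolding conn_def using ev_mat_det by fastforce

lemma conn_one[simp]: "conn n (1\<^sub>m n)"
  unfolding conn_def by (rule bexI[of _ "1\<^sub>m n"]) auto

lemma conn_mult: "conn n P \<Longrightarrow> conn n Q \<Longrightarrow> conn n (P * Q)"
proof -
  assume "conn n P" "conn n Q"
  then obtain A B where *: "A\<in>carrier_mat n n" "det A = 1" "ev_mat 0 A = 1\<^sub>m n" "ev_mat 1 A = P"
    "B\<in>carrier_mat n n" "det B = 1" "ev_mat 0 B = 1\<^sub>m n" "ev_mat 1 B = Q" unfolding conn_def by blast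
  show ?thesis unfolding conn_def
    by (rule bexI[of _ "A * B"]) (use * in \<open>auto simp: ev_mat_mult[of _ n n _ n] det_mult[of _ n]\<close>)
qed

lemma conn_osum: "conn m P \<Longrightarrow> conn n Q \<Longrightarrow> conn (m + n) (osum P Q)"
proof -
  assume "conn m P" "conn n Q"
  then obtain A B where *: "A\<in>carrier_mat m m" "det A = 1" "ev_mat 0 A = 1\<^sub>m m" "ev_mat 1 A = P"
    "B\<in>carrier_mat n n" "det B = 1" "ev_mat 0 B = 1\<^sub>m n" "ev_mat 1 B = Q" unfolding conn_def by blast
  show ?thesis unfolding conn_def
    by (rule bexI[of _ "osum A B"]) (use * in \<open>auto simp: ev_mat_osum[of _ m _ n] osum_det osum_one\<close>)
qed

definition lower_unip :: "nat \<Rightarrow> nat \<Rightarrow> 'a::comm_ring_1 mat \<Rightarrow> 'a mat" where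
  "lower_unip m n R = four_block_mat (1\<^sub>m m) (0\<^sub>m m n) R (1\<^sub>m n)"

lemma lower_unip_carrier[simp]: "R \<in> carrier_mat n m \<Longrightarrow> lower_unip m n R \<in> carrier_mat (m + n) (m + n)"
  by (simp add: lower_unip_def)

lemma lower_unip_det[simp]: "R \<in> carrier_mat n m \<Longrightarrow> det (lower_unip m n R :: 'a::idom mat) = 1"
  unfolding lower_unip_def by (subst det_four_block_mat_upper_right_zero) auto

lemma conn_lower_unip: assumes R: "R \<in> carrier_mat n m" shows "conn (m + n) (lower_unip m n R)"
proof -
  let ?S = "map_mat (\<lambda>c. [:0, c:]) R"
  have S: "?S \<in> carrier_mat n m" using R by auto
  have e: "ev_mat t (lower_unip m n ?S) = lower_unip m n (map_mat (\<lambda>c. t * c) R)" for t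
    unfolding lower_unip_def by (rule eq_matI) (use R in \<open>auto simp: ev_mat_def\<close>)
  show ?thesis unfolding conn_def
  proof (intro bexI[of _ "lower_unip m n ?S"] conjI)
    show "ev_mat 0 (lower_unip m n ?S) = 1\<^sub>m (m + n)" unfolding e
      by (rule eq_matI) (use R in \<open>auto simp: lower_unip_def\<close>)
    show "ev_mat 1 (lower_unip m n ?S) = lower_unip m n R" unfolding e
      by (rule arg_cong[of _ _ "lower_unip m n"], rule eq_matI) auto
  qed (use S in auto)
qed

lemma conn_mat2_lower: "conn 2 (mat2 1 0 t (1::'a::idom))"
  unfolding conn_def by (rule bexI[of _ "mat2 1 0 [:0,t:] 1"]) (auto simp: mat2_one)

lemma conn_mat2_upper: "conn 2 (mat2 1 t 0 (1::'a::idom))"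
  unfolding conn_def by (rule bexI[of _ "mat2 1 [:0,t:] 0 1"]) (auto simp: mat2_one)

lemma conn_mat2_rot: "conn 2 (mat2 0 1 (-1) (0::'a::idom))"
proof -
  have "mat2 0 1 (-1) (0::'a) = mat2 1 1 0 1 * (mat2 1 0 (-1) 1 * mat2 1 1 0 1)" by simp
  then show ?thesis by (metis conn_mult conn_mat2_lower conn_mat2_upper)
qed

text \<open>For c nonzero the matrix is a product of an upper, a lower and an upper elementary
  matrix. For c = 0, adding the second column to the first makes the lower left entry
  nonzero.\<close>

lemma conn_SL2: assumes "a * d - b * c = (1::'a::field)" shows "conn 2 (mat2 a b c d)"
proof -
  have main: "conn 2 (mat2 a b c d)" if "a * d - b * c = (1::'a)" "c \<noteq> 0" for a b c d
  proof -
    have "mat2 a b c d = mat2 1 ((a-1)/c) 0 1 * (mat2 1 0 c 1 * mat2 1 ((d-1)/c) 0 1)"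
      using that by (simp add: field_simps) algebra
    then show ?thesis by (metis conn_mult conn_mat2_lower conn_mat2_upper)
  qed
  show ?thesis
  proof (cases "c = 0")
    case True
    then have "d \<noteq> 0" using assms by auto
    then have "conn 2 (mat2 (a+b) b d d)" using assms True by (intro main) (auto simp: algebra_simps)
    moreover have "mat2 a b c d = mat2 (a+b) b d d * mat2 1 0 (-1) 1" using True by simp
    ultimately show ?thesis by (metis conn_mult conn_mat2_lower)
  qed (use main assms in auto)
qed

text \<open>The path variable is independent of the variable of the base ring, so a path of matrices
  over a polynomial ring can be specialized coefficientwise.\<close>

lemma conn_ev: assumes "conn n P" shows "conn n (ev_mat t P)"
proof -
  obtain A where *: "A\<in>carrier_mat n n" "det A = 1" "ev_mat 0 A = 1\<^sub>m n" "ev_mat 1 A = P"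
    using assms unfolding conn_def by blast
  let ?h = "map_poly (\<lambda>c. poly c t)"
  interpret mh: map_poly_comm_ring_hom "\<lambda>c. poly c t" ..
  have e: "ev_mat s (map_mat ?h A) = ev_mat t (ev_mat s' A)"
    if "\<And>p::'a poly poly. poly (?h p) s = poly (poly p s') t" for s s'
    by (rule eq_matI) (use that in \<open>auto simp: ev_mat_def\<close>)
  show ?thesis unfolding conn_def
  proof (intro bexI[of _ "map_mat ?h A"] conjI)
    show "det (map_mat ?h A) = 1" by (simp add: *)
    show "ev_mat 0 (map_mat ?h A) = 1\<^sub>m n" by (subst e[of _ 0]) (auto simp: * poly_hom.poly_map_poly_0)
    show "ev_mat 1 (map_mat ?h A) = ev_mat t P" by (subst e[of _ 1]) (auto simp: *  poly_hom.poly_map_poly_1)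
  qed (use * in auto)
qed

section \<open>Splitting off a regular summand\<close>

text \<open>Completing the square: C' is the inverse of the regular block C, and the first block
  becomes its Schur complement.\<close>

lemma split_off: fixes B :: "'a::idom mat"
  assumes A: "A \<in> carrier_mat m m" and B: "B \<in> carrier_mat m n" and C: "C \<in> carrier_mat n n" "C\<^sup>T = C"
    and C': "C' \<in> carrier_mat n n" "C * C' = 1\<^sub>m n" "C'\<^sup>T = C'"
  shows "congr (lower_unip m n (- (C' * B\<^sup>T))) (four_block_mat A B (B\<^sup>T) C) =
    osum (A - B * C' * B\<^sup>T) C"
proof -
  define R where "R = - (C' * B\<^sup>T)"
  have R: "R \<in> carrier_mat n m" using assms by (auto simp: R_def)
  have BT: "B\<^sup>T \<in> carrier_mat n m" using B by auto
  have CC: "C' * C = 1\<^sub>m n" using transpose_mult[OF C(1) C'(1)] C'(2,3) C(2) by simp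
  have tR: "R\<^sup>T = - (B * C')"
    unfolding R_def using B C' by (simp add: transpose_mult[OF C'(1) BT] transpose_uminus)
  have CR: "C * R = - B\<^sup>T"
  proof -
    have "C * R = - (C * (C' * B\<^sup>T))" unfolding R_def using C C' BT by simp
    also have "C * (C' * B\<^sup>T) = B\<^sup>T" using C C' BT
      by (subst assoc_mult_mat[symmetric, of C n n C' n]) auto
    finally show ?thesis .
  qed
  have RC: "R\<^sup>T * C = - B"
  proof -
    have "R\<^sup>T * C = - (B * C' * C)" unfolding tR using C C' B by simp
    also have "B * C' * C = B" using C C' B CC by (subst assoc_mult_mat[of B m n C' n C]) auto
    finally show ?thesis .
  qed
  have BR: "B * R = - (B * C' * B\<^sup>T)" unfolding R_def using B C' BT by (simp add: assoc_mult_mat[of B m n C' n "B\<^sup>T" m])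
  have 1: "transpose_mat (lower_unip m n R) = four_block_mat (1\<^sub>m m) (R\<^sup>T) (0\<^sub>m n m) (1\<^sub>m n)"
    unfolding lower_unip_def by (subst transpose_four_block_mat) (use R in auto)
  have "four_block_mat (1\<^sub>m m) (R\<^sup>T) (0\<^sub>m n m) (1\<^sub>m n) * four_block_mat A B (B\<^sup>T) C =
     four_block_mat (A + R\<^sup>T * B\<^sup>T) (B + R\<^sup>T * C) (B\<^sup>T) C"
    by (subst mult_four_block_mat) (use assms R BT in auto)
  also have "B + R\<^sup>T * C = 0\<^sub>m m n" unfolding RC using B by auto
  finally have 2: "congr (lower_unip m n R) (four_block_mat A B (B\<^sup>T) C) =
     four_block_mat (A + R\<^sup>T * B\<^sup>T) (0\<^sub>m m n) (B\<^sup>T) C * four_block_mat (1\<^sub>m m) (0\<^sub>m m n) R (1\<^sub>m n)"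
    unfolding congr_def 1 by (simp add: lower_unip_def)
  also have "\<dots> = four_block_mat (A + R\<^sup>T * B\<^sup>T) (0\<^sub>m m n) (B\<^sup>T + C * R) C"
    by (subst mult_four_block_mat) (use assms R BT in auto)
  also have "B\<^sup>T + C * R = 0\<^sub>m n m" unfolding CR using BT by auto
  also have "A + R\<^sup>T * B\<^sup>T = A - B * C' * B\<^sup>T"
    unfolding tR using A B C' BT by (auto simp: minus_add_uminus_mat)
  finally show ?thesis using assms unfolding R_def osum_def by simp
qed

lemma sym_split: assumes "M \<in> carrier_mat (m + n) (m + n)" "M\<^sup>T = M"
  obtains A B C where "A \<in> carrier_mat m m" "B \<in> carrier_mat m n" "C \<in> carrier_mat n n" "A\<^sup>T = A" "C\<^sup>T = C"
    "M = four_block_mat A B (B\<^sup>T) C"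
proof -
  obtain A B B' C where s: "split_block M m m = (A, B, B', C)" by (metis prod_cases4)
  note c = split_block[OF s, of n n]
  have c': "A \<in> carrier_mat m m" "B \<in> carrier_mat m n" "B' \<in> carrier_mat n m" "C \<in> carrier_mat n n" "M = four_block_mat A B B' C"
    using c assms by auto
  have e: "M $$ (i, j) = M $$ (j, i)" if "i < m + n" "j < m + n" for i j
    using assms that by (metis carrier_matD index_transpose_mat(1))
  have A: "A\<^sup>T = A"
  proof (rule eq_matI)
    fix i j assume "i < dim_row A" "j < dim_col A"
    then show "A\<^sup>T $$ (i, j) = A $$ (i, j)" using c'(1-4) e[of i j] by (simp add: c'(5))
  qed (use c' in auto)
  have C: "C\<^sup>T = C"
  proof (rule eq_matI)
    fix i j assume "i < dim_row C" "j < dim_col C"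
    then show "C\<^sup>T $$ (i, j) = C $$ (i, j)" using c'(1-4) e[of "m+i" "m+j"] by (simp add: c'(5))
  qed (use c' in auto)
  have B: "B\<^sup>T = B'"
  proof (rule eq_matI)
    fix i j assume "i < dim_row B'" "j < dim_col B'"
    then show "B\<^sup>T $$ (i, j) = B' $$ (i, j)" using c'(1-4) e[of "m+i" "j"] by (simp add: c'(5))
  qed (use c' in auto)
  have "M = four_block_mat A B (B\<^sup>T) C" unfolding B by (rule c'(5))
  then show ?thesis by (rule that[OF c'(1,2,4) A C])
qed

lemma sym_split1: assumes "M \<in> carrier_mat (Suc m) (Suc m)" "M\<^sup>T = M"
  obtains A r where "A \<in> carrier_mat m m" "r \<in> carrier_mat m 1" "A\<^sup>T = A"
    "M = four_block_mat A r (r\<^sup>T) (mat1 (M $$ (m, m)))"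
proof -
  have "M \<in> carrier_mat (m + 1) (m + 1)" using assms(1) by simp
  then obtain A r C where A: "A \<in> carrier_mat m m" "r \<in> carrier_mat m 1" "C \<in> carrier_mat 1 1" "A\<^sup>T = A"
    "M = four_block_mat A r (r\<^sup>T) C" using sym_split[OF _ assms(2)] by metis
  have "C $$ (0, 0) = M $$ (m, m)" unfolding A(5) using A by simp
  then show ?thesis using that A mat1_eq[OF A(3)] by metis
qed

lemma sym_split2: assumes "M \<in> carrier_mat (m + 2) (m + 2)" "M\<^sup>T = M"
  obtains A B where "A \<in> carrier_mat m m" "B \<in> carrier_mat m 2"
    "M = four_block_mat A B (B\<^sup>T) (mat2 (M $$ (m, m)) (M $$ (m, Suc m)) (M $$ (m, Suc m)) (M $$ (Suc m, Suc m)))"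
proof -
  obtain A B C where A: "A \<in> carrier_mat m m" "B \<in> carrier_mat m 2" "C \<in> carrier_mat 2 2" "C\<^sup>T = C"
    "M = four_block_mat A B (B\<^sup>T) C" using sym_split[OF assms] by metis
  have C: "C $$ (i, j) = M $$ (i + m, j + m)" if "i < 2" "j < 2" for i j
    unfolding A(5) using A that by simp
  have "C $$ (1, 0) = C $$ (0, 1)"
    using arg_cong[OF A(4), of "\<lambda>M. M $$ (1, 0)"] A(3) by (subst (asm) index_transpose_mat) auto
  then have "C = mat2 (M $$ (m, m)) (M $$ (m, Suc m)) (M $$ (m, Suc m)) (M $$ (Suc m, Suc m))"
    using mat2_eq[OF A(3)] C[of 0 0] C[of 0 1] C[of 1 1] by simp
  then show ?thesis using that A by metis
qed

text \<open>The last basis vector stays and the others are corrected by multiples of it, so the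
  splitting remains usable when that vector is prescribed.\<close>

lemma anisotropic_split: fixes M :: "'a::idom mat"
  assumes "symnd (Suc m) M" "M $$ (m, m) dvd 1"
  obtains R A where "R \<in> carrier_mat 1 m" "A \<in> carrier_mat m m"
    "congr (lower_unip m 1 R) M = osum A (mat1 (M $$ (m, m)))"
proof -
  define d where "d = M $$ (m, m)"
  obtain d' where d': "d * d' = 1" using assms(2) unfolding d_def by (metis dvdE)
  have "M \<in> carrier_mat (Suc m) (Suc m)" "M\<^sup>T = M" using assms(1) by (auto simp: symnd_def)
  then obtain A r where A: "A \<in> carrier_mat m m" "r \<in> carrier_mat m 1" "M = four_block_mat A r (r\<^sup>T) (mat1 d)"
    unfolding d_def using sym_split1 by metis
  have "mat1 d' * r\<^sup>T \<in> carrier_mat 1 m" by (intro mult_carrier_mat[of _ 1 1]) (use A in auto)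
  then have R: "- (mat1 d' * r\<^sup>T) \<in> carrier_mat 1 m" by simp
  have Ac: "A - r * mat1 d' * r\<^sup>T \<in> carrier_mat m m"
    using A by (intro minus_carrier_mat mult_carrier_mat[of _ _ 1]) auto
  have "congr (lower_unip m 1 (- (mat1 d' * r\<^sup>T))) M = osum (A - r * mat1 d' * r\<^sup>T) (mat1 d)"
    unfolding A(3) by (rule split_off) (use A d' in \<open>auto simp: mat1_one[simplified]\<close>)
  then show ?thesis using that[OF R Ac] by (simp add: d_def)
qed

section \<open>Symmetric matrices over k[T]\<close>

datatype 'a block = One 'a | Two 'a 'a

fun block_mat :: "'a::zero block \<Rightarrow> 'a mat" where
  "block_mat (One a) = mat1 a"
| "block_mat (Two c f) = mat2 f c c 0"

fun block_ok :: "'a::comm_monoid_mult block \<Rightarrow> bool" where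
  "block_ok (One a) = (a dvd 1)"
| "block_ok (Two c f) = (c dvd 1)"

text \<open>The head of the list is the block in the last coordinates.\<close>

fun blocks_mat :: "'a::comm_ring_1 block list \<Rightarrow> 'a mat" where
  "blocks_mat [] = 0\<^sub>m 0 0"
| "blocks_mat (b # w) = osum (blocks_mat w) (block_mat b)"

lemma mat1_carrier_Suc[simp]: "mat1 a \<in> carrier_mat (Suc 0) (Suc 0)"
  by (auto simp: mat1_def)

lemma congr_one_mat1[simp]: "congr (1\<^sub>m (Suc 0)) (mat1 a) = mat1 a"
  using congr_one[of "mat1 a" 1] by simp

lemma congr_block: fixes P :: "'a::comm_ring_1 mat"
  assumes P: "P \<in> carrier_mat m m" and Q: "Q \<in> carrier_mat n n"
    and A: "A \<in> carrier_mat m m" and B: "B \<in> carrier_mat m n" and C: "C \<in> carrier_mat n n"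
  shows "congr (osum P Q) (four_block_mat A B (B\<^sup>T) C) =
    four_block_mat (congr P A) (P\<^sup>T * B * Q) (transpose_mat (P\<^sup>T * B * Q)) (congr Q C)"
proof -
  have PT: "P\<^sup>T \<in> carrier_mat m m" and QT: "Q\<^sup>T \<in> carrier_mat n n"
    and BT: "B\<^sup>T \<in> carrier_mat n m" using P Q B by auto
  have PB: "P\<^sup>T * B \<in> carrier_mat m n" using PT B by auto
  have e: "transpose_mat (P\<^sup>T * B * Q) = Q\<^sup>T * B\<^sup>T * P"
    using transpose_mult[OF PB Q] transpose_mult[OF PT B] assoc_mult_mat[OF QT BT P] by simp
  have "transpose_mat (osum P Q) * four_block_mat A B (B\<^sup>T) C =
      four_block_mat (P\<^sup>T * A) (P\<^sup>T * B) (Q\<^sup>T * B\<^sup>T) (Q\<^sup>T * C)"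
    unfolding osum_transpose[OF P Q] unfolding osum_def
    by (subst mult_four_block_mat[of _ m m _ n _ n _ _ m _ n]) (use assms in auto)
  also have "\<dots> * osum P Q = four_block_mat (P\<^sup>T * A * P) (P\<^sup>T * B * Q)
      (Q\<^sup>T * B\<^sup>T * P) (Q\<^sup>T * C * Q)"
    unfolding osum_def
    by (subst mult_four_block_mat[of _ m m _ n _ n _ _ m _ n]) (use assms in auto)
  finally show ?thesis unfolding congr_def e .
qed

section \<open>Hermite reduction and the Euclidean algorithm on columns\<close>

text \<open>The Schur complement without division: \<open>?U\<close> multiplies the first block by a
  and clears the last row, so that a need not be a unit.\<close>

lemma det_schur_scaled: fixes C :: "'a::idom mat"
  assumes C: "C \<in> carrier_mat m m" and r: "r \<in> carrier_mat m 1" and a: "a \<noteq> 0"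
  shows "a * det (a \<cdot>\<^sub>m C - r * r\<^sup>T) = a ^ m * det (four_block_mat C r (r\<^sup>T) (mat1 a))"
proof -
  let ?N = "four_block_mat C r (r\<^sup>T) (mat1 a)"
  let ?U = "four_block_mat (a \<cdot>\<^sub>m 1\<^sub>m m) (0\<^sub>m m 1) (- r\<^sup>T) (1\<^sub>m 1)"
  have rT: "r\<^sup>T \<in> carrier_mat 1 m" using r by auto
  have "?N * ?U = four_block_mat (C * (a \<cdot>\<^sub>m 1\<^sub>m m) + r * (- r\<^sup>T)) (C * 0\<^sub>m m 1 + r * 1\<^sub>m 1)
      (r\<^sup>T * (a \<cdot>\<^sub>m 1\<^sub>m m) + mat1 a * (- r\<^sup>T)) (r\<^sup>T * 0\<^sub>m m 1 + mat1 a * 1\<^sub>m 1)"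
    by (rule mult_four_block_mat) (use C r in auto)
  also have "C * (a \<cdot>\<^sub>m 1\<^sub>m m) + r * (- r\<^sup>T) = a \<cdot>\<^sub>m C - r * r\<^sup>T"
    using C r rT by (simp add: mult_smult_distrib[OF C one_carrier_mat] minus_add_uminus_mat[of _ m m])
  also have "C * 0\<^sub>m m 1 + r * 1\<^sub>m 1 = r" using C r by auto
  also have "r\<^sup>T * (a \<cdot>\<^sub>m 1\<^sub>m m) + mat1 a * (- r\<^sup>T) = 0\<^sub>m 1 m"
  proof -
    have "mat1 a * r\<^sup>T = a \<cdot>\<^sub>m r\<^sup>T"
      by (rule eq_matI) (use r in \<open>auto simp: scalar_prod_def\<close>)
    moreover have "mat1 a * (- r\<^sup>T) = - (mat1 a * r\<^sup>T)" using rT by simp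
    moreover have "r\<^sup>T * (a \<cdot>\<^sub>m 1\<^sub>m m) = a \<cdot>\<^sub>m r\<^sup>T"
      using rT by (simp add: mult_smult_distrib[OF rT one_carrier_mat])
    ultimately show ?thesis using rT by auto
  qed
  also have "r\<^sup>T * 0\<^sub>m m 1 + mat1 a * 1\<^sub>m 1 = mat1 a" using rT by auto
  finally have e: "?N * ?U = four_block_mat (a \<cdot>\<^sub>m C - r * r\<^sup>T) r (0\<^sub>m 1 m) (mat1 a)" .
  have "det (?N * ?U) = det (a \<cdot>\<^sub>m C - r * r\<^sup>T) * a"
    unfolding e by (subst det_four_block_mat_lower_left_zero[of _ m]) (use C r in auto)
  moreover have "det (?N * ?U) = det ?N * det ?U"
    by (rule det_mult[of _ "m + 1"]) (use C r in auto)
  moreover have "det ?U = a ^ m"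
    by (subst det_four_block_mat_upper_right_zero) (use r in auto)
  ultimately show ?thesis by (simp add: mult.commute)
qed

text \<open>The extended Euclidean algorithm kept as a matrix: the column (p, r) is the relation
  between g and h that it ends with, and the division steps are elementary matrices, each joined to
  1.\<close>

lemma conn_euclid2: fixes g h :: "'a::field poly"
  shows "\<exists>p q r s. conn 2 (mat2 p q r s) \<and> p * g + r * h = 0"
proof (induction "euclidean_size g" arbitrary: g h rule: less_induct)
  case less
  show ?case
  proof (cases "g = 0")
    case True
    then show ?thesis by (intro exI[of _ 1] exI[of _ 0]) (simp add: mat2_one[symmetric])
  next
    case False
    define t where "t = h div g"
    have "euclidean_size (- (h mod g)) < euclidean_size g" 
      using mod_size_less[OF False, of h] by (auto simp: euclidean_size_poly_def split: if_splits)
    then obtain p q r s where c: "conn 2 (mat2 p q r s)" and e: "p * (- (h mod g)) + r * g = 0"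
      using less[of "- (h mod g)" g] by blast
    \<comment> \<open>These two factors replace (g, h) by (-(h mod g), g); the sign keeps the
      determinant equal to 1.\<close>
    have "conn 2 (mat2 1 (-t) 0 1 * mat2 0 1 (-1) 0 * mat2 p q r s)"
      using c conn_mat2_upper conn_mat2_rot conn_mult by blast
    moreover have "mat2 1 (-t) 0 1 * mat2 0 1 (-1) 0 * mat2 p q r s = mat2 (t * p + r) (t * q + s) (- p) (- q)" by simp
    moreover have "(t * p + r) * g + (- p) * h = p * (- (h mod g)) + r * g"
    proof -
      have "h mod g = h - t * g" unfolding t_def by (simp add: minus_div_mult_eq_mod)
      then show ?thesis by (simp only:) (simp add: algebra_simps)
    qed
    ultimately show ?thesis using e by metis
  qed
qed

text \<open>A column in two blocks, written as a four-block matrix whose right half has no columns,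
  so that the four-block multiplication rules apply.\<close>

definition vstack :: "'a::zero mat \<Rightarrow> 'a mat \<Rightarrow> 'a mat" where
  "vstack a b = four_block_mat a (0\<^sub>m (dim_row a) 0) b (0\<^sub>m (dim_row b) 0)"

lemma vstack_osum: assumes "a \<in> carrier_mat m k" "b \<in> carrier_mat n k" "P \<in> carrier_mat m m" "Q \<in> carrier_mat n n"
  shows "osum P Q * vstack a b = vstack (P * a) (Q * (b :: 'a::comm_ring_1 mat))"
proof -
  have "osum P Q * vstack a b = four_block_mat (P * a + 0\<^sub>m m n * b) (P * 0\<^sub>m m 0 + 0\<^sub>m m n * 0\<^sub>m n 0)
     (0\<^sub>m n m * a + Q * b) (0\<^sub>m n m * 0\<^sub>m m 0 + Q * 0\<^sub>m n 0)"
    unfolding vstack_def osum_def by (subst mult_four_block_mat[of _ m m _ n _ n _ _ k _ 0]) (use assms in auto)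
  also have "\<dots> = vstack (P * a) (Q * b)"
    unfolding vstack_def by (rule cong_four_block_mat) (use assms in auto)
  finally show ?thesis .
qed

lemma vstack_index: assumes "a \<in> carrier_mat m k" "b \<in> carrier_mat n k" "i < m + n" "j < k"
  shows "vstack a b $$ (i, j) = (if i < m then a $$ (i, j) else b $$ (i - m, j))"
  using assms by (auto simp: vstack_def)

lemma vstack_carrier: assumes "a \<in> carrier_mat m k" "b \<in> carrier_mat n k"
  shows "vstack a b \<in> carrier_mat (m + n) k"
  using assms by (auto simp: vstack_def)

lemma vstack_split: assumes "r \<in> carrier_mat (m + n) k"
  obtains a b where "a \<in> carrier_mat m k" "b \<in> carrier_mat n k" "r = vstack a b"
proof
  show "r = vstack (mat m k (\<lambda>ij. r $$ ij)) (mat n k (\<lambda>(i, j). r $$ (i + m, j)))"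
    by (rule eq_matI) (use assms in \<open>auto simp: vstack_def\<close>)
qed auto

text \<open>Induction from the top: all entries but the last are merged into one, and the 2 x 2
  algorithm merges that one with the last entry.\<close>

lemma conn_euclid: fixes r :: "'a::field poly mat"
  assumes "r \<in> carrier_mat (Suc m) 1"
  shows "\<exists>S. conn (Suc m) S \<and> (\<forall>j<m. (S\<^sup>T * r) $$ (j, 0) = 0)"
  using assms
proof (induction m arbitrary: r)
  case 0
  then show ?case by (intro exI[of _ "1\<^sub>m 1"]) (use conn_one in auto)
next
  case (Suc m)
  from Suc.prems obtain a b where ab: "a \<in> carrier_mat (Suc m) 1" "b \<in> carrier_mat 1 1" "r = vstack a b"
    using vstack_split[of r "Suc m" 1 1] by auto
  from Suc.IH[OF ab(1)] obtain S where S: "conn (Suc m) S" "\<And>j. j < m \<Longrightarrow> (S\<^sup>T * a) $$ (j, 0) = 0" by blast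
  have Sc: "S \<in> carrier_mat (Suc m) (Suc m)" using conn_carrier[OF S(1)] .
  let ?S1 = "osum S (1\<^sub>m 1)"
  define r1 where "r1 = ?S1\<^sup>T * r"
  have r1: "r1 = vstack (S\<^sup>T * a) b" unfolding r1_def ab(3)
    using Sc ab by (subst osum_transpose[of _ "Suc m" _ 1], simp_all) (subst vstack_osum[of _ "Suc m" 1 _ 1], auto)
  have r1c: "r1 \<in> carrier_mat (m + 2) 1" unfolding r1 using vstack_carrier[of _ "Suc m" 1 b 1] Sc ab by simp
  obtain u v where uv: "u \<in> carrier_mat m 1" "v \<in> carrier_mat 2 1" "r1 = vstack u v"
    using vstack_split[OF r1c] by blast
  have u0: "u $$ (j, 0) = 0" if "j < m" for j
  proof -
    have "u $$ (j, 0) = r1 $$ (j, 0)" using vstack_index[OF uv(1,2), of j 0] that uv(3) by simp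
    also have "\<dots> = 0" unfolding r1 using vstack_index[of "S\<^sup>T * a" "Suc m" 1 b 1 j 0] Sc ab that S(2) by simp
    finally show ?thesis .
  qed
  obtain p q x y where K: "conn 2 (mat2 p q x y)" "p * v $$ (0, 0) + x * v $$ (1, 0) = 0"
    using conn_euclid2 by blast
  let ?S2 = "osum (1\<^sub>m m) (mat2 p q x y)"
  have c1: "conn (Suc (Suc m)) ?S1" using conn_osum[OF S(1) conn_one[of 1]] by simp
  have c2: "conn (Suc (Suc m)) ?S2" using conn_osum[OF conn_one[of m] K(1)] by simp
  have e: "transpose_mat (?S1 * ?S2) * r = vstack u (transpose_mat (mat2 p q x y) * v)"
  proof -
    have "transpose_mat (?S1 * ?S2) * r = ?S2\<^sup>T * r1" unfolding r1_def
      using conn_carrier[OF c1] conn_carrier[OF c2] Suc.prems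
      by (simp add: transpose_mult[of _ "Suc (Suc m)" "Suc (Suc m)" _ "Suc (Suc m)"]
          assoc_mult_mat[of _ "Suc (Suc m)" "Suc (Suc m)" _ "Suc (Suc m)" _ 1])
    also have "?S2\<^sup>T = osum (1\<^sub>m m) (transpose_mat (mat2 p q x y))"
      by (subst osum_transpose[of _ m _ 2]) auto
    also have "\<dots> * r1 = vstack u (transpose_mat (mat2 p q x y) * v)"
      unfolding uv(3) using uv by (subst vstack_osum[of _ m 1 _ 2]) auto
    finally show ?thesis .
  qed
  have vc: "transpose_mat (mat2 p q x y) * v \<in> carrier_mat 2 1"
    using uv(2) by (intro mult_carrier_mat[of _ 2 2]) auto
  have v0: "(transpose_mat (mat2 p q x y) * v) $$ (0, 0) = 0"
    using K(2) uv by (simp add: scalar_prod_def numeral_2_eq_2)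
  have "vstack u (transpose_mat (mat2 p q x y) * v) $$ (j, 0) = 0" if "j < Suc m" for j
    using that vstack_index[OF uv(1) vc, of j 0] u0[of j] v0 by (cases "j < m") (auto simp: less_Suc_eq)
  then show ?case using conn_mult[OF c1 c2] e by metis
qed

text \<open>Take a basis whose last vector has a value a of minimal degree. If all values are nonzero, the induction
hypothesis for the form a C - r r^T on the quotient by that vector gives a second vector; after
reducing it modulo the first, minimality bounds the degree of its value from below by the degree of a.\<close>

lemma hermite_small: fixes M :: "'a::field poly mat"
  assumes "M \<in> carrier_mat (Suc n) (Suc n)" "M\<^sup>T = M" "det M \<noteq> 0"
  shows "\<exists>P. conn (Suc n) P \<and> (congr P M $$ (n, n) = 0 \<or> Suc n * degree (congr P M $$ (n, n)) \<le> degree (det M))"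
  using assms
proof (induction n arbitrary: M)
  case 0
  have "M = mat1 (M $$ (0, 0))" using 0 mat1_eq by simp
  then have "det M = M $$ (0, 0)" by (metis mat1_det)
  then show ?case using 0 conn_one[of 1] congr_one[of M 1] by (intro exI[of _ "1\<^sub>m 1"]) simp
next
  case (Suc n)
  let ?k = "Suc (Suc n)"
  show ?case
  proof (cases "\<exists>P. conn ?k P \<and> congr P M $$ (Suc n, Suc n) = 0")
    case True
    then show ?thesis by blast
  next
    case False
    define val where "val P = congr P M $$ (Suc n, Suc n)" for P
    have nz: "val P \<noteq> 0" if "conn ?k P" for P using False that unfolding val_def by blast
    obtain P where P: "conn ?k P" and min: "\<And>Q. conn ?k Q \<Longrightarrow> degree (val P) \<le> degree (val Q)"
      using ex_has_least_nat[of "conn ?k" "1\<^sub>m ?k" "\<lambda>P. degree (val P)"] conn_one by blast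
    define N where "N = congr P M"
    define a where "a = val P"
    have a0: "a \<noteq> 0" using nz[OF P] by (simp add: a_def)
    have Pc: "P \<in> carrier_mat ?k ?k" using conn_carrier[OF P] .
    have Nc: "N \<in> carrier_mat (Suc n + 1) (Suc n + 1)" "N\<^sup>T = N"
      using Suc.prems Pc congr_sym[of P ?k ?k M] by (auto simp: N_def)
    have detN: "det N = det M" unfolding N_def using congr_det[of P ?k M] Suc.prems Pc conn_det[OF P] by simp
    have "N $$ (Suc n, Suc n) = a" by (simp add: N_def a_def val_def)
    then obtain C r where C: "C \<in> carrier_mat (Suc n) (Suc n)" "r \<in> carrier_mat (Suc n) 1"
      "C\<^sup>T = C" "N = four_block_mat C r (r\<^sup>T) (mat1 a)" using sym_split1[of N "Suc n"] Nc by (metis Suc_eq_plus1)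
    define N2 where "N2 = a \<cdot>\<^sub>m C - r * r\<^sup>T"
    have rr: "r * r\<^sup>T \<in> carrier_mat (Suc n) (Suc n)" using C(2) by (intro mult_carrier_mat[of _ _ 1]) auto
    have N2c: "N2 \<in> carrier_mat (Suc n) (Suc n)" unfolding N2_def using C rr by auto
    have N2sym: "N2\<^sup>T = N2"
    proof -
      have "transpose_mat (r * r\<^sup>T) = r * r\<^sup>T"
        using C(2) transpose_mult[of r "Suc n" 1 "r\<^sup>T" "Suc n"] by simp
      moreover have smultT: "transpose_mat (a \<cdot>\<^sub>m C) = a \<cdot>\<^sub>m C\<^sup>T" by (rule eq_matI) auto
      ultimately show ?thesis unfolding N2_def using transpose_minus[of "a \<cdot>\<^sub>m C" "Suc n" "Suc n" "r * r\<^sup>T"] C rr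
        by (simp add: smultT)
    qed
    have "a * det N2 = a ^ Suc n * det N" unfolding N2_def C(4) by (rule det_schur_scaled) (use C a0 in auto)
    then have detN2: "det N2 = a ^ n * det M" using a0 by (simp add: detN)
    then have "det N2 \<noteq> 0" using a0 Suc.prems by simp
    from Suc.IH[OF N2c N2sym this] obtain P' where P': "conn (Suc n) P'"
      "congr P' N2 $$ (n, n) = 0 \<or> Suc n * degree (congr P' N2 $$ (n, n)) \<le> degree (det N2)" by blast
    have P'c: "P' \<in> carrier_mat (Suc n) (Suc n)" using conn_carrier[OF P'(1)] .
    define c where "c = congr P' C $$ (n, n)"
    define r' where "r' = P'\<^sup>T * r"
    define b where "b = r' $$ (n, 0)"
    have r'c: "r' \<in> carrier_mat (Suc n) 1" unfolding r'_def using P'c C by auto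
    have y: "congr P' N2 $$ (n, n) = a * c - b * b"
    proof -
      have "congr P' N2 = a \<cdot>\<^sub>m congr P' C - r' * r'\<^sup>T"
      proof -
        have PT: "P'\<^sup>T \<in> carrier_mat (Suc n) (Suc n)" using P'c by simp
        have 1: "r'\<^sup>T = r\<^sup>T * P'" unfolding r'_def
          using transpose_mult[OF PT C(2)] by simp
        have "P'\<^sup>T * N2 = a \<cdot>\<^sub>m (P'\<^sup>T * C) - P'\<^sup>T * (r * r\<^sup>T)"
          unfolding N2_def using mult_minus_distrib_mat[OF PT, of "a \<cdot>\<^sub>m C" "Suc n" "r * r\<^sup>T"] C rr PT
          by (simp add: mult_smult_distrib[OF PT C(1)])
        also have "P'\<^sup>T * (r * r\<^sup>T) = r' * r\<^sup>T"
          unfolding r'_def using assoc_mult_mat[OF PT C(2), of "r\<^sup>T" "Suc n"] C(2) by simp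
        finally have "congr P' N2 = (a \<cdot>\<^sub>m (P'\<^sup>T * C) - r' * r\<^sup>T) * P'"
          unfolding congr_def by simp
        also have "\<dots> = a \<cdot>\<^sub>m (P'\<^sup>T * C) * P' - r' * r\<^sup>T * P'"
          by (rule minus_mult_distrib_mat[of _ "Suc n" "Suc n"]) (use PT C r'c P'c in auto)
        also have "a \<cdot>\<^sub>m (P'\<^sup>T * C) * P' = a \<cdot>\<^sub>m congr P' C" unfolding congr_def
          by (rule mult_smult_assoc_mat[of _ "Suc n" "Suc n"]) (use PT C P'c in auto)
        also have "r' * r\<^sup>T * P' = r' * r'\<^sup>T" unfolding 1
          by (rule assoc_mult_mat[of _ _ 1]) (use r'c C P'c in auto)
        finally show ?thesis .
      qed
      moreover have "(r' * r'\<^sup>T) $$ (n, n) = b * b" using r'c by (simp add: b_def scalar_prod_def)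
      moreover have "congr P' C \<in> carrier_mat (Suc n) (Suc n)" using P'c C by simp
      moreover have "r' * r'\<^sup>T \<in> carrier_mat (Suc n) (Suc n)" using r'c by (intro mult_carrier_mat[of _ _ 1]) auto
      ultimately show ?thesis using carrier_matD[OF r'c] by (simp add: c_def)
    qed
    define P1 where "P1 = osum P' (1\<^sub>m 1)"
    have P1: "conn ?k P1" unfolding P1_def using conn_osum[OF P'(1) conn_one[of 1]] by simp
    have P1c: "P1 \<in> carrier_mat ?k ?k" using conn_carrier[OF P1] .
    define N' where "N' = congr P1 N"
    have N': "N' = four_block_mat (congr P' C) r' (r'\<^sup>T) (mat1 a)"
      unfolding N'_def P1_def C(4)
      using congr_block[OF P'c one_carrier_mat[of 1] C(1,2) mat1_carrier(1), of a] C r'c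
      by (simp add: r'_def[symmetric])
    have CC: "congr P' C \<in> carrier_mat (Suc n) (Suc n)" using P'c C by simp
    have N'c: "N' \<in> carrier_mat (n + 2) (n + 2)" unfolding N' using four_block_carrier_mat[OF CC mat1_carrier(1)] by simp
    have N's: "N'\<^sup>T = N'" unfolding N'_def using congr_sym[OF P1c] Nc by simp
    define E where "E = mat2 c b b a"
    have "N' $$ (n, n) = c" "N' $$ (n, Suc n) = b" "N' $$ (Suc n, Suc n) = a"
      using CC r'c unfolding N' c_def b_def by simp_all
    then obtain A B where AB: "A \<in> carrier_mat n n" "B \<in> carrier_mat n 2" "N' = four_block_mat A B (B\<^sup>T) E"
      using sym_split2[OF N'c N's] unfolding E_def by metis
    have Ec: "E \<in> carrier_mat 2 2" by (simp add: E_def)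
    define t where "t = b div a"
    define b' where "b' = b mod a"
    have b': "b = a * t + b'" by (simp add: t_def b'_def)
    define c' where "c' = c - 2 * t * b + t * t * a"
    \<comment> \<open>Let v be the minimal vector, of value a, and w the second one, of value c. The
      last column is w - t v: its product with v is the remainder b', and its value is c'.\<close>
    let ?K = "mat2 0 1 (-1) (-t)"
    have K: "conn 2 ?K"
    proof -
      have "?K = mat2 0 1 (-1) 0 * mat2 1 t 0 1" by simp
      then show ?thesis using conn_mult conn_mat2_rot conn_mat2_upper by metis
    qed
    define P2 where "P2 = osum (1\<^sub>m n) ?K"
    have P2: "conn ?k P2" unfolding P2_def using conn_osum[OF conn_one[of n] K] by simp
    have P2c: "P2 \<in> carrier_mat ?k ?k" using conn_carrier[OF P2] .
    have "congr P2 N' $$ (Suc n, Suc n) = congr ?K E $$ (1, 1)"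
      unfolding P2_def AB(3) using carrier_matD[OF congr_carrier[OF mat2_carrier(1)[of 0 1 "-1" "-t"] Ec]]
      by (subst congr_block) (use AB Ec in auto)
    also have "congr ?K E $$ (1, 1) = c'" unfolding E_def
      by (simp add: congr_def c'_def algebra_simps)
    also have "congr P2 N' = congr (P * P1 * P2) M" unfolding N'_def N_def
      by (simp only: congr_mult[OF mult_carrier_mat[OF Pc P1c] P2c Suc.prems(1)] congr_mult[OF Pc P1c Suc.prems(1)])
    finally have v: "val (P * P1 * P2) = c'" by (simp add: val_def)
    have cc: "conn ?k (P * P1 * P2)" using P P1 P2 conn_mult by blast
    have c'0: "c' \<noteq> 0" using nz[OF cc] v by simp
    have dc': "degree a \<le> degree c'" using min[OF cc] v by (simp add: a_def)
    \<comment> \<open>The plane of v and w has the same determinant as that of v and w - t v. The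
      induction hypothesis therefore bounds the degree of a c' - b'^2.\<close>
    have y': "a * c - b * b = a * c' - b' * b'" unfolding c'_def b' by (simp add: algebra_simps)
    have dac: "degree (a * c') = degree a + degree c'" using a0 c'0 by (rule degree_mult_eq)
    \<comment> \<open>Minimality makes c' at least of the degree of a, while b' is of smaller degree
      than a, so a c' dominates.\<close>
    have dy: "degree (a * c' - b' * b') = degree a + degree c'"  "a * c' - b' * b' \<noteq> 0"
    proof -
      have "degree (a * c' - b' * b') = degree a + degree c' \<and> a * c' - b' * b' \<noteq> 0"
      proof (cases "b' = 0")
        case True
        then show ?thesis using dac a0 c'0 by simp
      next
        case False
        then have "degree b' < degree a" using degree_mod_less[OF a0, of b] by (simp add: b'_def)
        then have *: "degree (b' * b') < degree (a * c')" using False dac dc' by (simp add: degree_mult_eq)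
        then have "degree (a * c' - b' * b') = degree (a * c')"
          using degree_add_eq_left[of "- (b' * b')" "a * c'"] by simp
        then show ?thesis using * dac by (metis degree_0 less_nat_zero_code)
      qed
      then show "degree (a * c' - b' * b') = degree a + degree c'"  "a * c' - b' * b' \<noteq> 0" by auto
    qed
    have "Suc n * (degree a + degree c') \<le> degree (det N2)" using P'(2) y y' dy by simp
    also have "degree (det N2) = n * degree a + degree (det M)"
      unfolding detN2 using a0 Suc.prems by (simp add: degree_mult_eq degree_power_eq)
    finally have "Suc n * (degree a + degree a) \<le> n * degree a + degree (det M)"
      using dc' by (smt (verit) add_le_mono mult_le_mono2 le_refl le_trans)
    \<comment> \<open>Of the 2 (n + 1) copies of degree a, n cancel against those in the determinant
      of the scaled form, which leaves n + 2.\<close>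
    then have "?k * degree a \<le> degree (det M)" by (simp add: algebra_simps)
    then show ?thesis using P by (intro exI[of _ P]) (simp add: a_def val_def)
  qed
qed

section \<open>Decomposition into blocks\<close>

text \<open>The inductive step shared by both kinds of block: the complement is again nondegenerate,
  and a congruence of it extends by the identity on the block.\<close>

lemma symnd_blocks_step: fixes M :: "'a::idom mat"
  assumes P: "conn n P" and M: "symnd n M" and n: "n = m + k" and A: "A \<in> carrier_mat m m" and b: "block_mat b \<in> carrier_mat k k" "block_ok b"
    and e: "congr P M = osum A (block_mat b)"
    and IH: "symnd m A \<Longrightarrow> \<exists>P w. conn m P \<and> (\<forall>b\<in>set w. block_ok b) \<and> congr P A = blocks_mat w"
  shows "\<exists>P w. conn n P \<and> (\<forall>b\<in>set w. block_ok b) \<and> congr P M = blocks_mat w"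
proof -
  have Pc: "P \<in> carrier_mat n n" and Mc: "M \<in> carrier_mat n n" using P M conn_carrier by (auto simp: symnd_def)
  have "symnd n (osum A (block_mat b))" unfolding e[symmetric] using symnd_congr[OF M Pc] conn_det[OF P] by simp
  then have "symnd m A" using symnd_osumD[OF A b(1)] n by simp
  then obtain Q w where Q: "conn m Q" "\<forall>b\<in>set w. block_ok b" "congr Q A = blocks_mat w" using IH by blast
  have Qc: "Q \<in> carrier_mat m m" using Q conn_carrier by blast
  have Q1: "conn n (osum Q (1\<^sub>m k))" unfolding n using conn_osum[OF Q(1) conn_one] .
  have "congr (P * osum Q (1\<^sub>m k)) M = congr (osum Q (1\<^sub>m k)) (osum A (block_mat b))"
    using congr_mult[OF Pc conn_carrier[OF Q1] Mc] e by simp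
  also have "\<dots> = blocks_mat (b # w)" using congr_osum[OF Qc one_carrier_mat A b(1)] Q(3) b(1) by simp
  finally show ?thesis using conn_mult[OF P Q1] Q(2) b(2) by (intro exI[of _ "P * osum Q (1\<^sub>m k)"] exI[of _ "b # w"]) auto
qed

text \<open>Multiplying by the adjugate exhibits det M as a combination of the entries of the last
  row.\<close>

lemma last_row_dvd_det: fixes M :: "'a::idom mat"
  assumes "M \<in> carrier_mat (Suc n) (Suc n)" "\<And>j. j < Suc n \<Longrightarrow> g dvd M $$ (n, j)"
  shows "g dvd det M"
proof -
  have "det M = (M * adj_mat M) $$ (n, n)" using adj_mat[OF assms(1)] by simp
  also have "\<dots> = (\<Sum>j<Suc n. M $$ (n, j) * adj_mat M $$ (j, n))"
    using assms(1) adj_mat(1)[OF assms(1)] by (simp add: scalar_prod_def atLeast0LessThan del: sum.lessThan_Suc)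
  also have "g dvd \<dots>" by (rule dvd_sum) (use assms(2) in auto)
  finally show ?thesis .
qed

lemma mult_last_col: fixes A :: "'a::comm_ring_1 mat"
  assumes "A \<in> carrier_mat n n" "B \<in> carrier_mat n n" "\<And>i. i < n \<Longrightarrow> B $$ (i, j) = 1\<^sub>m n $$ (i, j)" "i < n" "j < n"
  shows "(A * B) $$ (i, j) = A $$ (i, j)"
proof -
  have "(A * B) $$ (i, j) = (\<Sum>k<n. A $$ (i, k) * 1\<^sub>m n $$ (k, j))"
    using assms by (simp add: scalar_prod_def atLeast0LessThan)
  also have "\<dots> = (\<Sum>k<n. if k = j then A $$ (i, k) else 0)" by (rule sum.cong) (use assms in auto)
  finally show ?thesis using assms by simp
qed

text \<open>Euclidean reduction concentrates the products of the isotropic vector with the other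
  basis vectors in one entry g. As a divisor of the unit determinant, g is a unit, so the vector and
  its partner span a regular plane. The isotropic vector stays the last basis vector, which matters
  when the splitting serves to compare two given bases.\<close>

lemma isotropic_split: fixes M :: "'a::field poly mat"
  assumes sM: "symnd (Suc n') M" and z: "M $$ (n', n') = 0"
  obtains k P A c f where "n' = Suc k" "conn (Suc n') P" "\<And>i. i < Suc n' \<Longrightarrow> P $$ (i, n') = 1\<^sub>m (Suc n') $$ (i, n')"
    "A \<in> carrier_mat k k" "c dvd 1" "congr P M = osum A (mat2 f c c 0)"
proof -
  have Mc: "M \<in> carrier_mat (Suc n') (Suc n')" "M\<^sup>T = M" "det M dvd 1" using sM by (auto simp: symnd_def)
  have d0: "det M \<noteq> 0" using Mc(3) by auto
  obtain A r where A: "A \<in> carrier_mat n' n'" "r \<in> carrier_mat n' 1"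
    "A\<^sup>T = A" "M = four_block_mat A r (r\<^sup>T) (mat1 0)" using sym_split1[OF Mc(1,2)] z by metis
  have "n' \<noteq> 0"
  proof
    assume "n' = 0"
    then have "M = mat1 0" using mat1_eq[of M] Mc z by simp
    then show False using d0 by simp
  qed
  then obtain m where m: "n' = Suc m" by (cases n') auto
  obtain S where S: "conn n' S" "\<And>j. j < m \<Longrightarrow> (S\<^sup>T * r) $$ (j, 0) = 0"
    using conn_euclid[of r m] A(2) m by auto
  have Sc: "S \<in> carrier_mat n' n'" using S(1) conn_carrier by blast
  define S1 where "S1 = osum S (1\<^sub>m 1)"
  have S1: "conn (Suc n') S1" unfolding S1_def using conn_osum[OF S(1) conn_one[of 1]] by simp
  define r' where "r' = S\<^sup>T * r"
  have r'c: "r' \<in> carrier_mat n' 1" unfolding r'_def using Sc A by auto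
  define N' where "N' = congr S1 M"
  have N': "N' = four_block_mat (congr S A) r' (r'\<^sup>T) (mat1 0)"
    unfolding N'_def S1_def A(4)
    using congr_block[OF Sc one_carrier_mat[of 1] A(1,2) mat1_carrier(1), of 0] A r'c
    by (simp add: r'_def[symmetric])
  have CC: "congr S A \<in> carrier_mat n' n'" using Sc A by simp
  have N'c: "N' \<in> carrier_mat (m + 2) (m + 2)" unfolding N' using four_block_carrier_mat[OF CC mat1_carrier(1)] m by simp
  have N's: "N'\<^sup>T = N'" unfolding N'_def using congr_sym[OF conn_carrier[OF S1]] Mc by simp
  have detN': "det N' = det M" unfolding N'_def
    using congr_det[OF conn_carrier[OF S1]] Mc conn_det[OF S1] by simp
  define f where "f = congr S A $$ (m, m)"
  define g where "g = r' $$ (m, 0)"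
  have "N' $$ (m, m) = f" "N' $$ (m, Suc m) = g" "N' $$ (Suc m, Suc m) = 0"
    using CC r'c m unfolding N' f_def g_def by simp_all
  then obtain A2 B where AB: "A2 \<in> carrier_mat m m" "B \<in> carrier_mat m 2"
    "N' = four_block_mat A2 B (B\<^sup>T) (mat2 f g g 0)" using sym_split2[OF N'c N's] by metis
  have "g dvd det N'"
  proof (rule last_row_dvd_det[of _ "Suc m"])
    fix j assume "j < Suc (Suc m)"
    then consider "j < m" | "j = m" | "j = Suc m" by linarith
    then show "g dvd N' $$ (Suc m, j)"
      by cases (use CC r'c m S(2)[of j] in \<open>auto simp: N' g_def r'_def[symmetric]\<close>)
  qed (use N'c in auto)
  then have gu: "g dvd 1" using detN' Mc(3) dvd_trans by metis
  then obtain g' where g': "g * g' = 1" by (metis dvdE)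
  then have g'2: "g' * g = 1" by (simp add: mult.commute)
  have g'3: "g * (f * (g' * g')) = f * g'" using arg_cong[OF g', of "\<lambda>x. f * g' * x"] by (simp add: ac_simps)
  \<comment> \<open>The inverse of [[f, g], [g, 0]].\<close>
  define E' where "E' = mat2 0 g' g' (- f * g' * g')"
  let ?L = "lower_unip m 2 (- (E' * B\<^sup>T))"
  have so: "congr ?L N' = osum (A2 - B * E' * B\<^sup>T) (block_mat (Two g f))"
    unfolding AB(3) block_mat.simps
    by (rule split_off) (use AB g' g'2 g'3 in \<open>auto simp: E'_def mat2_one algebra_simps\<close>)
  have EB: "E' * B\<^sup>T \<in> carrier_mat 2 m" unfolding E'_def
    using AB(2) by (intro mult_carrier_mat[of _ 2 2]) auto
  have L: "conn (Suc n') ?L" using conn_lower_unip[of "- (E' * B\<^sup>T)" 2 m] EB m by simp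
  have BEB: "A2 - B * E' * B\<^sup>T \<in> carrier_mat m m" using AB EB
    unfolding E'_def by (intro minus_carrier_mat mult_carrier_mat[of _ _ 2]) auto
  have e: "congr (S1 * ?L) M = osum (A2 - B * E' * B\<^sup>T) (mat2 f g g 0)"
    using so congr_mult[OF conn_carrier[OF S1] conn_carrier[OF L] Mc(1)] by (simp add: N'_def)
  have Lcol: "?L $$ (i, n') = 1\<^sub>m (Suc n') $$ (i, n')" if "i < Suc n'" for i
    using that EB m by (auto simp: lower_unip_def)
  have col: "(S1 * ?L) $$ (i, n') = 1\<^sub>m (Suc n') $$ (i, n')" if "i < Suc n'" for i
  proof -
    have "(S1 * ?L) $$ (i, n') = S1 $$ (i, n')"
      by (rule mult_last_col[OF conn_carrier[OF S1] conn_carrier[OF L] Lcol]) (use that in auto)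
    then show ?thesis using that Sc by (auto simp: S1_def osum_def)
  qed
  show ?thesis by (rule that[OF m conn_mult[OF S1 L] col BEB gu e])
qed

text \<open>When the determinant is a unit, the degree bound of \<open>hermite_small\<close> leaves
  an isotropic last vector or one whose value has degree 0 and is a unit.\<close>

lemma blocks_exist_poly: fixes M :: "'a::field poly mat"
  assumes "symnd n M"
  shows "\<exists>P w. conn n P \<and> (\<forall>b\<in>set w. block_ok b) \<and> congr P M = blocks_mat w"
  using assms
proof (induction n arbitrary: M rule: less_induct)
  case (less n)
  have Mc: "M \<in> carrier_mat n n" "M\<^sup>T = M" "det M dvd 1" using less.prems by (auto simp: symnd_def)
  show ?case
  proof (cases n)
    case 0
    then have "M = 0\<^sub>m 0 0" using Mc by auto
    then show ?thesis using 0 by (intro exI[of _ "1\<^sub>m 0"] exI[of _ "[]"]) (auto simp: congr_def)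
  next
    case (Suc n')
    have d: "degree (det M) = 0" "det M \<noteq> 0" using Mc(3) by (auto simp: poly_dvd_1)
    obtain P where P: "conn n P" "congr P M $$ (n', n') = 0 \<or> Suc n' * degree (congr P M $$ (n', n')) \<le> degree (det M)"
      using hermite_small[of M n'] Mc d(2) Suc by auto
    define x where "x = congr P M $$ (n', n')"
    define N where "N = congr P M"
    have Pc: "P \<in> carrier_mat n n" using P conn_carrier by blast
    have sN: "symnd (Suc n') N" unfolding N_def using symnd_congr[OF less.prems Pc] conn_det[OF P(1)] Suc by simp
    show ?thesis
    proof (cases "x = 0")
      case False
      then have "degree x = 0" using P(2) d(1) by (simp add: x_def)
      then have xu: "x dvd 1" using False by (simp add: poly_dvd_1)
      then obtain R A where R: "R \<in> carrier_mat 1 n'" "A \<in> carrier_mat n' n'" "congr (lower_unip n' 1 R) N = osum A (mat1 x)"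
        using anisotropic_split[OF sN] unfolding x_def N_def by metis
      have L: "conn n (lower_unip n' 1 R)" using conn_lower_unip[OF R(1)] Suc by simp
      have e: "congr (P * lower_unip n' 1 R) M = osum A (block_mat (One x))"
        using congr_mult[OF Pc conn_carrier[OF L] Mc(1)] R(3) by (simp add: N_def)
      show ?thesis
        by (rule symnd_blocks_step[OF conn_mult[OF P(1) L] less.prems _ R(2) _ _ e]) (use Suc xu less.IH[of n'] in auto)
    next
      case True
      then obtain k L A2 c f where L: "n' = Suc k" "conn (Suc n') L" "A2 \<in> carrier_mat k k" "c dvd 1"
        "congr L N = osum A2 (mat2 f c c 0)" using isotropic_split[OF sN] unfolding N_def x_def by metis
      have L2: "conn n L" using L Suc by simp
      have e: "congr (P * L) M = osum A2 (block_mat (Two c f))"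
        using congr_mult[OF Pc conn_carrier[OF L2] Mc(1)] L(5) by (simp add: N_def)
      show ?thesis
        by (rule symnd_blocks_step[OF conn_mult[OF P(1) L2] less.prems _ L(3) _ _ e]) (use Suc L less.IH[of k] in auto)
    qed
  qed
qed

section \<open>Rational functions and their sum\<close>

text \<open>Stated by vanishing coefficients, the bound is inherited by sums without a case
  distinction for zero, and the bound 0 means p = 0, as points of degree 0 require.\<close>

definition deg_lt :: "'a::zero poly \<Rightarrow> nat \<Rightarrow> bool" where "deg_lt p n \<longleftrightarrow> (\<forall>i\<ge>n. coeff p i = 0)"

lemma deg_lt_iff: "deg_lt p n \<longleftrightarrow> p = 0 \<or> degree p < n"
  unfolding deg_lt_def
  by (metis coeff_eq_0 coeff_0 degree_0 leading_coeff_0_iff leI order_less_le_trans)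

lemma deg_lt_simps[simp]: "deg_lt 0 n" "deg_lt p 0 \<longleftrightarrow> p = 0"
  by (auto simp: deg_lt_iff)

lemma deg_lt_1[simp]: "deg_lt (1::'a::comm_semiring_1 poly) (Suc n)"
  by (simp add: deg_lt_iff)

lemma deg_lt_add: "deg_lt p n \<Longrightarrow> deg_lt q n \<Longrightarrow> deg_lt (p + q :: 'a::comm_ring_1 poly) n"
  and deg_lt_diff: "deg_lt p n \<Longrightarrow> deg_lt q n \<Longrightarrow> deg_lt (p - q :: 'a::comm_ring_1 poly) n"
  and deg_lt_minus: "deg_lt p n \<Longrightarrow> deg_lt (- p :: 'a::comm_ring_1 poly) n"
  and deg_lt_smult: "deg_lt p n \<Longrightarrow> deg_lt (smult c p :: 'a::comm_ring_1 poly) n"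
  by (auto simp: deg_lt_def)

lemma deg_lt_mono: "deg_lt p m \<Longrightarrow> m \<le> n \<Longrightarrow> deg_lt p n"
  by (auto simp: deg_lt_def)

lemma deg_lt_mult: assumes "deg_lt p m" "deg_lt q n" "m + n \<le> Suc k" shows "deg_lt (p * q :: 'a::comm_ring_1 poly) k"
  unfolding deg_lt_def
proof (intro allI impI)
  fix i assume i: "k \<le> i"
  have "coeff p j * coeff q (i - j) = 0" if "j \<le> i" for j
  proof (cases "j \<ge> m")
    case False
    then have "i - j \<ge> n" using assms(3) i by linarith
    then show ?thesis using assms(2) by (simp add: deg_lt_def)
  qed (use assms(1) in \<open>simp add: deg_lt_def\<close>)
  then show "coeff (p * q) i = 0" by (simp add: coeff_mult)
qed

lemma deg_lt_mult_monic: fixes A :: "'a::idom poly"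
  assumes "coeff A n = 1" "deg_lt A (Suc n)" "deg_lt (A * U) (n + k)" shows "deg_lt U k"
proof (cases "U = 0")
  case False
  have A: "A \<noteq> 0" using assms(1) by auto
  moreover have "degree A = n" using assms A
    by (metis deg_lt_iff le_degree less_Suc_eq_le le_antisym zero_neq_one)
  ultimately have "n + degree U < n + k" using assms(3) False by (simp add: deg_lt_iff degree_mult_eq)
  then show ?thesis by (simp add: deg_lt_iff)
qed simp

text \<open>All entries of the matrix with columns (A, B) and (-V, U). For n = 0 this matrix is the identity, so U = 1
violates the general degree bound.\<close>

definition bez_point :: "nat \<Rightarrow> 'a::idom poly \<Rightarrow> 'a poly \<Rightarrow> 'a poly \<Rightarrow> 'a poly \<Rightarrow> bool" where
  "bez_point n A B U V \<longleftrightarrow> coeff A n = 1 \<and> deg_lt A (Suc n) \<and> deg_lt B n \<and> A * U + B * V = 1 \<and>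
     deg_lt V n \<and> (if n = 0 then U = 1 else deg_lt U (n - 1))"

lemma monic_iff: "lead_coeff A = 1 \<and> degree A = n \<longleftrightarrow> coeff A n = (1::'a::idom) \<and> deg_lt A (Suc n)"
proof
  assume *: "coeff A n = 1 \<and> deg_lt A (Suc n)"
  then have "A \<noteq> 0" by auto
  then have "degree A = n" using * by (metis deg_lt_iff le_degree less_Suc_eq_le le_antisym zero_neq_one)
  then show "lead_coeff A = 1 \<and> degree A = n" using * by simp
qed (auto simp: deg_lt_iff)

lemma bez_point_0: "bez_point 0 A B U V \<longleftrightarrow> A = 1 \<and> B = 0 \<and> U = 1 \<and> V = 0"
proof -
  have "A = 1" if "coeff A 0 = 1" "deg_lt A (Suc 0)"
    by (rule poly_eqI) (use that in \<open>auto simp: deg_lt_def coeff_1 gr0_conv_Suc\<close>)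
  then show ?thesis by (auto simp: bez_point_def)
qed

lemma bez_bounds_iff: "bez_bounds n U V \<longleftrightarrow> deg_lt U (n - 1) \<and> deg_lt V n"
  unfolding bez_bounds_def deg_lt_iff by auto

lemma ratfun_iff: "ratfun n (A, B) \<longleftrightarrow> (\<exists>U V. bez_point n A B U V)"
proof (cases "n = 0")
  case True
  have "A = 1" if "coeff A 0 = 1" "deg_lt A (Suc 0)"
    by (rule poly_eqI) (use that in \<open>auto simp: deg_lt_def coeff_1 gr0_conv_Suc\<close>)
  then show ?thesis unfolding ratfun_def using True monic_iff[of A 0] by (auto simp: bez_point_0)
next
  case False
  then show ?thesis unfolding ratfun_def bez_point_def bez_bounds_iff using monic_iff[of A n] by (auto simp: deg_lt_iff[of B])
qed

lemma ratfun_cases: assumes "ratfun n f" obtains A B U V where "f = (A, B)" "bez_point n A B U V"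
  using assms ratfun_iff by (metis surj_pair)

text \<open>B is invertible modulo A, so two choices of V differ by a multiple of A; the degree of
  the difference is too small for a nonzero multiple.\<close>

lemma bez_point_unique: assumes "bez_point n A B U V" "bez_point n A B U' V'" shows "U = U' \<and> V = V'"
proof (cases "n = 0")
  case False
  have e: "A * U + B * V = 1" "A * U' + B * V' = 1" using assms by (auto simp: bez_point_def)
  have "V' - V = A * (U * (V' - V) + V * (U - U'))"
  proof -
    have "A * (U * (V' - V) + V * (U - U')) = (A * U) * (V' - V) + V * (A * U - A * U')" by (simp add: algebra_simps)
    also have "A * U - A * U' = B * V' - B * V" using e by (simp add: algebra_simps)
    also have "(A * U) * (V' - V) + V * (B * V' - B * V) = (A * U + B * V) * (V' - V)" by (simp add: algebra_simps)
    finally show ?thesis using e by simp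
  qed
  moreover have "deg_lt (V' - V) (n + 0)" using assms by (simp add: bez_point_def deg_lt_diff)
  ultimately have "deg_lt (U * (V' - V) + V * (U - U')) 0"
    using deg_lt_mult_monic[of A n] assms unfolding bez_point_def by metis
  then have V: "V' = V" using \<open>V' - V = _\<close> by simp
  then have "A * U = A * U'" using e by (metis add_right_cancel)
  moreover have "A \<noteq> 0" using assms by (auto simp: bez_point_def)
  ultimately show ?thesis using V by simp
qed (use assms in \<open>simp add: bez_point_0\<close>)

lemma bez_UV_eq: assumes "bez_point n A B U V" shows "bez_UV (A, B) = (U, V)"
proof -
  have d: "degree A = n" using assms monic_iff[of A n] by (auto simp: bez_point_def)
  show ?thesis
  proof (cases "n = 0")
    case True
    then show ?thesis using assms by (auto simp: bez_point_0 bez_UV_def)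
  next
    case False
    have "(THE (U, V). A * U + B * V = 1 \<and> bez_bounds n U V) = (U, V)"
    proof (rule the_equality)
      show "case (U, V) of (U, V) \<Rightarrow> A * U + B * V = 1 \<and> bez_bounds n U V"
        using assms False by (simp add: bez_point_def bez_bounds_iff)
      fix UV assume *: "case UV of (U, V) \<Rightarrow> A * U + B * V = 1 \<and> bez_bounds n U V"
      obtain U' V' where UV: "UV = (U', V')" by (cases UV)
      have "bez_point n A B U' V'" using * UV assms False by (simp add: bez_point_def bez_bounds_iff)
      then show "UV = (U, V)" using bez_point_unique assms UV by blast
    qed
    then show ?thesis using False d by (simp add: bez_UV_def)
  qed
qed

lemma oplusN_eq: assumes "bez_point n A1 B1 U1 V1"
  shows "oplusN (A1, B1) (A2, B2) = (A1 * A2 - V1 * B2, B1 * A2 + U1 * B2)"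
  using bez_UV_eq[OF assms] by (simp add: oplusN_def)

text \<open>The Bezout relation says that the associated matrix has determinant 1, which is
  multiplicative.\<close>

lemma bez_point_oplus: assumes 1: "bez_point m A1 B1 U1 V1" and 2: "bez_point n A2 B2 U2 V2"
  shows "bez_point (m + n) (A1 * A2 - V1 * B2) (B1 * A2 + U1 * B2) (U1 * U2 - B1 * V2) (A1 * V2 + V1 * U2)"
proof -
  note d1 = 1[unfolded bez_point_def] and d2 = 2[unfolded bez_point_def]
  have "(A1 * A2 - V1 * B2) * (U1 * U2 - B1 * V2) + (B1 * A2 + U1 * B2) * (A1 * V2 + V1 * U2) =
    (A1 * U1 + B1 * V1) * (A2 * U2 + B2 * V2)" by (simp add: algebra_simps)
  then have det: "(A1 * A2 - V1 * B2) * (U1 * U2 - B1 * V2) + (B1 * A2 + U1 * B2) * (A1 * V2 + V1 * U2) = 1"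
    using d1 d2 by simp
  \<comment> \<open>A summand of degree 0 has U = 1, so its bound is 1 and not the truncated
    difference.\<close>
  have U1: "deg_lt U1 (if m = 0 then 1 else m - 1)" and U2: "deg_lt U2 (if n = 0 then 1 else n - 1)"
    using d1 d2 by (auto split: if_splits)
  have VB: "deg_lt (V1 * B2) (m + n)" by (rule deg_lt_mult[of _ m _ n]) (use d1 d2 in auto)
  have AA: "deg_lt (A1 * A2) (Suc (m + n))" by (rule deg_lt_mult[of _ "Suc m" _ "Suc n"]) (use d1 d2 in auto)
  have lc: "coeff (A1 * A2) (m + n) = 1"
  proof -
    have "lead_coeff A1 = 1 \<and> degree A1 = m" "lead_coeff A2 = 1 \<and> degree A2 = n"
      using d1 d2 monic_iff by blast+
    then show ?thesis using coeff_mult_degree_sum[of A1 A2] d1 d2 by simp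
  qed
  have BA: "deg_lt (B1 * A2) (m + n)" by (rule deg_lt_mult[of _ m _ "Suc n"]) (use d1 d2 in auto)
  have UB: "deg_lt (U1 * B2) (m + n)" by (rule deg_lt_mult[OF U1, of _ n]) (use d2 in auto)
  have AV: "deg_lt (A1 * V2) (m + n)" by (rule deg_lt_mult[of _ "Suc m" _ n]) (use d1 d2 in auto)
  have VU: "deg_lt (V1 * U2) (m + n)" by (rule deg_lt_mult[OF _ U2, of _ m]) (use d1 in auto)
  have UU: "deg_lt (U1 * U2) (m + n - 1)" if "m + n \<noteq> 0" by (rule deg_lt_mult[OF U1 U2]) (use that in auto)
  have BV: "deg_lt (B1 * V2) (m + n - 1)" by (rule deg_lt_mult[of _ m _ n]) (use d1 d2 in auto)
  show ?thesis
  proof (cases "m + n = 0")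
    case True
    then show ?thesis using 1 2 by (simp add: bez_point_0)
  next
    case False
    have "coeff (V1 * B2) (m + n) = 0" using VB by (simp add: deg_lt_def)
    then show ?thesis unfolding bez_point_def using det lc False AA UU[OF False] BV
      by (auto intro!: deg_lt_add deg_lt_diff AV VU BA UB deg_lt_mono[OF VB])
  qed
qed

lemma ratfun_oplusN: "ratfun m f \<Longrightarrow> ratfun n g \<Longrightarrow> ratfun (m + n) (oplusN f (g :: 'a::idom poly \<times> 'a poly))"
  by (elim ratfun_cases) (auto simp: oplusN_eq ratfun_iff intro!: exI bez_point_oplus)

text \<open>Associativity of the matrix product, applied to the first column of the third
  factor.\<close>

lemma oplusN_assoc: fixes f :: "'a::idom poly \<times> 'a poly" assumes "ratfun l f" "ratfun m g" "ratfun n h"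
  shows "oplusN (oplusN f g) h = oplusN f (oplusN g h)"
proof -
  from assms obtain A1 B1 U1 V1 A2 B2 U2 V2 A3 B3 where
    1: "f = (A1, B1)" "bez_point l A1 B1 U1 V1" and 2: "g = (A2, B2)" "bez_point m A2 B2 U2 V2" and 3: "h = (A3, B3)"
    by (elim ratfun_cases)
  show ?thesis unfolding 1(1) 2(1) 3 oplusN_eq[OF 1(2)] oplusN_eq[OF 2(2)] oplusN_eq[OF bez_point_oplus[OF 1(2) 2(2)]]
    by (simp add: algebra_simps)
qed

lemma bez_point_unit: "bez_point 0 1 0 1 0" by (simp add: bez_point_0)

lemma oplusN_unit_left: "oplusN (1, 0) f = (f :: 'a::idom poly \<times> 'a poly)"
  by (cases f) (simp add: oplusN_eq[OF bez_point_unit])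

text \<open>By uniqueness the images of U and V are the Bezout coefficients of the image point;
  hence the sum is natural in the ring and commutes with evaluation.\<close>

lemma bez_point_map: assumes "comm_ring_hom h" "bez_point n A B U V"
  shows "bez_point n (map_poly h A) (map_poly h B) (map_poly h U) (map_poly h V)"
proof -
  interpret comm_ring_hom h by fact
  interpret mh: map_poly_comm_ring_hom h ..
  have d: "deg_lt p k \<Longrightarrow> deg_lt (map_poly h p) k" for p k by (simp add: deg_lt_def)
  have "map_poly h (A * U + B * V) = 1" using assms by (simp add: bez_point_def)
  then show ?thesis using assms(2) d by (auto simp: bez_point_def mh.hom_add mh.hom_mult split: if_splits)
qed

lemma oplusN_map: fixes h :: "'a::idom \<Rightarrow> 'b::idom" assumes "comm_ring_hom h" "ratfun n (A1, B1)"
  shows "map_prod (map_poly h) (map_poly h) (oplusN (A1, B1) (A2, B2)) =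
    oplusN (map_poly h A1, map_poly h B1) (map_poly h A2, map_poly h B2)"
proof -
  interpret comm_ring_hom h by fact
  interpret mh: map_poly_comm_ring_hom h ..
  obtain U V where r: "bez_point n A1 B1 U V" using assms(2) ratfun_iff by blast
  show ?thesis unfolding oplusN_eq[OF r] oplusN_eq[OF bez_point_map[OF assms(1) r]]
    by (simp add: mh.hom_add mh.hom_mult mh.hom_minus)
qed

lemma comm_ring_hom_poly: "comm_ring_hom (\<lambda>c. poly c t)" ..

lemma ev_pt_oplusN: "ratfun n f \<Longrightarrow> ev_pt (t::'a::idom) (oplusN f g) = oplusN (ev_pt t f) (ev_pt t g)"
  using oplusN_map[OF comm_ring_hom_poly, of n _ _ t] by (cases f; cases g) (auto simp: ev_pt_def map_prod_def split: prod.splits)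

definition lift_pt :: "'a::comm_ring_1 poly \<times> 'a poly \<Rightarrow> 'a poly poly \<times> 'a poly poly" where
  "lift_pt f = map_prod (map_poly (\<lambda>c. [:c:])) (map_poly (\<lambda>c. [:c:])) f"

lemma ratfun_lift_pt: "ratfun n f \<Longrightarrow> ratfun n (lift_pt (f :: 'a::idom poly \<times> 'a poly))"
  by (elim ratfun_cases) (auto simp: lift_pt_def ratfun_iff intro!: exI bez_point_map const_hom.comm_ring_hom_axioms)

lemma ev_lift_pt[simp]: "ev_pt t (lift_pt f) = f"
  by (cases f) (simp add: ev_pt_def lift_pt_def map_poly_map_poly o_def)

section \<open>Naive homotopies of rational functions\<close>

lemma equivclp_map: assumes "\<And>x y. r x y \<Longrightarrow> equivclp s (F x) (F y)" "equivclp r x y" shows "equivclp s (F x) (F y)"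
  using assms(2)
proof (induction rule: equivclp_induct)
  case (step y z)
  then have "equivclp s (F y) (F z)" using assms(1) equivclp_sym by metis
  with step show ?case using equivclp_trans by metis
qed simp

lemma htpF_refl[simp]: "htpF n f f" by (simp add: htpF_def)
lemma htpF_sym: "htpF n f g \<Longrightarrow> htpF n g f" by (simp add: htpF_def equivclp_sym)
lemma htpF_trans[trans]: "htpF n f g \<Longrightarrow> htpF n g h \<Longrightarrow> htpF n f h" unfolding htpF_def by (rule equivclp_trans)

lemma htpF_step: "ratfun n h \<Longrightarrow> ev_pt 0 h = f \<Longrightarrow> ev_pt 1 h = g \<Longrightarrow> htpF n f g"
  unfolding htpF_def by (rule r_into_equivclp) blast

lemma htpF_map:
  "htpF m x y \<Longrightarrow> (\<And>h. ratfun m h \<Longrightarrow> equivclp s (F (ev_pt 0 h)) (F (ev_pt 1 h))) \<Longrightarrow> equivclp s (F x) (F y)"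
  unfolding htpF_def by (rule equivclp_map[where F = F]) auto

text \<open>A homotopy is added to a constant one over k[T]; naturality of the sum identifies the
  two ends.\<close>

lemma htpF_oplus_left: fixes g :: "'k::field poly \<times> 'k poly" assumes "ratfun n g" "htpF m f f'"
  shows "htpF (m + n) (oplusN f g) (oplusN f' g)"
proof -
  have step: "htpF (m + n) (oplusN (ev_pt 0 h) g) (oplusN (ev_pt 1 h) g)" if "ratfun m h" for h
    by (rule htpF_step[of _ "oplusN h (lift_pt g)"])
      (use that assms(1) in \<open>auto simp: ev_pt_oplusN intro: ratfun_oplusN ratfun_lift_pt\<close>)
  show ?thesis unfolding htpF_def[of "m + n"]
    by (rule htpF_map[OF assms(2), where F = "\<lambda>f. oplusN f g"]) (rule step[unfolded htpF_def])
qed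

lemma htpF_oplus_right: fixes f :: "'k::field poly \<times> 'k poly" assumes "ratfun m f" "htpF n g g'"
  shows "htpF (m + n) (oplusN f g) (oplusN f g')"
proof -
  have step: "htpF (m + n) (oplusN f (ev_pt 0 h)) (oplusN f (ev_pt 1 h))" if "ratfun n h" for h
    by (rule htpF_step[of _ "oplusN (lift_pt f) h"])
      (use that assms(1) in \<open>auto simp: ev_pt_oplusN[OF ratfun_lift_pt] intro: ratfun_oplusN ratfun_lift_pt\<close>)
  show ?thesis unfolding htpF_def[of "m + n"]
    by (rule htpF_map[OF assms(2), where F = "oplusN f"]) (rule step[unfolded htpF_def])
qed

lemma htpF_oplus: assumes "ratfun m f'" "ratfun n g" "htpF m f f'" "htpF n g g'"
  shows "htpF (m + n) (oplusN f g) (oplusN f' g')"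
  using htpF_oplus_left[OF assms(2,3)] htpF_oplus_right[OF assms(1,4)] htpF_trans by blast

section \<open>Sums of functions X/a\<close>

fun word_point :: "'k::field list \<Rightarrow> 'k poly \<times> 'k poly" where
  "word_point [] = (1, 0)"
| "word_point (a # xs) = oplusN ([:0, 1:], [:a:]) (word_point xs)"

definition all_nonzero :: "'k::zero list \<Rightarrow> bool" where "all_nonzero xs \<longleftrightarrow> 0 \<notin> set xs"

lemma all_nonzero_simps[simp]: "all_nonzero []" "all_nonzero (a # xs) \<longleftrightarrow> a \<noteq> 0 \<and> all_nonzero xs" "all_nonzero (xs @ ys) \<longleftrightarrow> all_nonzero xs \<and> all_nonzero ys"
  by (auto simp: all_nonzero_def)

lemma bez_point_const: fixes b :: "'a::idom" assumes "b * b' = 1" "coeff P n = 1" "deg_lt P (Suc n)" "0 < n"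
  shows "bez_point n P [:b:] 0 [:b':]"
  using assms mult.commute[of b b'] by (simp add: bez_point_def deg_lt_iff)

lemma bez_point_X: "(a::'k::field) \<noteq> 0 \<Longrightarrow> bez_point 1 [:0, 1:] [:a:] 0 [:1/a:]"
  by (rule bez_point_const) (auto simp: deg_lt_iff)

lemma word_point_Cons: "a \<noteq> 0 \<Longrightarrow> word_point xs = (A, B) \<Longrightarrow> word_point (a # xs) = ([:0, 1:] * A - smult (1/a) B, smult a A)"
  using oplusN_eq[OF bez_point_X, of a A B] by simp

lemma ratfun_X: "(a::'k::field) \<noteq> 0 \<Longrightarrow> ratfun 1 ([:0, 1:], [:a:])"
  unfolding ratfun_iff using bez_point_X by blast

lemma ratfun_word_point: "all_nonzero xs \<Longrightarrow> ratfun (length xs) (word_point xs)"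
proof (induction xs)
  case Nil
  then show ?case by (simp add: ratfun_iff bez_point_0)
next
  case (Cons a xs)
  then show ?case using ratfun_oplusN[OF ratfun_X, of a "length xs" "word_point xs"] by simp
qed

lemma word_point_append: "all_nonzero xs \<Longrightarrow> all_nonzero ys \<Longrightarrow> word_point (xs @ ys) = oplusN (word_point xs) (word_point ys)"
proof (induction xs)
  case Nil
  then show ?case by (simp add: oplusN_unit_left)
next
  case (Cons a xs)
  then show ?case using oplusN_assoc[OF ratfun_X ratfun_word_point ratfun_word_point, of a xs ys] by simp
qed

text \<open>Equal length and nonzero letters belong to the relation, so that chains of moves carry
  them along.\<close>

definition word_htp :: "'k::field list \<Rightarrow> 'k list \<Rightarrow> bool" where
  "word_htp xs ys \<longleftrightarrow> length xs = length ys \<and> all_nonzero xs \<and> all_nonzero ys \<and> htpF (length xs) (word_point xs) (word_point ys)"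

lemma word_htp_refl[simp]: "all_nonzero xs \<Longrightarrow> word_htp xs xs" by (simp add: word_htp_def)
lemma word_htp_sym: "word_htp xs ys \<Longrightarrow> word_htp ys xs" by (auto simp: word_htp_def intro: htpF_sym)
lemma word_htp_trans[trans]: "word_htp xs ys \<Longrightarrow> word_htp ys zs \<Longrightarrow> word_htp xs zs" by (auto simp: word_htp_def intro: htpF_trans)
lemma word_htp_all_nonzero: "word_htp xs ys \<Longrightarrow> all_nonzero xs \<and> all_nonzero ys" by (auto simp: word_htp_def)

lemma word_htp_append: "word_htp xs xs' \<Longrightarrow> word_htp ys ys' \<Longrightarrow> word_htp (xs @ ys) (xs' @ ys')"
proof -
  assume "word_htp xs xs'" "word_htp ys ys'"
  then have *: "length xs = length xs'" "all_nonzero xs" "all_nonzero xs'" "htpF (length xs) (word_point xs) (word_point xs')"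
    "length ys = length ys'" "all_nonzero ys" "all_nonzero ys'" "htpF (length ys) (word_point ys) (word_point ys')" by (auto simp: word_htp_def)
  have "ratfun (length xs) (word_point xs')" using ratfun_word_point[OF *(3)] *(1) by simp
  from htpF_oplus[OF this ratfun_word_point[OF *(6)] *(4,8)] show ?thesis
    using * by (simp add: word_htp_def word_point_append)
qed

lemma word_htp_Cons: "a \<noteq> 0 \<Longrightarrow> word_htp ys ys' \<Longrightarrow> word_htp (a # ys) (a # ys')"
  using word_htp_append[of "[a]" "[a]" ys ys'] by simp

lemma word_htp_head2: "word_htp [a, b] [a', b'] \<Longrightarrow> all_nonzero ys \<Longrightarrow> word_htp (a # b # ys) (a' # b' # ys)"
  using word_htp_append[of "[a, b]" "[a', b']" ys ys] by simp

text \<open>The fibres of the Bezout map in degree 2 are affine lines; this is a point of the fibre over M that depends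
polynomially on M and on the inverse of its determinant.\<close>

definition form2_point :: "'k::field mat \<Rightarrow> 'k poly \<times> 'k poly" where
  "form2_point M = (let \<alpha> = M $$ (0, 0); s = M $$ (0, 1); r = M $$ (1, 1); \<delta> = \<alpha> * r - s * s in
     ([: - (\<alpha> * \<alpha> / \<delta>), - (s * \<alpha> / \<delta>), 1 :], [: s, r :]))"

text \<open>For A = X^2 + p X + q and B = r X + s the Bezout matrix is [[p s - q r, s], [s, r]]. The
  values p = - s \<alpha> / \<delta> and q = - \<alpha>^2 / \<delta> solve p s - q r = \<alpha>,
  because \<alpha> r - s^2 = \<delta>; \<delta>' is the inverse of \<delta>.\<close>

lemma bez_point_form2_point: fixes \<alpha> s r \<delta>' :: "'a::idom" assumes "(\<alpha> * r - s * s) * \<delta>' = 1"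
  shows "bez_point 2 [: - (\<alpha> * \<alpha> * \<delta>'), - (s * \<alpha> * \<delta>'), 1 :] [: s, r :] [: - (r * r * \<delta>') :]
    [: (r * (- (s * \<alpha> * \<delta>')) - s) * \<delta>', r * \<delta>' :]"
proof -
  let ?p = "- (s * \<alpha> * \<delta>')" and ?q = "- (\<alpha> * \<alpha> * \<delta>')"
  have 1: "- (r * r * \<delta>') + r * (r * \<delta>') = 0" by simp
  have 2: "?p * (- (r * r * \<delta>')) + s * (r * \<delta>') + r * ((r * ?p - s) * \<delta>') = 0" by (simp add: algebra_simps)
  have "?q * (- (r * r * \<delta>')) + s * ((r * ?p - s) * \<delta>') =
      ((\<alpha> * r - s * s) * \<delta>') * ((\<alpha> * r) * \<delta>') - s * s * \<delta>'" by (simp add: algebra_simps)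
  also have "\<dots> = 1" using assms by (simp add: algebra_simps)
  finally have 3: "?q * (- (r * r * \<delta>')) + s * ((r * ?p - s) * \<delta>') = 1" .
  have "[: ?q, ?p, 1 :] * [: - (r * r * \<delta>') :] + [: s, r :] * [: (r * ?p - s) * \<delta>', r * \<delta>' :] =
     [: ?q * (- (r * r * \<delta>')) + s * ((r * ?p - s) * \<delta>'), ?p * (- (r * r * \<delta>')) + s * (r * \<delta>') + r * ((r * ?p - s) * \<delta>'),
       - (r * r * \<delta>') + r * (r * \<delta>') :]"
    by (simp add: algebra_simps)
  also have "\<dots> = 1" unfolding 1 2 3 by simp
  finally show ?thesis
    by (auto simp: bez_point_def deg_lt_iff numeral_2_eq_2)
qed

lemma map_poly_poly_pCons: "map_poly (\<lambda>c. poly c t) (pCons a p) = pCons (poly a t) (map_poly (\<lambda>c. poly c t) p)"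
  by (rule poly_eqI) (simp add: coeff_map_poly coeff_pCons split: nat.split)

lemma htpS_map:
  "htpS m x y \<Longrightarrow> (\<And>H. symnd m H \<Longrightarrow> equivclp s (F (ev_mat 0 H)) (F (ev_mat 1 H))) \<Longrightarrow> equivclp s (F x) (F y)"
  unfolding htpS_def by (rule equivclp_map[where F = F]) auto

text \<open>Over k[T] the inverse of the determinant is again a polynomial, so the formula applies
  to a whole family of matrices, and it commutes with evaluation.\<close>

lemma form2_point_htp: assumes "htpS 2 M N" shows "htpF 2 (form2_point M) (form2_point (N :: 'k::field mat))"
proof -
  have step: "htpF 2 (form2_point (ev_mat 0 H)) (form2_point (ev_mat 1 H))" if H: "symnd 2 H" for H :: "'k poly mat"
  proof -
    have Hc: "H \<in> carrier_mat 2 2" "H\<^sup>T = H" "det H dvd 1" using H by (auto simp: symnd_def)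
    define \<alpha> s r where "\<alpha> = H $$ (0, 0)" and "s = H $$ (0, 1)" and "r = H $$ (1, 1)"
    have "H $$ (1, 0) = s" unfolding s_def
      using Hc(1) arg_cong[OF Hc(2), of "\<lambda>M. M $$ (1, 0)"] by (subst (asm) index_transpose_mat) auto
    then have Hm: "H = mat2 \<alpha> s s r" using mat2_eq[OF Hc(1)] by (simp add: \<alpha>_def s_def r_def)
    then obtain \<delta>' where \<delta>': "(\<alpha> * r - s * s) * \<delta>' = 1" using Hc(3) by (metis dvdE mat2_det)
    let ?h = "([: - (\<alpha> * \<alpha> * \<delta>'), - (s * \<alpha> * \<delta>'), 1 :], [: s, r :])"
    have h: "ratfun 2 ?h" unfolding ratfun_iff using bez_point_form2_point[OF \<delta>'] by blast
    have e: "ev_pt t ?h = form2_point (ev_mat t H)" for t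
    proof -
      have "(poly \<alpha> t * poly r t - poly s t * poly s t) * poly \<delta>' t = 1"
        using arg_cong[OF \<delta>', of "\<lambda>p. poly p t"] by simp
      then have "poly \<delta>' t = 1 / (poly \<alpha> t * poly r t - poly s t * poly s t)"
        by (metis mult_zero_left nonzero_mult_div_cancel_left zero_neq_one)
      then show ?thesis unfolding Hm by (simp add: ev_pt_def form2_point_def map_poly_poly_pCons Let_def)
    qed
    show ?thesis by (rule htpF_step[OF h e e])
  qed
  show ?thesis unfolding htpF_def
    by (rule htpS_map[OF assms, where F = "form2_point"]) (rule step[unfolded htpF_def])
qed

text \<open>The order is reversed: the head of a word belongs to the last coordinate.\<close>

lemma word_point_form2_point: assumes "a \<noteq> 0" "c \<noteq> 0" shows "word_point [a, c] = form2_point (mat2 c 0 0 (a::'k::field))"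
proof -
  have "word_point [c] = ([:0, 1:], [:c:])" using word_point_Cons[of c "[]" 1 0] assms by (simp add: smult_one)
  then show ?thesis using word_point_Cons[of a "[c]"] assms by (simp add: form2_point_def)
qed

section \<open>Naive homotopies of symmetric matrices\<close>

lemma htpS_refl[simp]: "htpS n f f" by (simp add: htpS_def)
lemma htpS_sym: "htpS n f g \<Longrightarrow> htpS n g f" by (simp add: htpS_def equivclp_sym)
lemma htpS_trans[trans]: "htpS n f g \<Longrightarrow> htpS n g h \<Longrightarrow> htpS n f h" unfolding htpS_def by (rule equivclp_trans)

lemma htpS_step: "symnd n H \<Longrightarrow> ev_mat 0 H = f \<Longrightarrow> ev_mat 1 H = g \<Longrightarrow> htpS n f g"
  unfolding htpS_def by (rule r_into_equivclp) blast

lemma htpS_congr: assumes "symnd n M" "conn n P" shows "htpS n M (congr P (M :: 'k::field mat))"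
proof -
  obtain Q where Q: "Q\<in>carrier_mat n n" "det Q = 1" "ev_mat 0 Q = 1\<^sub>m n" "ev_mat 1 Q = P"
    using assms(2) unfolding conn_def by blast
  have M: "M \<in> carrier_mat n n" using assms(1) by (simp add: symnd_def)
  show ?thesis
    by (rule htpS_step[of _ "congr Q (lift_mat M)"])
      (use Q M symnd_congr[OF symnd_lift[OF assms(1)] Q(1)] in \<open>auto simp: ev_congr[of _ n n]\<close>)
qed

lemma htpS_osum: assumes "symnd m M'" "symnd n N" "htpS m M M'" "htpS n N (N' :: 'k::field mat)"
  shows "htpS (m + n) (osum M N) (osum M' N')"
proof -
  have 1: "htpS (m + n) (osum (ev_mat 0 H) N) (osum (ev_mat 1 H) N)" if "symnd m H" for H :: "'k poly mat"
    by (rule htpS_step[OF symnd_osum[OF that symnd_lift[OF assms(2)]]])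
      (use that assms(2) in \<open>auto simp: symnd_def ev_mat_osum[of _ m _ n]\<close>)
  have 2: "htpS (m + n) (osum M' (ev_mat 0 H)) (osum M' (ev_mat 1 H))" if "symnd n H" for H :: "'k poly mat"
    by (rule htpS_step[OF symnd_osum[OF symnd_lift[OF assms(1)] that]])
      (use that assms(1) in \<open>auto simp: symnd_def ev_mat_osum[of _ m _ n]\<close>)
  have "htpS (m + n) (osum M N) (osum M' N)" unfolding htpS_def[of "m + n"]
    by (rule htpS_map[OF assms(3), where F = "\<lambda>M. osum M N"]) (rule 1[unfolded htpS_def])
  moreover have "htpS (m + n) (osum M' N) (osum M' N')" unfolding htpS_def[of "m + n"]
    by (rule htpS_map[OF assms(4), where F = "osum M'"]) (rule 2[unfolded htpS_def])
  ultimately show ?thesis by (rule htpS_trans)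
qed

section \<open>Binary forms and the elementary moves on words\<close>

lemma symnd_mat2: "symnd 2 (mat2 a b b d) \<longleftrightarrow> (a * d - b * b) dvd (1::'a::idom)"
  by (simp add: symnd_def)

lemma word_htp_of_htpS2: assumes "all_nonzero [a, d, a', d']" "htpS 2 (mat2 d 0 0 a) (mat2 d' 0 0 (a' :: 'k::field))"
  shows "word_htp [a, d] [a', d']"
  using assms form2_point_htp[OF assms(2)] by (simp add: word_htp_def word_point_form2_point numeral_2_eq_2 del: word_point.simps)

text \<open>The new basis has (1, 0), of value u, in last place and the orthogonal vector (c / u,
  -1) before it, scaled to give determinant 1.\<close>

lemma htpS_plane: assumes "c \<noteq> 0" "u \<noteq> (0::'k::field)"
  shows "htpS 2 (mat2 u c c 0) (mat2 (- (c * c / u)) 0 0 u)"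
proof -
  have "htpS 2 (mat2 u c c 0) (congr (mat2 (c / u) 1 (-1) 0) (mat2 u c c 0))"
    by (rule htpS_congr) (use assms conn_SL2[of "c / u" 0 1 "-1"] in \<open>auto simp: symnd_mat2 dvd_field_iff\<close>)
  also have "congr (mat2 (c / u) 1 (-1) 0) (mat2 u c c 0) = mat2 (- (c * c / u)) 0 0 u"
    using assms by (simp add: congr_def field_simps)
  finally show ?thesis .
qed

text \<open>The determinant -c^2 does not involve the corner entry, which may therefore move along a
  line, even through 0.\<close>

lemma htpS_plane_move: assumes "c \<noteq> 0" shows "htpS 2 (mat2 u c c 0) (mat2 v c c (0::'k::field))"
  by (rule htpS_step[of _ "mat2 [:u, v - u:] [:c:] [:c:] 0"])
    (use assms in \<open>auto simp: symnd_mat2 is_unit_const_poly_iff minus_pCons\<close>)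

text \<open>The words of all planes with the same c are joined by moving the corner entry. A base
  change need not achieve this: in characteristic 2 the values of the plane are u times
  squares.\<close>

lemma word_htp_plane: assumes "c \<noteq> 0" "u \<noteq> (0::'k::field)"
  shows "word_htp [u, - (c * c / u)] [1, - (c * c)]"
proof (rule word_htp_of_htpS2)
  have "htpS 2 (mat2 (- (c * c / u)) 0 0 u) (mat2 u c c 0)" using htpS_plane[OF assms] htpS_sym by blast
  also have "htpS 2 (mat2 u c c 0) (mat2 1 c c 0)" by (rule htpS_plane_move[OF assms(1)])
  also have "htpS 2 (mat2 1 c c 0) (mat2 (- (c * c / 1)) 0 0 1)" by (rule htpS_plane) (use assms in auto)
  finally show "htpS 2 (mat2 (- (c * c / u)) 0 0 u) (mat2 (- (c * c)) 0 0 1)" by simp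
qed (use assms in simp)

text \<open>The second column (g, x) is a vector of value b for the diagonal form with entries d, a;
  the first spans its orthogonal complement, scaled to give determinant 1.\<close>

definition rebase2 :: "'a::field \<Rightarrow> 'a \<Rightarrow> 'a \<Rightarrow> 'a \<Rightarrow> 'a mat" where
  "rebase2 a d g x = (let b = d * (g * g) + a * (x * x) in mat2 (a * x / b) g (- (d * g / b)) x)"

lemma rebase2: assumes b: "b = d * (g * g) + a * (x * x)" "b \<noteq> (0::'k::field)"
  shows "rebase2 a d g x = mat2 (a * x / b) g (- (d * g / b)) x" "conn 2 (rebase2 a d g x)"
    "congr (rebase2 a d g x) (mat2 d 0 0 a) = mat2 (d * a / b) 0 0 b"
proof -
  show r: "rebase2 a d g x = mat2 (a * x / b) g (- (d * g / b)) x" by (simp add: rebase2_def Let_def b(1))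
  have "a * x / b * x - g * (- (d * g / b)) = (d * (g * g) + a * (x * x)) / b" by (simp add: field_simps add_divide_distrib)
  then show "conn 2 (rebase2 a d g x)" unfolding r by (intro conn_SL2) (use b in simp)
  have "a * x / b * d * (a * x / b) + (- (d * g / b)) * a * (- (d * g / b)) = d * a * (d * (g * g) + a * (x * x)) / (b * b)"
    using b(2) by (simp add: field_simps)
  also have "\<dots> = d * a / b" unfolding b(1)[symmetric] using b(2) by simp
  finally have 1: "a * x / b * d * (a * x / b) + (- (d * g / b)) * a * (- (d * g / b)) = d * a / b" .
  show "congr (rebase2 a d g x) (mat2 d 0 0 a) = mat2 (d * a / b) 0 0 b"
    unfolding r using 1 b by (simp add: congr_def algebra_simps)
qed

text \<open>The elementary move of the chain equivalence: any nonzero value b of the binary form may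
  become the first letter, and the determinant then fixes the second.\<close>

lemma word_htp_move: assumes "all_nonzero [a, d]" and b: "b = d * (g * g) + a * (x * x)" "b \<noteq> (0::'k::field)"
  shows "word_htp [a, d] [b, d * a / b]"
proof (rule word_htp_of_htpS2)
  have "symnd 2 (mat2 d 0 0 a)" using assms(1) by (simp add: symnd_mat2 dvd_field_iff)
  then show "htpS 2 (mat2 d 0 0 a) (mat2 (d * a / b) 0 0 b)" using htpS_congr rebase2[OF b] by metis
qed (use assms in simp)

lemma word_htp_swap: "all_nonzero [a, d] \<Longrightarrow> word_htp [a, d] [d, a :: 'k::field]"
  using word_htp_move[of a d d 1 0] by simp

lemma word_htp_scale: "all_nonzero [a, d, x] \<Longrightarrow> word_htp [a, d] [a * (x * x), d / (x * x) :: 'k::field]"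
  using word_htp_move[of a d "a * (x * x)" 0 x] by simp

text \<open>Carries a square from the third letter to the first across a 1. A plane contributes the
  letters 1, -c^2; dividing its c by x has to rescale the second of them and leave the 1.\<close>

lemma word_htp_scale3: assumes "all_nonzero (a # e # x # ys)"
  shows "word_htp (a # 1 # e # ys) (a * (x * x) # 1 # e / (x * x) # (ys :: 'k::field list))"
proof -
  have "word_htp (a # 1 # e # ys) (1 # a # e # ys)" by (rule word_htp_head2[OF word_htp_swap]) (use assms in auto)
  also have "word_htp (1 # a # e # ys) (1 # a * (x * x) # e / (x * x) # ys)"
    by (rule word_htp_Cons[OF _ word_htp_head2[OF word_htp_scale]]) (use assms in auto)
  also have "word_htp (1 # a * (x * x) # e / (x * x) # ys) (a * (x * x) # 1 # e / (x * x) # ys)"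
    by (rule word_htp_head2[OF word_htp_swap]) (use assms in auto)
  finally show ?thesis .
qed

lemma word_htp_move_head: "all_nonzero (a # xs) \<Longrightarrow> word_htp (a # xs) (xs @ [a :: 'k::field])"
proof (induction xs)
  case (Cons b xs)
  have "word_htp (a # b # xs) (b # a # xs)" using word_htp_head2[OF word_htp_swap[of a b]] Cons.prems by simp
  also have "word_htp (b # a # xs) (b # (xs @ [a]))" by (rule word_htp_Cons) (use Cons in auto)
  finally show ?case by simp
qed simp

lemma word_htp_commute: "all_nonzero xs \<Longrightarrow> all_nonzero ys \<Longrightarrow> word_htp (xs @ ys) (ys @ xs :: 'k::field list)"
proof (induction xs arbitrary: ys)
  case (Cons a xs)
  have "word_htp (a # (xs @ ys)) ((xs @ ys) @ [a])" by (rule word_htp_move_head) (use Cons in auto)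
  also have "(xs @ ys) @ [a] = xs @ (ys @ [a])" by simp
  also have "word_htp (xs @ (ys @ [a])) ((ys @ [a]) @ xs)" by (rule Cons.IH) (use Cons.prems in auto)
  finally show ?case by simp
qed simp

section \<open>The Euclidean algorithm for rational functions\<close>

text \<open>Any Bezout relation can be normalized: V is reduced modulo A, and the bound on U follows
  by comparing degrees.\<close>

lemma ratfun_of_coprime: fixes A B :: "'k::field poly"
  assumes "coeff A n = 1" "deg_lt A (Suc n)" "0 < n" "deg_lt B n" "A * U + B * V = 1"
  shows "ratfun n (A, B)"
proof -
  define V' where "V' = V mod A"
  define U' where "U' = U + B * (V div A)"
  have A: "A \<noteq> 0" "degree A = n" using assms(1,2) monic_iff[of A n] by auto
  have V: "V = A * (V div A) + V'" by (simp add: V'_def)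
  have "A * U' + B * V' = A * U + B * (A * (V div A) + V')" by (simp add: U'_def algebra_simps)
  then have e: "A * U' + B * V' = 1" using V assms(5) by simp
  have dV: "deg_lt V' n" using degree_mod_less[OF A(1), of V] A by (auto simp: V'_def deg_lt_iff)
  have BV: "deg_lt (B * V') (n + (n - 1))" by (rule deg_lt_mult[OF assms(4) dV]) (use assms(3) in auto)
  have "deg_lt 1 (n + (n - 1))" using assms(3) by (simp add: deg_lt_iff)
  then have "deg_lt (1 - B * V') (n + (n - 1))" using BV deg_lt_diff by blast
  moreover have "A * U' = 1 - B * V'" using e by (simp add: algebra_simps)
  ultimately have "deg_lt U' (n - 1)" using deg_lt_mult_monic[OF assms(1,2), of U' "n - 1"] by simp
  then have "bez_point n A B U' V'" using assms e dV by (simp add: bez_point_def)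
  then show ?thesis unfolding ratfun_iff by blast
qed

lemma monic_split: fixes A :: "'a::comm_ring_1 poly" assumes "coeff A n = 1" "deg_lt A (Suc n)"
  obtains A0 where "A = monom 1 n + A0" "deg_lt A0 n"
proof
  show "A = monom 1 n + (A - monom 1 n)" by simp
  show "deg_lt (A - monom 1 n) n" unfolding deg_lt_def
  proof (intro allI impI)
    fix i assume "n \<le> i"
    then show "coeff (A - monom 1 n) i = 0" using assms by (cases "i = n") (auto simp: deg_lt_def)
  qed
qed

text \<open>A constant unit denominator is coprime to every numerator, so the lower coefficients of
  A can be scaled to 0 by the factor 1 - T.\<close>

lemma htpF_monic: fixes b :: "'k::field" assumes "coeff A n = 1" "deg_lt A (Suc n)" "0 < n" "b \<noteq> 0"
  shows "htpF n (A, [:b:]) (monom 1 n, [:b:])"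
proof -
  obtain A0 where A0: "A = monom 1 n + A0" "deg_lt A0 n" using monic_split[OF assms(1,2)] .
  let ?h = "(monom 1 n + smult [:1, -1:] (map_poly (\<lambda>c. [:c:]) A0), [:[:b:]:])"
  have d: "deg_lt (map_poly (\<lambda>c. [:c:]) A0) n" using A0(2) by (simp add: deg_lt_def coeff_map_poly)
  have d2: "deg_lt (smult [:1, -1:] (map_poly (\<lambda>c. [:c:]) A0)) n" by (rule deg_lt_smult[OF d])
  have "bez_point n (monom 1 n + smult [:1, -1:] (map_poly (\<lambda>c. [:c:]) A0)) [:[:b:]:] 0 [:[:1/b:]:]"
  proof (rule bez_point_const)
    show "coeff (monom 1 n + smult [:1, -1:] (map_poly (\<lambda>c. [:c:]) A0)) n = 1"
      using d by (simp add: deg_lt_def)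
    show "deg_lt (monom 1 n + smult [:1, -1:] (map_poly (\<lambda>c. [:c:]) A0)) (Suc n)"
      by (rule deg_lt_add[OF _ deg_lt_mono[OF d2]]) (auto simp: deg_lt_def)
  qed (use assms in auto)
  then have h: "ratfun n ?h" unfolding ratfun_iff by blast
  have e: "ev_pt t ?h = (monom 1 n + smult (1 - t) A0, [:b:])" for t
    unfolding ev_pt_def prod.case
    by (intro arg_cong2[of _ _ _ _ Pair] poly_eqI) (auto simp: coeff_map_poly coeff_pCons algebra_simps split: nat.split)
  show ?thesis by (rule htpF_step[OF h]) (simp_all add: e A0(1))
qed

text \<open>Makes the Euclidean algorithm applicable to a constant denominator.\<close>

lemma htpF_denominator: fixes b :: "'k::field" assumes "2 \<le> n" "b \<noteq> 0"
  shows "htpF n (monom 1 n, [:b:]) (monom 1 n, [:b:] + monom 1 (n - 1))"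
proof -
  let ?B = "[:[:b:]:] + monom [:0, 1:] (n - 1)"
  \<comment> \<open>\<open>?V\<close> inverts b + T X^(n-1) modulo X^n: the geometric series stops
    after two terms because 2 (n - 1) \<ge> n, and \<open>?U\<close> takes up the next term.\<close>
  let ?U = "monom [:0, 0, 1 / (b * b):] (n - 2)" and ?V = "[:[:1 / b:]:] - monom [:0, 1 / (b * b):] (n - 1)"
  obtain m where m: "n = m + 2" using assms(1) by (metis add.commute le_Suc_ex)
  have "monom 1 n * ?U + ?B * ?V = 1"
  proof -
    have "monom (1::'k poly) n * ?U = monom [:0, 0, 1 / (b * b):] (n + (n - 2))" by (simp add: mult_monom)
    moreover have "?B * ?V = [:[:b:]:] * [:[:1 / b:]:] - [:[:b:]:] * monom [:0, 1 / (b * b):] (n - 1)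
       + [:[:1 / b:]:] * monom [:0, 1:] (n - 1) - monom [:0, 1:] (n - 1) * monom [:0, 1 / (b * b):] (n - 1)"
      by (simp only: algebra_simps)
    moreover have "[:[:b:]:] * [:[:1 / b:]:] = 1" using assms(2) by simp
    moreover have "[:[:b:]:] * monom [:0, 1 / (b * b):] (n - 1) = [:[:1 / b:]:] * monom [:0, 1:] (n - 1)"
      using assms(2) by (simp add: smult_monom)
    moreover have "monom [:0, 1::'k:] (n - 1) * monom [:0, 1 / (b * b):] (n - 1) = monom [:0, 0, 1 / (b * b):] (n + (n - 2))"
      by (simp add: mult_monom m)
    ultimately show ?thesis by simp
  qed
  then have "bez_point n (monom 1 n) ?B ?U ?V"
    unfolding bez_point_def using m
    by (auto simp: deg_lt_def coeff_pCons split: nat.split)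
  then have h: "ratfun n (monom 1 n, ?B)" unfolding ratfun_iff by blast
  have e: "ev_pt t (monom 1 n, ?B) = (monom 1 n, [:b:] + monom t (n - 1))" for t
    unfolding ev_pt_def prod.case
    by (intro arg_cong2[of _ _ _ _ Pair] poly_eqI) (auto simp: coeff_map_poly coeff_pCons algebra_simps split: nat.split)
  show ?thesis using htpF_step[OF h e e] by simp
qed

text \<open>Dividing A by the monic multiple A2 of B, with A = P A2 + R, writes A/B as the sum of
  P/b and A2/(-b R). Both summands have smaller degree exactly when 0 < deg B < n. A constant
  denominator is therefore changed to b + X^(n-1) beforehand, except in degree 1, where X/b is
  itself a letter.\<close>

lemma htpF_word_point: fixes f :: "'k::field poly \<times> 'k poly" assumes "ratfun n f"
  shows "\<exists>xs. length xs = n \<and> all_nonzero xs \<and> htpF n f (word_point xs)"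
  using assms
proof (induction n arbitrary: f rule: less_induct)
  case (less n)
  have euclid: "\<exists>xs. length xs = n \<and> all_nonzero xs \<and> htpF n (A, B) (word_point xs)"
    if r: "bez_point n A B U V" and dB: "0 < degree B" for A B U V :: "'k poly"
  proof -
    note rd = r[unfolded bez_point_def]
    define b where "b = lead_coeff B"
    define m where "m = degree B"
    have B0: "B \<noteq> 0" "b \<noteq> 0" using dB by (auto simp: b_def)
    have mn: "m < n" using rd B0 by (simp add: m_def deg_lt_iff)
    define A2 where "A2 = smult (1 / b) B"
    define P where "P = A div A2"
    define R where "R = A mod A2"
    define B2 where "B2 = smult (- b) R"
    have A2: "degree A2 = m" "coeff A2 m = 1" "A2 \<noteq> 0" using B0 by (auto simp: A2_def m_def b_def)
    have BA2: "B = smult b A2" using B0 by (simp add: A2_def)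
    have A: "A = P * A2 + R" by (simp add: P_def R_def)
    have An: "degree A = n" "A \<noteq> 0" using rd monic_iff[of A n] by auto
    have dR: "deg_lt R m" using degree_mod_less[OF A2(3), of A] A2(1) by (auto simp: R_def deg_lt_iff)
    have P0: "P \<noteq> 0" using A dR An mn by (auto simp: deg_lt_iff)
    have PA: "degree (P * A2) = degree P + m" using degree_mult_eq[OF P0 A2(3)] A2(1) by simp
    have dRA: "degree R < degree (P * A2) \<or> R = 0" using dR PA by (auto simp: deg_lt_iff)
    have "degree A = degree (P * A2)"
      using dRA A degree_add_eq_left[of R "P * A2"] by auto
    then have dP: "degree P = n - m" using PA An by simp
    have cP: "coeff P (n - m) = 1"
    proof -
      have "coeff A n = coeff (P * A2) n + coeff R n" unfolding A by simp
      moreover have "coeff R n = 0" using dR mn by (simp add: deg_lt_def)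
      moreover have "coeff (P * A2) n = coeff P (n - m) * coeff A2 m"
        using coeff_mult_degree_sum[of P A2] dP A2(1) mn by simp
      ultimately show ?thesis using rd A2(2) by simp
    qed
    have dP': "deg_lt P (Suc (n - m))" using dP by (simp add: deg_lt_iff)
    have rP: "bez_point (n - m) P [:b:] 0 [:1 / b:]"
      by (rule bez_point_const) (use B0 cP dP' mn in auto)
    have c: "A2 * (P * U + smult b V) + B2 * smult (- 1 / b) U = 1"
    proof -
      have "A2 * (P * U + smult b V) + B2 * smult (- 1 / b) U = A * U + B * V"
        unfolding A B2_def BA2 using B0 by (simp add: algebra_simps)
      then show ?thesis using rd by simp
    qed
    have r2: "ratfun m (A2, B2)"
      by (rule ratfun_of_coprime[OF A2(2) _ _ _ c])
        (use A2(1) dB dR in \<open>auto simp: deg_lt_iff[of A2] B2_def m_def intro: deg_lt_smult deg_lt_minus\<close>)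
    have e: "oplusN (P, [:b:]) (A2, B2) = (A, B)"
      unfolding oplusN_eq[OF rP] unfolding B2_def using A B0 BA2 by simp
    have r1: "ratfun (n - m) (P, [:b:])" unfolding ratfun_iff using rP by blast
    obtain xs where xs: "length xs = n - m" "all_nonzero xs" "htpF (n - m) (P, [:b:]) (word_point xs)"
      using less.IH[OF _ r1] mn dB m_def by auto
    obtain ys where ys: "length ys = m" "all_nonzero ys" "htpF m (A2, B2) (word_point ys)"
      using less.IH[OF mn r2] by auto
    have "htpF (n - m + m) (oplusN (P, [:b:]) (A2, B2)) (oplusN (word_point xs) (word_point ys))"
      by (rule htpF_oplus[OF _ r2 xs(3) ys(3)]) (use ratfun_word_point[OF xs(2)] xs(1) in simp)
    then have "htpF n (A, B) (word_point (xs @ ys))" using e mn xs ys by (simp add: word_point_append)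
    then show ?thesis using xs ys mn by (intro exI[of _ "xs @ ys"]) auto
  qed
  obtain A B U V where f: "f = (A, B)" and r: "bez_point n A B U V" using less.prems ratfun_cases by metis
  note rd = r[unfolded bez_point_def]
  show ?case
  proof (cases "n = 0")
    case True
    then show ?thesis using f r by (intro exI[of _ "[]"]) (simp add: bez_point_0)
  next
    case n: False
    show ?thesis
    proof (cases "degree B = 0")
      case False
      then show ?thesis using euclid[OF r] f by simp
    next
      case True
      then obtain b where b: "B = [:b:]" by (metis degree_eq_zeroE)
      have b0: "b \<noteq> 0"
      proof
        assume "b = 0"
        then have "A * U = 1" using rd b by simp
        then have "degree A = 0" by (metis degree_1 degree_mult_eq mult_zero_left mult_zero_right one_neq_zero add_is_0)
        then show False using rd monic_iff[of A n] n by auto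
      qed
      have h1: "htpF n f (monom 1 n, [:b:])" unfolding f b by (rule htpF_monic) (use rd n b0 in auto)
      show ?thesis
      proof (cases "n = 1")
        case True
        have "word_point [b] = (monom 1 n, [:b:])"
          using word_point_Cons[OF b0, of "[]" 1 0] True by (simp add: monom_altdef)
        then show ?thesis using h1 True b0 by (intro exI[of _ "[b]"]) (simp del: word_point.simps)
      next
        case False
        then have n2: "2 \<le> n" using n by simp
        let ?B = "[:b:] + monom 1 (n - 1)"
        have h2: "htpF n f (monom 1 n, ?B)" using h1 htpF_denominator[OF n2 b0] htpF_trans by blast
        have "coeff ?B (n - 1) \<noteq> 0" using n2 by (auto simp: coeff_pCons split: nat.split)
        then have "0 < degree ?B" using le_degree[of ?B "n - 1"] n2 by simp
        moreover have "ratfun n (monom 1 n, ?B)"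
        proof (rule ratfun_of_coprime)
          let ?V = "[:1 / b:] - monom (1 / (b * b)) (n - 1)"
          have "?B * ?V = [:b:] * [:1 / b:] - [:b:] * monom (1 / (b * b)) (n - 1)
            + [:1 / b:] * monom 1 (n - 1) - monom 1 (n - 1) * monom (1 / (b * b)) (n - 1)"
            by (simp only: algebra_simps)
          also have "\<dots> = 1 - monom (1 / (b * b)) (n + (n - 2))"
          proof -
            have "n - 1 + (n - 1) = n + (n - 2)" using n2 by simp
            then show ?thesis using b0 by (simp add: smult_monom mult_monom)
          qed
          finally show "monom 1 n * monom (1 / (b * b)) (n - 2) + ?B * ?V = 1" by (simp add: mult_monom)
          show "deg_lt ?B n" using n2 by (auto simp: deg_lt_def coeff_pCons split: nat.split)
        qed (use n2 in \<open>auto simp: deg_lt_def\<close>)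
        ultimately obtain xs where "length xs = n" "all_nonzero xs" "htpF n (monom 1 n, ?B) (word_point xs)"
          using euclid unfolding ratfun_iff by blast
        then show ?thesis using h2 htpF_trans by blast
      qed
    qed
  qed
qed

section \<open>Bezout matrices\<close>

text \<open>The coefficient of Y^(q-1) in the Bezout form, for q > 0. It comes from A(X) B(Y) - A(Y)
  B(X) = B(X) (A(X) - A(Y)) - A(X) (B(X) - B(Y)), as \<open>poly_shift q A\<close> is the
  coefficient of Y^(q-1) in (A(X) - A(Y)) / (X - Y). The index is shifted by one so that the
  recursion starts with 0 at q = 0.\<close>

definition bez_coeff :: "'a::comm_ring_1 poly \<Rightarrow> 'a poly \<Rightarrow> nat \<Rightarrow> 'a poly" where
  "bez_coeff A B q = B * poly_shift q A - A * poly_shift q B"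

lemma poly_shift_rec: "[:0, 1:] * poly_shift (Suc q) A = poly_shift q A - [:coeff A q:]"
  for A :: "'a::comm_ring_1 poly"
  by (rule poly_eqI) (simp add: coeff_poly_shift coeff_pCons split: nat.split)

lemma poly_shift_0_left: "poly_shift 0 A = A"
  by (rule poly_eqI) (simp add: coeff_poly_shift)

lemma bez_coeff_0: "bez_coeff A B 0 = 0"
  by (simp add: bez_coeff_def poly_shift_0_left)

text \<open>Multiplication of the Bezout form by X - Y, compared in powers of Y.\<close>

lemma bez_coeff_rec: "[:0, 1:] * bez_coeff A B (Suc q) = bez_coeff A B q + smult (coeff B q) A - smult (coeff A q) B"
proof -
  have "[:0, 1:] * bez_coeff A B (Suc q) = B * ([:0, 1:] * poly_shift (Suc q) A) - A * ([:0, 1:] * poly_shift (Suc q) B)"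
    unfolding bez_coeff_def by (simp only: algebra_simps)
  then show ?thesis unfolding poly_shift_rec bez_coeff_def by (simp add: algebra_simps)
qed

lemma bez_coeff_coeff_Suc: "coeff (bez_coeff A B (Suc q)) p = coeff (bez_coeff A B q) (Suc p) + coeff B q * coeff A (Suc p) - coeff A q * coeff B (Suc p)"
  using arg_cong[OF bez_coeff_rec[of A B q], of "\<lambda>P. coeff P (Suc p)"] by simp

lemma bez_coeff_coeff_0: "coeff (bez_coeff A B q) 0 = coeff A q * coeff B 0 - coeff B q * coeff A 0"
  using arg_cong[OF bez_coeff_rec[of A B q], of "\<lambda>P. coeff P 0"] by (simp add: algebra_simps eq_diff_eq add_eq_0_iff)

text \<open>The recursion trades one index for the other, and both sides of the equation receive the
  same correction when it is applied to them.\<close>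

lemma bez_coeff_sym: "coeff (bez_coeff A B (Suc q)) p = coeff (bez_coeff A B (Suc p)) q"
proof (induction q arbitrary: p)
  case 0
  then show ?case by (simp add: bez_coeff_coeff_Suc bez_coeff_coeff_0 bez_coeff_0 mult.commute)
next
  case (Suc q)
  show ?case using Suc[of "Suc p"] bez_coeff_coeff_Suc[of A B "Suc q" p] bez_coeff_coeff_Suc[of A B "Suc p" q]
    by (simp add: mult.commute)
qed

lemma bez_poly_coeff: fixes A :: "'a::idom poly" shows "coeff (bez_poly A B) q = bez_coeff A B (Suc q)"
proof -
  let ?XY = "[:[:0, 1:]:] - [:0, 1:] :: 'a poly poly"
  \<comment> \<open>The divided difference (A(X) - A(Y)) / (X - Y), whose coefficients in Y are the
    Horner polynomials of A.\<close>
  define h where "h = (\<lambda>A :: 'a poly. \<Sum>i\<le>degree A. monom (poly_shift (Suc i) A) i)"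
  have ch: "coeff (h A) q = poly_shift (Suc q) A" for A q
  proof -
    have "poly_shift (Suc q) A = 0" if "degree A < q"
      by (rule poly_eqI) (use that in \<open>simp add: coeff_poly_shift coeff_eq_0\<close>)
    then show ?thesis by (auto simp: h_def coeff_sum)
  qed
  have hXY: "h A * ?XY = [:A:] - map_poly (\<lambda>b. [:b:]) A" for A
  proof (rule poly_eqI)
    fix q
    have "h A * ?XY = smult [:0, 1:] (h A) - pCons 0 (h A)" by (simp add: algebra_simps)
    then have "coeff (h A * ?XY) q = [:0, 1:] * poly_shift (Suc q) A - (case q of 0 \<Rightarrow> 0 | Suc r \<Rightarrow> poly_shift (Suc r) A)"
      by (simp only: coeff_diff coeff_smult coeff_pCons ch split: nat.split) simp
    also have "\<dots> = coeff ([:A:] - map_poly (\<lambda>b. [:b:]) A) q"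
      unfolding poly_shift_rec by (cases q) (simp_all add: coeff_map_poly poly_shift_0_left)
    finally show "coeff (h A * ?XY) q = coeff ([:A:] - map_poly (\<lambda>b. [:b:]) A) q" .
  qed
  let ?Q = "[:B:] * h A - [:A:] * h B"
  have "?Q * ?XY = [:B:] * (h A * ?XY) - [:A:] * (h B * ?XY)" by (simp only: algebra_simps)
  also have "\<dots> = [:A:] * map_poly (\<lambda>b. [:b:]) B - map_poly (\<lambda>a. [:a:]) A * [:B:]"
    unfolding hXY by (simp only: algebra_simps)
  finally have e: "?Q * ?XY = [:A:] * map_poly (\<lambda>b. [:b:]) B - map_poly (\<lambda>a. [:a:]) A * [:B:]" .
  have XY0: "?XY \<noteq> 0" by simp
  have "bez_poly A B = ?Q" unfolding bez_poly_def
  proof (rule the_equality)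
    fix Q assume "Q * ?XY = [:A:] * map_poly (\<lambda>b. [:b:]) B - map_poly (\<lambda>a. [:a:]) A * [:B:]"
    then have "Q * ?XY = ?Q * ?XY" using e by metis
    then show "Q = ?Q" using XY0 mult_right_cancel by blast
  qed (rule e)
  then show ?thesis by (simp add: ch bez_coeff_def)
qed

lemma Bez_eq: "Bez n (A, B) = mat n n (\<lambda>(p, q). coeff (bez_coeff A (B::'a::idom poly) (Suc q)) p)"
  unfolding Bez_def by (simp add: bez_poly_coeff)

lemma Bez_carrier[simp]: "Bez n (f :: 'a::idom poly \<times> 'a poly) \<in> carrier_mat n n"
  by (cases f) (simp add: Bez_eq)

lemma Bez_sym: "transpose_mat (Bez n (f :: 'a::idom poly \<times> 'a poly)) = Bez n f"
  by (cases f, rule eq_matI) (auto simp: Bez_eq bez_coeff_sym)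

lemma Bez_ev: "Bez n (ev_pt t f) = ev_mat t (Bez n (f :: 'a::idom poly poly \<times> 'a poly poly))"
proof -
  obtain A B where f: "f = (A, B)" by (cases f)
  interpret mh: map_poly_comm_ring_hom "\<lambda>c. poly c t" ..
  have s: "poly_shift q (map_poly (\<lambda>c. poly c t) A) = map_poly (\<lambda>c. poly c t) (poly_shift q A)" for q and A :: "'a poly poly"
    by (rule poly_eqI) (simp add: coeff_poly_shift coeff_map_poly)
  have "bez_coeff (map_poly (\<lambda>c. poly c t) A) (map_poly (\<lambda>c. poly c t) B) q = map_poly (\<lambda>c. poly c t) (bez_coeff A B q)" for q
    by (simp add: bez_coeff_def s mh.hom_mult mh.hom_minus)
  then show ?thesis unfolding f ev_pt_def prod.case Bez_eq
    by (intro eq_matI) (auto simp: ev_mat_def coeff_map_poly)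
qed

text \<open>By symmetry, the coefficient of X^p is read off from the shifts by p + 1, which vanish
  for p \<ge> n. Counting degrees in the defining products would give a weaker bound.\<close>

lemma bez_coeff_deg_lt: assumes "deg_lt A (Suc n)" "deg_lt B n" shows "deg_lt (bez_coeff A B (Suc q)) n"
  unfolding deg_lt_def
proof (intro allI impI)
  fix p assume "n \<le> p"
  then have "poly_shift (Suc p) A = 0" "poly_shift (Suc p) B = 0"
    using assms by (auto intro!: poly_eqI simp: deg_lt_def coeff_poly_shift)
  then show "coeff (bez_coeff A B (Suc q)) p = 0" by (subst bez_coeff_sym) (simp add: bez_coeff_def)
qed

section \<open>The determinant of the Bezout matrix\<close>

text \<open>Division by a monic polynomial needs no inverses. The coefficients must be allowed to
  lie in k[T], because the Bezout matrix of a homotopy has to be nondegenerate too.\<close>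

lemma monic_rem_exists: fixes A :: "'a::idom poly" assumes A: "coeff A n = 1" "deg_lt A (Suc n)"
  shows "\<exists>R. deg_lt R n \<and> A dvd F - R"
proof -
  have "\<exists>R. deg_lt R n \<and> A dvd F - R" if "deg_lt F (n + k)" for F k
    using that
  proof (induction k arbitrary: F)
    case 0
    then show ?case by (intro exI[of _ F]) simp
  next
    case (Suc k)
    let ?G = "F - A * monom (coeff F (n + k)) k"
    have "coeff ?G i = 0" if i: "n + k \<le> i" for i
    proof -
      have "coeff (A * monom (coeff F (n + k)) k) i = coeff F (n + k) * coeff A (i - k)"
        using i by (subst mult.commute) (simp add: coeff_monom_mult)
      then have G: "coeff ?G i = coeff F i - coeff F (n + k) * coeff A (i - k)" by simp
      show ?thesis
      proof (cases "i = n + k")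
        case True
        then show ?thesis unfolding G using A(1) by simp
      next
        case False
        then have "coeff A (i - k) = 0" "coeff F i = 0" using i A(2) Suc.prems by (auto simp: deg_lt_def)
        then show ?thesis unfolding G by simp
      qed
    qed
    then have "deg_lt ?G (n + k)" unfolding deg_lt_def by blast
    then obtain R where "deg_lt R n" "A dvd ?G - R" using Suc.IH by blast
    moreover have "F - R = (?G - R) + A * monom (coeff F (n + k)) k" by simp
    ultimately show ?case using dvd_add dvd_triv_left by metis
  qed
  moreover have "deg_lt F (n + Suc (degree F))" by (auto simp: deg_lt_iff)
  ultimately show ?thesis by blast
qed

lemma monic_rem_unique: fixes A :: "'a::idom poly" assumes A: "coeff A n = 1" "deg_lt A (Suc n)"
  and "deg_lt R n" "deg_lt S n" "A dvd R - S" shows "R = S"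
proof -
  obtain Q where Q: "R - S = A * Q" using assms(5) by blast
  have "deg_lt (A * Q) (n + 0)" unfolding Q[symmetric] using assms deg_lt_diff by simp
  then have "Q = 0" using deg_lt_mult_monic[OF A] deg_lt_simps by blast
  then show ?thesis using Q by simp
qed

text \<open>Barnett's factorization: modulo A, each column of the Bezout matrix is B times a Horner
  polynomial of A. The matrix is thus multiplication by B on R[X]/(A), which multiplication by V
  inverts, times a Hankel matrix H of coefficients of A, with zeros below an antidiagonal of
  ones.\<close>

lemma Bez_det_unit: assumes "bez_point n A B U V" shows "det (Bez n (A, B)) dvd (1::'a::idom)"
proof -
  note rd = assms[unfolded bez_point_def]
  have A: "coeff A n = 1" "deg_lt A (Suc n)" using rd by auto
  obtain rem where rem: "deg_lt (rem F) n" "A dvd F - rem F" for F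
    using monic_rem_exists[OF A] by metis
  have rem_eq: "rem F = S" if "deg_lt S n" "A dvd F - S" for F S
  proof (rule monic_rem_unique[OF A rem(1) that(1)])
    have "rem F - S = (F - S) - (F - rem F)" by simp
    then show "A dvd rem F - S" using that(2) rem(2) dvd_diff by metis
  qed
  \<comment> \<open>Multiplication by F on R[X]/(A) in the basis 1, X, ..., X^(n-1).\<close>
  define M where "M = (\<lambda>F. mat n n (\<lambda>(p, j). coeff (rem (F * monom 1 j)) p))"
  have Mc: "M F \<in> carrier_mat n n" for F by (simp add: M_def)
  have Mmul: "(\<Sum>j<n. coeff (rem (F * monom 1 j)) p * coeff R j) = coeff (rem (F * R)) p" if R: "deg_lt R n" for F R p
  proof -
    let ?S = "\<Sum>j<n. smult (coeff R j) (rem (F * monom 1 j))"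
    have RR: "R = (\<Sum>j<n. monom (coeff R j) j)"
      by (rule poly_eqI) (use R in \<open>simp add: coeff_sum deg_lt_def\<close>)
    have "F * R - ?S = (\<Sum>j<n. smult (coeff R j) (F * monom 1 j - rem (F * monom 1 j)))"
    proof -
      have "F * R = (\<Sum>j<n. F * monom (coeff R j) j)" by (subst RR) (simp add: sum_distrib_left)
      also have "\<dots> = (\<Sum>j<n. smult (coeff R j) (F * monom 1 j))"
        by (intro sum.cong refl) (simp flip: mult_smult_right add: smult_monom)
      finally show ?thesis by (simp add: sum_subtractf[symmetric] smult_diff_right)
    qed
    moreover have "A dvd \<dots>" by (intro dvd_sum dvd_smult rem(2))
    moreover have "deg_lt ?S n" using rem(1) by (simp add: deg_lt_def coeff_sum)
    ultimately have "rem (F * R) = ?S" by (metis rem_eq)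
    then show ?thesis by (simp add: coeff_sum mult.commute)
  qed
  have prod_eq: "M F * mat n n (\<lambda>(p, j). coeff (G j) p) = mat n n (\<lambda>(p, j). coeff (rem (F * G j)) p)"
    if "\<And>j. j < n \<Longrightarrow> deg_lt (G j) n" for F G
    by (rule eq_matI) (use that Mmul in \<open>auto simp: M_def scalar_prod_def atLeast0LessThan\<close>)
  have MM: "M B * M V = 1\<^sub>m n"
  proof -
    have "rem (B * rem (V * monom 1 j)) = monom 1 j" if "j < n" for j
    proof (rule rem_eq)
      show "deg_lt (monom 1 j :: 'a poly) n" using that by (simp add: deg_lt_def)
      have "B * rem (V * monom 1 j) - monom 1 j =
          (B * V - 1) * monom 1 j - B * (V * monom 1 j - rem (V * monom 1 j))" by (simp add: algebra_simps)
      moreover have "B * V - 1 = - (A * U)" using rd by (simp add: algebra_simps add_eq_0_iff2)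
      ultimately show "A dvd B * rem (V * monom 1 j) - monom 1 j"
        using rem(2)[of "V * monom 1 j"] by (metis dvd_diff dvd_minus_iff dvd_mult dvd_mult2 dvd_triv_left)
    qed
    note r = this
    have MV: "M V = mat n n (\<lambda>(p, j). coeff (rem (V * monom 1 j)) p)" by (simp add: M_def)
    have "M B * M V = mat n n (\<lambda>(p, j). coeff (rem (B * rem (V * monom 1 j))) p)"
      unfolding MV by (rule prod_eq) (rule rem(1))
    also have "\<dots> = mat n n (\<lambda>(p, j). coeff (monom 1 j :: 'a poly) p)"
      by (rule eq_matI) (auto simp: r)
    also have "\<dots> = 1\<^sub>m n" by (rule eq_matI) auto
    finally show ?thesis .
  qed
  define H where "H = mat n n (\<lambda>(p, q). coeff (poly_shift (Suc q) A) p)"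
  have rb: "rem (B * poly_shift (Suc q) A) = bez_coeff A B (Suc q)" for q
    by (rule rem_eq[OF bez_coeff_deg_lt]) (use rd in \<open>auto simp: bez_coeff_def\<close>)
  have "M B * H = mat n n (\<lambda>(p, q). coeff (rem (B * poly_shift (Suc q) A)) p)"
    unfolding H_def by (rule prod_eq) (use A in \<open>auto simp: deg_lt_def coeff_poly_shift\<close>)
  then have MH: "M B * H = Bez n (A, B)" by (simp add: Bez_eq rb)
  \<comment> \<open>Reverses the columns, which makes H upper triangular with diagonal 1.\<close>
  define J :: "'a mat" where "J = mat n n (\<lambda>(i, j). if i + j = n - 1 then 1 else 0)"
  have Hc: "H \<in> carrier_mat n n" and Jc: "J \<in> carrier_mat n n" by (auto simp: H_def J_def)
  have HJ: "H * J = mat n n (\<lambda>(p, q). coeff A (p + n - q))"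
  proof (rule eq_matI)
    fix p q assume "p < dim_row (mat n n (\<lambda>(p, q). coeff A (p + n - q)))" "q < dim_col (mat n n (\<lambda>(p, q). coeff A (p + n - q)))"
    then have pq: "p < n" "q < n" by auto
    have "(H * J) $$ (p, q) = (\<Sum>i<n. coeff (poly_shift (Suc i) A) p * (if i + q = n - 1 then 1 else 0))"
      using pq by (simp add: H_def J_def scalar_prod_def atLeast0LessThan)
    also have "\<dots> = (\<Sum>i<n. if i = n - 1 - q then coeff (poly_shift (Suc i) A) p else 0)"
      by (rule sum.cong) (use pq in auto)
    also have "\<dots> = coeff A (p + n - q)" using pq by (simp add: coeff_poly_shift Suc_diff_Suc)
    finally show "(H * J) $$ (p, q) = mat n n (\<lambda>(p, q). coeff A (p + n - q)) $$ (p, q)" using pq by simp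
  qed (auto simp: H_def J_def)
  have "det (H * J) = prod_list (diag_mat (H * J))"
    by (rule det_upper_triangular) (use A Hc Jc in \<open>auto simp: HJ deg_lt_def\<close>)
  also have "diag_mat (H * J) = map (\<lambda>i. 1) [0..<n]"
    unfolding diag_mat_def HJ using A by auto
  also have "prod_list (map (\<lambda>i. 1::'a) [0..<n]) = 1" by (induction n) auto
  finally have "det H * det J = 1" using det_mult[OF Hc Jc] by simp
  then have "det H dvd 1" by (metis dvd_triv_left)
  moreover have "det (M B) * det (M V) = 1" using det_mult[OF Mc Mc, of B V] MM by simp
  then have "det (M B) dvd 1" by (metis dvd_triv_left)
  ultimately show ?thesis unfolding MH[symmetric] using det_mult[OF Mc Hc] by (metis is_unit_mult_iff)
qed

lemma symnd_Bez: "ratfun n f \<Longrightarrow> symnd n (Bez n (f :: 'a::idom poly \<times> 'a poly))"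
  by (elim ratfun_cases) (auto simp: symnd_def Bez_sym intro: Bez_det_unit)

lemma htpS_Bez: fixes f :: "'k::field poly \<times> 'k poly" assumes "htpF n f g" shows "htpS n (Bez n f) (Bez n g)"
proof -
  have step: "htpS n (Bez n (ev_pt 0 h)) (Bez n (ev_pt 1 h))" if "ratfun n h" for h :: "'k poly poly \<times> 'k poly poly"
    unfolding Bez_ev by (rule htpS_step[OF symnd_Bez[OF that]]) auto
  show ?thesis unfolding htpS_def
    by (rule htpF_map[OF assms, where F = "Bez n"]) (rule step[unfolded htpS_def])
qed

text \<open>Putting X/a in front adds the rank one form a A(X) A(Y) to the Bezout form. The
  coefficient vector of the monic A ends in 1, so this is the effect of the lower unipotent matrix
  that has the remaining coefficients in its last row.\<close>

lemma Bez_word_point_Cons: fixes a :: "'k::field" assumes "a \<noteq> 0" "all_nonzero xs" "length xs = m"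
  obtains P where "conn (Suc m) P" "Bez (Suc m) (word_point (a # xs)) = congr P (osum (Bez m (word_point xs)) (mat1 a))"
proof -
  obtain A B U V where f: "word_point xs = (A, B)" and r: "bez_point m A B U V"
    using ratfun_word_point[OF assms(2)] assms(3) ratfun_cases by metis
  note rd = r[unfolded bez_point_def]
  let ?A = "[:0, 1:] * A - smult (1/a) B" and ?B = "smult a A"
  have c: "bez_coeff ?A ?B (Suc q) = bez_coeff A B (Suc q) + smult (a * coeff A q) A" for q
  proof -
    have s: "poly_shift (Suc q) ?A = poly_shift q A - smult (1/a) (poly_shift (Suc q) B)"
      "poly_shift (Suc q) ?B = smult a (poly_shift (Suc q) A)"
      by (rule poly_eqI, simp add: coeff_poly_shift)+
    have "bez_coeff ?A ?B (Suc q) = smult a A * (poly_shift q A - [:0, 1:] * poly_shift (Suc q) A) + bez_coeff A B (Suc q)"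
      unfolding bez_coeff_def s using assms(1) by (simp add: algebra_simps smult_diff_right)
    also have "poly_shift q A - [:0, 1:] * poly_shift (Suc q) A = [:coeff A q:]" unfolding poly_shift_rec by simp
    finally show ?thesis by (simp add: mult.commute)
  qed
  define R where "R = mat 1 m (\<lambda>(_, j). coeff A j)"
  have Rc: "R \<in> carrier_mat 1 m" by (simp add: R_def)
  have dim_word_point: "Bez m (A, B) \<in> carrier_mat m m" by simp
  note dims = carrier_matD[OF dim_word_point]
  have mat1_carrier_Suc: "mat1 a \<in> carrier_mat (Suc 0) (Suc 0)" by (auto simp: mat1_def)
  have Ra: "R\<^sup>T * mat1 a \<in> carrier_mat m 1" by (intro mult_carrier_mat[of _ _ 1]) (use Rc in auto)
  have z: "coeff (bez_coeff A B (Suc q)) p = 0" if "m \<le> p \<or> m \<le> q" for p q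
  proof -
    have "coeff (bez_coeff A B (Suc q)) p = 0" if "m \<le> p" for p q
      using bez_coeff_deg_lt[of A m B q] rd that by (simp add: deg_lt_def)
    then show ?thesis using that bez_coeff_sym by metis
  qed
  have T: "transpose_mat (lower_unip m 1 R) = four_block_mat (1\<^sub>m m) (R\<^sup>T) (0\<^sub>m 1 m) (1\<^sub>m 1)"
    unfolding lower_unip_def by (subst transpose_four_block_mat) (use Rc in auto)
  have "congr (lower_unip m 1 R) (osum (Bez m (A, B)) (mat1 a)) =
     four_block_mat (Bez m (A, B)) (R\<^sup>T * mat1 a) (0\<^sub>m 1 m) (mat1 a) * lower_unip m 1 R"
    unfolding congr_def T osum_def
    by (subst mult_four_block_mat[of _ m m _ 1 _ 1 _ _ m _ 1]) (use Rc Ra dim_word_point dims mat1_carrier_Suc in auto)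
  also have "\<dots> = four_block_mat (Bez m (A, B) + R\<^sup>T * mat1 a * R) (R\<^sup>T * mat1 a) (mat1 a * R) (mat1 a)"
    unfolding lower_unip_def
    by (subst mult_four_block_mat[of _ m m _ 1 _ 1 _ _ m _ 1]) (use Rc Ra dim_word_point dims mat1_carrier_Suc in auto)
  also have "\<dots> = Bez (Suc m) (?A, ?B)"
  proof (rule eq_matI)
    fix i j assume "i < dim_row (Bez (Suc m) (?A, ?B))" "j < dim_col (Bez (Suc m) (?A, ?B))"
    then have ij: "i < Suc m" "j < Suc m" by (auto simp: Bez_eq)
    have "Bez (Suc m) (?A, ?B) $$ (i, j) = coeff (bez_coeff A B (Suc j)) i + a * coeff A j * coeff A i"
      using ij by (simp only: Bez_eq c) simp
    then show "four_block_mat (Bez m (A, B) + R\<^sup>T * mat1 a * R) (R\<^sup>T * mat1 a) (mat1 a * R) (mat1 a) $$ (i, j) =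
       Bez (Suc m) (?A, ?B) $$ (i, j)"
      using ij z[of i j] rd by (cases "i = m"; cases "j = m") (auto simp: Bez_eq R_def scalar_prod_def ac_simps)
  qed (auto simp: Bez_eq R_def)
  finally have "Bez (Suc m) (word_point (a # xs)) = congr (lower_unip m 1 R) (osum (Bez m (word_point xs)) (mat1 a))"
    using word_point_Cons[OF assms(1) f] f by simp
  then show ?thesis using that[of "lower_unip m 1 R"] conn_lower_unip[OF Rc] by simp
qed

section \<open>Words of units representing a symmetric matrix\<close>

text \<open>The block [[f, c], [c, 0]] is homotopic to [[1, c], [c, 0]], which is congruent to the diagonal matrix
with entries -c^2, 1.\<close>

definition diag_entries :: "'a::comm_ring_1 block list \<Rightarrow> 'a list" where
  "diag_entries w = concat (map (\<lambda>b. case b of One a \<Rightarrow> [a] | Two c f \<Rightarrow> [1, - (c * c)]) w)"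

lemma diag_entries_simps[simp]: "diag_entries [] = []" "diag_entries (One a # w) = a # diag_entries w"
  "diag_entries (Two c f # w) = 1 # - (c * c) # diag_entries w"
  by (auto simp: diag_entries_def)

lemma blocks_mat_carrier: "blocks_mat w \<in> carrier_mat (length (diag_entries w)) (length (diag_entries w))"
proof (induction w)
  case (Cons b w)
  then show ?case using osum_carrier[OF Cons mat1_carrier(1)] osum_carrier[OF Cons mat2_carrier(1)] by (cases b) auto
qed simp

lemma all_nonzero_diag_entries: "\<forall>b\<in>set w. block_ok b \<Longrightarrow> all_nonzero (diag_entries (w :: 'k::field block list))"
proof (induction w)
  case (Cons b w)
  then show ?case by (cases b) (auto simp: dvd_field_iff)
qed simp

lemma symnd_blocks: "\<forall>b\<in>set w. block_ok b \<Longrightarrow> symnd (length (diag_entries w)) (blocks_mat (w :: 'k::field block list))"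
proof (induction w)
  case (Cons b w)
  have 1: "symnd (length (diag_entries w)) (blocks_mat w)" using Cons by simp
  show ?case
  proof (cases b)
    case (One a)
    then have "symnd 1 (block_mat b)" using Cons.prems by (simp add: symnd_def)
    from symnd_osum[OF 1 this] show ?thesis using One by simp
  next
    case (Two c f)
    then have "symnd 2 (block_mat b)" using Cons.prems by (auto simp: symnd_mat2 dvd_field_iff)
    from symnd_osum[OF 1 this] show ?thesis using Two by simp
  qed
qed (simp add: symnd_def)

lemma ev_blocks: "ev_mat t (blocks_mat w) = blocks_mat (map (map_block (\<lambda>c. poly c t)) w)"
proof (induction w)
  case Nil
  then show ?case by (auto simp: ev_mat_def)
next
  case (Cons b w)
  show ?case
  proof (cases b)
    case (One a)
    then show ?thesis using ev_mat_osum[OF blocks_mat_carrier[of w] mat1_carrier(1), of t a] Cons by simp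
  next
    case (Two c f)
    then show ?thesis using ev_mat_osum[OF blocks_mat_carrier[of w] mat2_carrier(1), of t f c c 0] Cons by simp
  qed
qed

lemma block_ok_ev: "block_ok b \<Longrightarrow> block_ok (map_block (\<lambda>c. poly c t) (b :: 'k::field poly block))"
  by (cases b) (auto intro: poly_dvd_one)

text \<open>Letters are units of k[T], hence constants, and the polynomial f of a block does not
  enter the word.\<close>

lemma diag_entries_ev: assumes "\<forall>b\<in>set w. block_ok (b :: 'k::field poly block)"
  shows "diag_entries (map (map_block (\<lambda>c. poly c t)) w) = map (\<lambda>c. poly c t) (diag_entries w) \<and>
    diag_entries (map (map_block (\<lambda>c. poly c t)) w) = diag_entries (map (map_block (\<lambda>c. poly c s)) w)"
  using assms
proof (induction w)
  case (Cons b w)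
  have const: "poly p t = poly p s" if "p dvd 1" for p :: "'k poly"
    using that poly_dvd_1[of p] by (metis degree_eq_zeroE poly_pCons mult_zero_right poly_0)
  show ?case using Cons by (cases b) (auto simp: const)
qed simp

definition represents :: "nat \<Rightarrow> 'k::field mat \<Rightarrow> 'k list \<Rightarrow> bool" where
  "represents n M xs \<longleftrightarrow> M \<in> carrier_mat n n \<and> (\<exists>P w. P \<in> carrier_mat n n \<and> det P = 1 \<and> (\<forall>b\<in>set w. block_ok b) \<and>
     congr P M = blocks_mat w \<and> xs = diag_entries w)"

lemma represents_length: "represents n M xs \<Longrightarrow> length xs = n"
  unfolding represents_def by (metis blocks_mat_carrier carrier_matD(1) congr_carrier)

lemma represents_all_nonzero: "represents n M xs \<Longrightarrow> all_nonzero xs"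
  unfolding represents_def using all_nonzero_diag_entries by blast

lemma represents_congrD: assumes "represents n (congr Q M) xs" "Q \<in> carrier_mat n n" "det Q = 1" "M \<in> carrier_mat n n"
  shows "represents n M xs"
proof -
  obtain P w where P: "P \<in> carrier_mat n n" "det P = 1" "\<forall>b\<in>set w. block_ok b"
     "congr P (congr Q M) = blocks_mat w" "xs = diag_entries w" using assms(1) unfolding represents_def by blast
  have "congr (Q * P) M = blocks_mat w" using congr_mult[OF assms(2) P(1) assms(4)] P(4) by simp
  moreover have "det (Q * P) = 1" using det_mult[OF assms(2) P(1)] assms P by simp
  moreover have "Q * P \<in> carrier_mat n n" using assms P by simp
  ultimately show ?thesis unfolding represents_def using P assms(4) by blast
qed

lemma congr_inv: assumes "Q \<in> carrier_mat n n" "R \<in> carrier_mat n n" "Q * R = 1\<^sub>m n" "M \<in> carrier_mat n n"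
  shows "congr R (congr Q M) = M"
  using congr_mult[OF assms(1,2,4)] assms by simp

lemma represents_congr: assumes "represents n M xs" "Q \<in> carrier_mat n n" "det Q = 1"
  shows "represents n (congr Q M) xs"
proof -
  obtain R where R: "R \<in> carrier_mat n n" "det R = 1" "Q * R = 1\<^sub>m n" using SL_inv[OF assms(2,3)] by metis
  have M: "M \<in> carrier_mat n n" using assms(1) by (simp add: represents_def)
  show ?thesis by (rule represents_congrD[OF _ R(1,2)]) (use congr_inv[OF assms(2) R(1,3) M] assms M in auto)
qed

lemma represents_osum_block: assumes "represents m M xs" "block_ok b" "block_mat b \<in> carrier_mat k k"
  shows "represents (m + k) (osum M (block_mat b)) (diag_entries [b] @ xs)"
proof -
  obtain P w where P: "P \<in> carrier_mat m m" "det P = 1" "\<forall>b\<in>set w. block_ok b"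
     "congr P M = blocks_mat w" "xs = diag_entries w" and M: "M \<in> carrier_mat m m" using assms(1) unfolding represents_def by blast
  have "congr (osum P (1\<^sub>m k)) (osum M (block_mat b)) = blocks_mat (b # w)"
    using congr_osum[OF P(1) one_carrier_mat M assms(3)] P(4) assms(3) by simp
  moreover have "det (osum P (1\<^sub>m k)) = 1" using osum_det[OF P(1) one_carrier_mat[of k]] P by simp
  moreover have "diag_entries (b # w) = diag_entries [b] @ xs" using P(5) by (simp add: diag_entries_def)
  moreover have "\<forall>c\<in>set (b # w). block_ok c" using P(3) assms(2) by simp
  ultimately show ?thesis unfolding represents_def using osum_carrier[OF P(1) one_carrier_mat[of k]] osum_carrier[OF M assms(3)] by metis
qed

lemma represents_One: "represents m M xs \<Longrightarrow> a \<noteq> 0 \<Longrightarrow> represents (Suc m) (osum M (mat1 a)) (a # xs)"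
  using represents_osum_block[of m M xs "One a" 1] by (simp add: dvd_field_iff)

lemma represents_Two: "represents m M xs \<Longrightarrow> c \<noteq> 0 \<Longrightarrow> represents (m + 2) (osum M (mat2 f c c 0)) (1 # - (c * c) # xs)"
  using represents_osum_block[of m M xs "Two c f" 2] by (simp add: dvd_field_iff)

lemma represents_homotopy: assumes "symnd n (H :: 'k::field poly mat)"
  shows "\<exists>xs. represents n (ev_mat 0 H) xs \<and> represents n (ev_mat 1 H) xs"
proof -
  obtain P w where P: "conn n P" "\<forall>b\<in>set w. block_ok b" "congr P H = blocks_mat w"
    using blocks_exist_poly[OF assms] by blast
  have c: "P \<in> carrier_mat n n" "H \<in> carrier_mat n n" using P conn_carrier assms by (auto simp: symnd_def)
  have "represents n (ev_mat t H) (diag_entries (map (map_block (\<lambda>c. poly c t)) w))" for t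
    unfolding represents_def
  proof (intro conjI exI)
    show "congr (ev_mat t P) (ev_mat t H) = blocks_mat (map (map_block (\<lambda>c. poly c t)) w)"
      using ev_congr[OF c, of t] P(3) ev_blocks by metis
    show "\<forall>b\<in>set (map (map_block (\<lambda>c. poly c t)) w). block_ok b" using P(2) block_ok_ev by auto
  qed (use c conn_det[OF P(1)] in auto)
  then show ?thesis using diag_entries_ev[OF P(2)] by metis
qed

text \<open>The constant family is decomposed over k[T] and evaluated at T = 0; the path behind
  \<open>conn\<close> is specialized along with it.\<close>

lemma blocks_exist: assumes "symnd n (M :: 'k::field mat)"
  shows "\<exists>P w. conn n P \<and> (\<forall>b\<in>set w. block_ok b) \<and> congr P M = blocks_mat w"
proof -
  obtain P w where P: "conn n P" "\<forall>b\<in>set w. block_ok b" "congr P (lift_mat M) = blocks_mat w"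
    using blocks_exist_poly[OF symnd_lift[OF assms]] by blast
  have c: "P \<in> carrier_mat n n" "lift_mat M \<in> carrier_mat n n" using P conn_carrier assms by (auto simp: symnd_def)
  have "congr (ev_mat 0 P) M = blocks_mat (map (map_block (\<lambda>c. poly c 0)) w)"
    using ev_congr[OF c, of 0] P(3) ev_blocks ev_lift_mat by metis
  moreover have "\<forall>b\<in>set (map (map_block (\<lambda>c. poly c 0)) w). block_ok b" using P(2) block_ok_ev by auto
  ultimately show ?thesis using conn_ev[OF P(1)] by blast
qed

lemma represents_exists: "symnd n M \<Longrightarrow> \<exists>xs. represents n M xs"
  using blocks_exist conn_carrier conn_det unfolding represents_def symnd_def by metis

section \<open>Specialization of the splittings to the field\<close>

lemma isotropic_split_field: fixes M :: "'k::field mat"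
  assumes "symnd (Suc n') M" "M $$ (n', n') = 0"
  obtains k P A c f where "n' = Suc k" "P \<in> carrier_mat (Suc n') (Suc n')" "det P = 1"
    "\<And>i. i < Suc n' \<Longrightarrow> P $$ (i, n') = 1\<^sub>m (Suc n') $$ (i, n')"
    "A \<in> carrier_mat k k" "c \<noteq> 0" "congr P M = osum A (mat2 f c c 0)"
proof -
  have M: "M \<in> carrier_mat (Suc n') (Suc n')" using assms by (simp add: symnd_def)
  then have "lift_mat M $$ (n', n') = 0" using assms by (simp add: lift_mat_def)
  then obtain k P A c f where P: "n' = Suc k" "conn (Suc n') P"
    "\<And>i. i < Suc n' \<Longrightarrow> P $$ (i, n') = 1\<^sub>m (Suc n') $$ (i, n')"
    "A \<in> carrier_mat k k" "c dvd 1" "congr P (lift_mat M) = osum A (mat2 f c c 0)"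
    using isotropic_split[OF symnd_lift[OF assms(1)]] by metis
  have Pc: "P \<in> carrier_mat (Suc n') (Suc n')" using conn_carrier P(2) .
  have "poly c 0 dvd 1" using P(5) poly_dvd_one by blast
  then have c0: "poly c 0 \<noteq> 0" by auto
  have e: "congr (ev_mat 0 P) M = osum (ev_mat 0 A) (mat2 (poly f 0) (poly c 0) (poly c 0) 0)"
    using ev_congr[OF Pc, of "lift_mat M" 0] M P(6) ev_mat_osum[OF P(4) mat2_carrier(1)] by simp
  show ?thesis
  proof (rule that[OF P(1) _ _ _ _ c0 e])
    fix i assume "i < Suc n'"
    then show "ev_mat 0 P $$ (i, n') = 1\<^sub>m (Suc n') $$ (i, n')" using P(3)[of i] Pc by (auto simp: ev_mat_def)
  qed (use Pc P conn_det[OF P(2)] in auto)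
qed

lemma conn_euclid_field: fixes r :: "'k::field mat"
  assumes "r \<in> carrier_mat (Suc m) 1"
  obtains S where "S \<in> carrier_mat (Suc m) (Suc m)" "det S = 1" "\<And>j. j < m \<Longrightarrow> (S\<^sup>T * r) $$ (j, 0) = 0"
proof -
  obtain S where S: "conn (Suc m) S" "\<forall>j<m. (S\<^sup>T * lift_mat r) $$ (j, 0) = 0"
    using conn_euclid[of "lift_mat r" m] assms by auto
  have Sc: "S \<in> carrier_mat (Suc m) (Suc m)" using conn_carrier S(1) .
  have e: "ev_mat 0 (S\<^sup>T * lift_mat r) = transpose_mat (ev_mat 0 S) * r"
    using Sc assms by (subst ev_mat_mult[of _ "Suc m" "Suc m" _ 1]) (auto simp: ev_mat_transpose)
  have c: "S\<^sup>T * lift_mat r \<in> carrier_mat (Suc m) 1" using Sc assms by (intro mult_carrier_mat[of _ _ "Suc m"]) auto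
  show ?thesis
  proof (rule that[of "ev_mat 0 S"])
    fix j assume "j < m"
    then have "ev_mat 0 (S\<^sup>T * lift_mat r) $$ (j, 0) = 0" using S(2) carrier_matD[OF c] unfolding ev_mat_def by (subst index_map_mat) auto
    then show "(transpose_mat (ev_mat 0 S) * r) $$ (j, 0) = 0" unfolding e .
  qed (use Sc conn_det[OF S(1)] in auto)
qed

lemma mult_entry: "A \<in> carrier_mat k n \<Longrightarrow> B \<in> carrier_mat n m \<Longrightarrow> i < k \<Longrightarrow> j < m \<Longrightarrow>
    (A * B) $$ (i, j) = (\<Sum>q<n. A $$ (i, q) * B $$ (q, j))"
  by (simp add: scalar_prod_def atLeast0LessThan)

lemma congr_entry: assumes "P \<in> carrier_mat n k" "M \<in> carrier_mat n n" "i < k" "j < k"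
  shows "congr P M $$ (i, j) = (\<Sum>q<n. (\<Sum>p<n. P $$ (p, i) * M $$ (p, q)) * P $$ (q, j))"
proof -
  have PM: "P\<^sup>T * M \<in> carrier_mat k n" using assms by auto
  have 1: "(P\<^sup>T * M) $$ (i, q) = (\<Sum>p<n. P $$ (p, i) * M $$ (p, q))" if "q < n" for q
    using assms that by (simp add: scalar_prod_def atLeast0LessThan)
  show ?thesis unfolding congr_def mult_entry[OF PM assms(1,3,4)] using 1 by simp
qed

lemma osum_one_last_col: assumes "L \<in> carrier_mat m m" "P \<in> carrier_mat (Suc m) (Suc m)" "i < Suc m" "j < Suc m"
  shows "(osum L (1\<^sub>m 1) * P) $$ (i, j) = (if i < m then (\<Sum>k<m. L $$ (i, k) * P $$ (k, j)) else P $$ (m, j) :: 'a::comm_ring_1)"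
proof -
  have "(osum L (1\<^sub>m 1) * P) $$ (i, j) = (\<Sum>k<Suc m. osum L (1\<^sub>m 1) $$ (i, k) * P $$ (k, j))"
    using assms by (simp add: scalar_prod_def atLeast0LessThan osum_def)
  then show ?thesis using assms by (auto simp: osum_def intro!: sum.neutral)
qed

section \<open>Matrices of size three\<close>

definition mat3 :: "'a \<Rightarrow> 'a \<Rightarrow> 'a \<Rightarrow> 'a \<Rightarrow> 'a \<Rightarrow> 'a \<Rightarrow> 'a \<Rightarrow> 'a \<Rightarrow> 'a \<Rightarrow> 'a mat" where
  "mat3 a b c d e f g h i = mat 3 3 (\<lambda>(p, q). if p = 0 then (if q = 0 then a else if q = 1 then b else c)
     else if p = 1 then (if q = 0 then d else if q = 1 then e else f)
     else (if q = 0 then g else if q = 1 then h else i))"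

lemma less_3_cases_nat: "i < (3::nat) \<longleftrightarrow> i = 0 \<or> i = 1 \<or> i = 2" by auto

lemma mat3_carrier[simp]: "mat3 a b c d e f g h i \<in> carrier_mat 3 3"
  "dim_row (mat3 a b c d e f g h i) = 3" "dim_col (mat3 a b c d e f g h i) = 3"
  by (auto simp: mat3_def)

lemma mat3_transpose[simp]: "transpose_mat (mat3 a b c d e f g h i) = mat3 a d g b e h c f i"
  by (rule eq_matI) (auto simp: less_3_cases_nat mat3_def)

lemma mat3_mult[simp]: "mat3 a b c d e f g h i * mat3 a' b' c' d' e' f' g' h' i' =
    mat3 (a * a' + b * d' + c * g') (a * b' + b * e' + c * h') (a * c' + b * f' + c * i')
       (d * a' + e * d' + f * g') (d * b' + e * e' + f * h') (d * c' + e * f' + f * i')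
       (g * a' + h * d' + i * g') (g * b' + h * e' + i * h') (g * c' + h * f' + i * i' :: 'a::comm_ring_1)" (is "_ = ?R")
proof (rule eq_matI)
  have [simp]: "{0..<3::nat} = {0, 1, 2}" by auto
  fix p q assume "p < dim_row ?R" "q < dim_col ?R"
  then show "(mat3 a b c d e f g h i * mat3 a' b' c' d' e' f' g' h' i') $$ (p, q) = ?R $$ (p, q)"
    by (auto simp: less_3_cases_nat scalar_prod_def mat3_def add.assoc)
qed auto

lemma osum_mat2_mat1: "osum (mat2 a b c d) (mat1 e) = mat3 a b 0 c d 0 0 0 (e::'a::comm_ring_1)"
  unfolding osum_def by (rule eq_matI) (auto simp: less_3_cases_nat mat3_def)

lemma osum_mat1_mat2: "osum (mat1 a) (mat2 b c d e) = mat3 a 0 0 0 b c 0 d (e::'a::comm_ring_1)"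
  unfolding osum_def by (rule eq_matI) (auto simp: less_3_cases_nat mat3_def)

lemma lower_unip_2_1: "lower_unip 2 1 (mat 1 2 (\<lambda>(i, j). if j = 0 then r else 0)) = mat3 1 0 0 0 1 0 r 0 (1::'a::comm_ring_1)"
  unfolding lower_unip_def by (rule eq_matI) (auto simp: less_3_cases_nat mat3_def)

lemma congr_transfer: assumes "T \<in> carrier_mat n n" "T' \<in> carrier_mat n n" "P \<in> carrier_mat n n" "M \<in> carrier_mat n n"
  "T * T' = 1\<^sub>m n" shows "congr (T' * P) (congr T M) = congr P M"
  using congr_mult[OF assms(1) mult_carrier_mat[OF assms(2,3)] assms(4)] assoc_mult_mat[OF assms(1-3)] assms by simp

section \<open>Comparison of two lines split off from one form\<close>

text \<open>A base change of determinant 1 / x on the complement, balanced by multiplying the split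
  letter by x^2. Only the head block is rescaled: a letter d becomes d / x^2, and in a plane c
  becomes c / x.\<close>

lemma scale_blocks: fixes x :: "'k::field"
  assumes "\<forall>b\<in>set w. block_ok b" "w \<noteq> []" "x \<noteq> 0" "a \<noteq> 0" "n = length (diag_entries w)"
  obtains Z w' where "Z \<in> carrier_mat n n" "det Z = 1 / x" "\<forall>b\<in>set w'. block_ok b"
    "congr Z (blocks_mat w) = blocks_mat w'" "word_htp (a # diag_entries w) (a * (x * x) # diag_entries w')"
proof -
  obtain b v where w: "w = b # v" using assms(2) by (cases w) auto
  let ?k = "length (diag_entries v)"
  have vc: "blocks_mat v \<in> carrier_mat ?k ?k" by (rule blocks_mat_carrier)
  have nzv: "all_nonzero (diag_entries v)" using all_nonzero_diag_entries[of v] assms(1) w by auto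
  show ?thesis
  proof (cases b)
    case (One d)
    then have d: "d \<noteq> 0" using assms(1) w by auto
    show ?thesis
    proof (rule that[of "osum (1\<^sub>m ?k) (mat1 (1 / x))" "One (d / (x * x)) # v"])
      show "congr (osum (1\<^sub>m ?k) (mat1 (1 / x))) (blocks_mat w) = blocks_mat (One (d / (x * x)) # v)"
        unfolding w One using congr_osum[OF one_carrier_mat mat1_carrier(1) vc mat1_carrier(1), of "1/x" d] vc
        by (simp add: congr_def[of "mat1 _"])
      show "word_htp (a # diag_entries w) (a * (x * x) # diag_entries (One (d / (x * x)) # v))"
        unfolding w One using word_htp_head2[OF word_htp_scale[of a d x] nzv] assms d by simp
    qed (use assms w One d in \<open>auto simp: osum_det[OF one_carrier_mat mat1_carrier(1)] dvd_field_iff\<close>)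
  next
    case (Two c f)
    then have c: "c \<noteq> 0" using assms(1) w by auto
    show ?thesis
    proof (rule that[of "osum (1\<^sub>m ?k) (mat2 1 0 0 (1 / x))" "Two (c / x) f # v"])
      show "congr (osum (1\<^sub>m ?k) (mat2 1 0 0 (1 / x))) (blocks_mat w) = blocks_mat (Two (c / x) f # v)"
        unfolding w Two using congr_osum[OF one_carrier_mat mat2_carrier(1) vc mat2_carrier(1), of 1 0 0 "1/x" f c c 0] vc
        by (simp add: congr_def[of "mat2 _ _ _ _"])
      show "word_htp (a # diag_entries w) (a * (x * x) # diag_entries (Two (c / x) f # v))"
        unfolding w Two using word_htp_scale3[of a "- (c * c)" x "diag_entries v"] assms c nzv by simp
    qed (use assms w Two c in \<open>auto simp: osum_det[OF one_carrier_mat mat2_carrier(1)] dvd_field_iff\<close>)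
  qed
qed

text \<open>If the second split vector is x times the first, orthogonality makes P the block sum of
  P1 and x. The complements are then isometric by P1, of determinant 1 / x and not 1;
  \<open>scale_blocks\<close> repairs this before the induction hypothesis is applied.\<close>

lemma split_vector_fixed: fixes M1 :: "'k::field mat"
  assumes IH: "\<And>(M :: 'k mat) xs ys. symnd m M \<Longrightarrow> represents m M xs \<Longrightarrow> represents m M ys \<Longrightarrow> word_htp xs ys"
    and M1: "M1 \<in> carrier_mat m m" and N1: "symnd m N1" and nz: "a \<noteq> 0" "b \<noteq> 0"
    and P: "P \<in> carrier_mat (Suc m) (Suc m)" "det P = 1" and col: "\<And>i. i < m \<Longrightarrow> P $$ (i, m) = 0"
    and e: "congr P (osum M1 (mat1 a)) = osum N1 (mat1 b)"
    and rep: "represents m M1 zs" "represents m N1 zs'"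
  shows "word_htp (a # zs) (b # zs')"
proof -
  have N1c: "N1 \<in> carrier_mat m m" using N1 by (simp add: symnd_def)
  have Mc: "osum M1 (mat1 a) \<in> carrier_mat (Suc m) (Suc m)" using osum_carrier[OF M1 mat1_carrier(1)] by simp
  define x where "x = P $$ (m, m)"
  have ent: "osum N1 (mat1 b) $$ (j, m) = P $$ (m, j) * a * x" if "j < Suc m" for j
  proof -
    have 0: "(\<Sum>p<m. P $$ (p, j) * osum M1 (mat1 a) $$ (p, m)) = 0"
      by (rule sum.neutral) (use M1 in \<open>auto simp: osum_def\<close>)
    have "osum N1 (mat1 b) $$ (j, m) = (\<Sum>q<Suc m. (\<Sum>p<Suc m. P $$ (p, j) * osum M1 (mat1 a) $$ (p, q)) * P $$ (q, m))"
      unfolding e[symmetric] by (rule congr_entry[OF P(1) Mc that]) simp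
    also have "\<dots> = (\<Sum>p<Suc m. P $$ (p, j) * osum M1 (mat1 a) $$ (p, m)) * P $$ (m, m)"
      using col by (subst sum.lessThan_Suc, subst sum.neutral) auto
    also have "(\<Sum>p<Suc m. P $$ (p, j) * osum M1 (mat1 a) $$ (p, m)) = P $$ (m, j) * a"
      using 0 M1 by (simp add: osum_def)
    finally show ?thesis by (simp add: x_def)
  qed
  have b: "b = x * a * x" using ent[of m] N1c by (simp add: osum_def x_def)
  then have x0: "x \<noteq> 0" using nz by auto
  have row: "P $$ (m, j) = 0" if "j < m" for j
    using ent[of j] that N1c x0 nz by (simp add: osum_def)
  define P1 where "P1 = mat m m (\<lambda>ij. P $$ ij)"
  have P1c: "P1 \<in> carrier_mat m m" by (simp add: P1_def)
  have PP: "P = osum P1 (mat1 x)"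
  proof (rule eq_matI)
    fix i j assume ij: "i < dim_row (osum P1 (mat1 x))" "j < dim_col (osum P1 (mat1 x))"
    then have "i < Suc m" "j < Suc m" by (auto simp: P1_def)
    then show "P $$ (i, j) = osum P1 (mat1 x) $$ (i, j)"
      using col[of i] row[of j] by (cases "i = m"; cases "j = m") (auto simp: osum_def P1_def x_def)
  qed (use P P1c in auto)
  have dx: "det P1 * x = 1" using P(2) osum_det[OF P1c mat1_carrier(1), of x] by (simp add: PP)
  have "osum (congr P1 M1) (congr (mat1 x) (mat1 a)) = osum N1 (mat1 b)"
    using e congr_osum[OF P1c mat1_carrier(1) M1 mat1_carrier(1)] by (simp add: PP)
  then have N1e: "congr P1 M1 = N1"
    using osum_inject[OF congr_carrier[OF P1c M1] mat1_carrier(1) N1c mat1_carrier(1), of "x * a * x" b]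
    by (simp add: congr_def[of "mat1 _"] ac_simps)
  obtain R w where R: "R \<in> carrier_mat m m" "det R = 1" "\<forall>b\<in>set w. block_ok b" "congr R M1 = blocks_mat w" "zs = diag_entries w"
    using rep(1) unfolding represents_def by blast
  have lw: "length (diag_entries w) = m" using represents_length[OF rep(1)] R(5) by simp
  show ?thesis
  proof (cases "m = 0")
    \<comment> \<open>No block is left to absorb x, but here x = det P = 1.\<close>
    case True
    then have "det P1 = 1" using P1c by simp
    then have "x = 1" using dx by simp
    moreover have "zs = []" "zs' = []" using represents_length[OF rep(1)] represents_length[OF rep(2)] True by auto
    ultimately show ?thesis using b nz by simp
  next
    case False
    then have "w \<noteq> []" using lw by auto
    then obtain Z w' where Z: "Z \<in> carrier_mat m m" "det Z = 1 / x" "\<forall>b\<in>set w'. block_ok b"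
      "congr Z (blocks_mat w) = blocks_mat w'" "word_htp (a # diag_entries w) (a * (x * x) # diag_entries w')"
      using scale_blocks[OF R(3) _ x0 nz(1) lw[symmetric]] by blast
    define Q where "Q = x \<cdot>\<^sub>m adj_mat P1"
    have adj: "adj_mat P1 \<in> carrier_mat m m" "P1 * adj_mat P1 = det P1 \<cdot>\<^sub>m 1\<^sub>m m" using adj_mat[OF P1c] by auto
    have Qc: "Q \<in> carrier_mat m m" using adj by (simp add: Q_def)
    have PQ: "P1 * Q = 1\<^sub>m m" unfolding Q_def using mult_smult_distrib[OF P1c adj(1)] adj(2) dx
      by (auto intro!: eq_matI simp: mult.commute)
    have dQ: "det Q = x"
    proof -
      have "det P1 * det Q = 1" using det_mult[OF P1c Qc] PQ by simp
      then show ?thesis using dx by (metis mult_cancel_left mult_zero_left zero_neq_one)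
    qed
    have rw: "represents m N1 (diag_entries w')"
      unfolding represents_def
    proof (intro conjI exI)
      show "Q * R * Z \<in> carrier_mat m m" using Qc R Z by simp
      show "det (Q * R * Z) = 1" using det_mult[OF mult_carrier_mat[OF Qc R(1)] Z(1)] det_mult[OF Qc R(1)] dQ R(2) Z(2) x0 by simp
      have "congr (Q * R * Z) N1 = congr Z (congr R (congr Q N1))"
        using congr_mult[OF mult_carrier_mat[OF Qc R(1)] Z(1) N1c] congr_mult[OF Qc R(1) N1c] by simp
      also have "congr Q N1 = M1" using congr_inv[OF P1c Qc PQ M1] N1e by simp
      finally show "congr (Q * R * Z) N1 = blocks_mat w'" using R(4) Z(4) by simp
    qed (use N1c Z(3) in auto)
    then have "word_htp (diag_entries w') zs'" using IH[OF N1 rw rep(2)] by blast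
    then have "word_htp (a * (x * x) # diag_entries w') (a * (x * x) # zs')" using nz x0 by (intro word_htp_Cons) auto
    with Z(5) have "word_htp (a # zs) (a * (x * x) # zs')" using R(5) word_htp_trans by metis
    then show ?thesis using b by (simp add: ac_simps)
  qed
qed

text \<open>A third decomposition is interposed, with summands M2, C' and b and with the last vector
  of P. It arises from the first by changing only the part C, a, and it shares the split vector with
  the second, so \<open>split_vector_fixed\<close> compares these two.\<close>

lemma split_vector_via: fixes M1 :: "'k::field mat"
  assumes IH: "\<And>(M :: 'k mat) xs ys. symnd m M \<Longrightarrow> represents m M xs \<Longrightarrow> represents m M ys \<Longrightarrow> word_htp xs ys"
    and M1: "symnd m M1" and N1: "symnd m N1" and nz: "a \<noteq> 0" "b \<noteq> 0" and m: "m = Suc l"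
    and P: "P \<in> carrier_mat (Suc m) (Suc m)" "det P = 1" and col: "\<And>i. i < l \<Longrightarrow> P $$ (i, m) = 0"
    and e: "congr P (osum M1 (mat1 a)) = osum N1 (mat1 b)"
    and rep: "represents m N1 zs'"
    and L: "L \<in> carrier_mat m m" "det L = 1" "\<And>i. i < m \<Longrightarrow> L $$ (i, l) = 1\<^sub>m m $$ (i, l)"
      "congr L M1 = osum M2 C" and M2: "M2 \<in> carrier_mat k k" and C: "C \<in> carrier_mat j j" "C' \<in> carrier_mat j j" and kj: "m = k + j" "0 < j"
    and K: "K \<in> carrier_mat (Suc j) (Suc j)" "det K = 1" "congr K (osum C (mat1 a)) = osum C' (mat1 b)"
      "\<And>i. i < Suc j \<Longrightarrow> K $$ (i, j) = (if i = j then P $$ (m, m) else if Suc i = j then P $$ (l, m) else 0)"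
    and ts: "represents m (osum M2 C') ts" "word_htp (a # zs) (b # ts)"
  shows "word_htp (a # zs) (b # zs')"
proof -
  let ?n = "Suc m"
  have M1c: "M1 \<in> carrier_mat m m" using M1 by (simp add: symnd_def)
  let ?M = "osum M1 (mat1 a)"
  have Mc: "?M \<in> carrier_mat ?n ?n" using osum_carrier[OF M1c mat1_carrier(1)] by simp
  obtain L' where L': "L' \<in> carrier_mat m m" "det L' = 1" "L * L' = 1\<^sub>m m" "L' * L = 1\<^sub>m m" using SL_inv[OF L(1,2)] by metis
  \<comment> \<open>Since L fixes the basis vector l, so does its inverse; the coordinates of the
    prescribed vector are therefore unchanged in the new basis.\<close>
  have L'col: "L' $$ (i, l) = 1\<^sub>m m $$ (i, l)" if "i < m" for i
    using mult_last_col[OF L'(1) L(1) L(3) that] L'(4) m by simp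
  define T where "T = osum L (1\<^sub>m 1)"
  define T' where "T' = osum L' (1\<^sub>m 1)"
  have Tc: "T \<in> carrier_mat ?n ?n" "T' \<in> carrier_mat ?n ?n" unfolding T_def T'_def
    using osum_carrier[OF L(1) one_carrier_mat[of 1]] osum_carrier[OF L'(1) one_carrier_mat[of 1]] by auto
  have TT: "T * T' = 1\<^sub>m ?n" unfolding T_def T'_def
    using osum_mult[OF L(1) one_carrier_mat L'(1) one_carrier_mat] L'(3) osum_one[of m 1] by simp
  have dT': "det T' = 1" unfolding T'_def using osum_det[OF L'(1) one_carrier_mat[of 1]] L'(2) by simp
  define P' where "P' = T' * P"
  have P': "P' \<in> carrier_mat ?n ?n" "det P' = 1" unfolding P'_def using Tc P det_mult[OF Tc(2) P(1)] dT' by auto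
  have P'col: "P' $$ (i, m) = (if i = m then P $$ (m, m) else if i = l then P $$ (l, m) else 0)" if "i < ?n" for i
  proof (cases "i < m")
    case True
    have "P' $$ (i, m) = (\<Sum>k<Suc l. L' $$ (i, k) * P $$ (k, m))"
      unfolding P'_def T'_def using osum_one_last_col[OF L'(1) P(1) that, of m] True m by simp
    also have "\<dots> = L' $$ (i, l) * P $$ (l, m)"
      using col by (subst sum.lessThan_Suc, subst sum.neutral) auto
    finally show ?thesis using L'col[OF True] True m by auto
  next
    case False
    then show ?thesis unfolding P'_def T'_def using osum_one_last_col[OF L'(1) P(1) that, of m] that by simp
  qed
  have T_M: "congr T ?M = osum M2 (osum C (mat1 a))"
    unfolding T_def using congr_osum[OF L(1) one_carrier_mat M1c mat1_carrier(1), of a] L(4) by (simp add: osum_assoc)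
  define V where "V = osum (1\<^sub>m k) K"
  have Vc: "V \<in> carrier_mat ?n ?n" unfolding V_def using osum_carrier[OF one_carrier_mat[of k] K(1)] kj by simp
  have dV: "det V = 1" unfolding V_def using osum_det[OF one_carrier_mat[of k] K(1)] K(2) by simp
  obtain V' where V': "V' \<in> carrier_mat ?n ?n" "det V' = 1" "V * V' = 1\<^sub>m ?n" "V' * V = 1\<^sub>m ?n"
    using SL_inv[OF Vc dV] by metis
  have Vcol: "V $$ (i, m) = P' $$ (i, m)" if "i < ?n" for i
  proof (cases "i < k")
    case True
    then show ?thesis using that K kj m C P'col[OF that] by (auto simp: V_def osum_def)
  next
    case False
    have "V $$ (i, m) = K $$ (i - k, j)" using False that K kj by (simp add: V_def osum_def)
    also have "\<dots> = P' $$ (i, m)" using K(4)[of "i - k"] P'col[OF that] False that kj m by auto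
    finally show ?thesis .
  qed
  \<comment> \<open>The base change from the third decomposition to the second. V and P' have the
    same last column, so the last column of this one is a unit vector.\<close>
  define P2 where "P2 = V' * P'"
  have P2: "P2 \<in> carrier_mat ?n ?n" "det P2 = 1" unfolding P2_def using V' P' det_mult[OF V'(1) P'(1)] by auto
  have P2col: "P2 $$ (i, m) = 0" if "i < m" for i
  proof -
    have "P2 $$ (i, m) = (\<Sum>q<?n. V' $$ (i, q) * P' $$ (q, m))"
      unfolding P2_def by (rule mult_entry[OF V'(1) P'(1)]) (use that in auto)
    also have "\<dots> = (\<Sum>q<?n. V' $$ (i, q) * V $$ (q, m))" using Vcol by simp
    also have "\<dots> = (V' * V) $$ (i, m)" by (rule mult_entry[OF V'(1) Vc, symmetric]) (use that in auto)
    finally show ?thesis using V'(4) that by simp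
  qed
  have M3: "congr V (congr T ?M) = osum (osum M2 C') (mat1 b)"
    unfolding T_M V_def using congr_osum[OF one_carrier_mat K(1) M2 osum_carrier[OF C(1) mat1_carrier(1), of a, simplified]] K(3) M2
    by (simp add: osum_assoc)
  have e2: "congr P2 (osum (osum M2 C') (mat1 b)) = osum N1 (mat1 b)"
    unfolding M3[symmetric] P2_def using congr_transfer[OF Vc V'(1) P'(1) congr_carrier[OF Tc(1) Mc] V'(3)]
      congr_transfer[OF Tc(1,2) P(1) Mc TT] e by (simp add: P'_def)
  have MC: "osum M2 C' \<in> carrier_mat m m" using osum_carrier[OF M2 C(2)] kj by simp
  have "word_htp (b # ts) (b # zs')"
    by (rule split_vector_fixed[OF IH MC N1 nz(2,2) P2 P2col e2 ts(1) rep])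
  then show ?thesis using ts(2) word_htp_trans by blast
qed

text \<open>The last basis vector v of P lies in the plane spanned by the last two coordinate vectors e, e'. If e has
nonzero value, the plane is an orthogonal sum, and its orthogonal basis can be changed to one that contains v. If e is
isotropic, it is completed to a regular plane inside the complement of e', and e stays orthogonal to v; then the two
complements differ by a plane of type [[f, c], [c, 0]], whose word depends on c alone.\<close>

lemma split_vector_adapted: fixes M1 :: "'k::field mat"
  assumes IH: "\<And>k (M :: 'k mat) xs ys. k < Suc m \<Longrightarrow> symnd k M \<Longrightarrow> represents k M xs \<Longrightarrow> represents k M ys \<Longrightarrow> word_htp xs ys"
    and M1: "symnd m M1" and N1: "symnd m N1" and nz: "a \<noteq> 0" "b \<noteq> 0" and m: "m = Suc l"
    and P: "P \<in> carrier_mat (Suc m) (Suc m)" "det P = 1" and col: "\<And>i. i < l \<Longrightarrow> P $$ (i, m) = 0"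
    and e: "congr P (osum M1 (mat1 a)) = osum N1 (mat1 b)"
    and rep: "represents m M1 zs" "represents m N1 zs'"
  shows "word_htp (a # zs) (b # zs')"
proof -
  let ?n = "Suc m"
  have IHm: "word_htp xs ys" if "symnd m M" "represents m M xs" "represents m M ys" for M :: "'k mat" and xs ys
    using IH[of m M xs ys] that by simp
  have M1c: "M1 \<in> carrier_mat m m" and N1c: "N1 \<in> carrier_mat m m" using M1 N1 by (auto simp: symnd_def)
  let ?M = "osum M1 (mat1 a)"
  have Mc: "?M \<in> carrier_mat ?n ?n" using osum_carrier[OF M1c mat1_carrier(1)] by simp
  define g where "g = P $$ (l, m)"
  define x where "x = P $$ (m, m)"
  define d where "d = M1 $$ (l, l)"
  \<comment> \<open>The value of v = g e + x e'. There is no mixed term, as e' is orthogonal to the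
    other coordinate vectors.\<close>
  have b: "b = d * (g * g) + a * (x * x)"
  proof -
    have "b = congr P ?M $$ (m, m)" unfolding e using N1c by (simp add: osum_def)
    also have "\<dots> = (\<Sum>q<?n. (\<Sum>p<?n. P $$ (p, m) * ?M $$ (p, q)) * P $$ (q, m))"
      by (rule congr_entry[OF P(1) Mc]) auto
    also have "\<dots> = (\<Sum>q<?n. (P $$ (l, m) * ?M $$ (l, q) + P $$ (m, m) * ?M $$ (m, q)) * P $$ (q, m))"
    proof (rule sum.cong[OF refl])
      fix q
      have "(\<Sum>p<l. P $$ (p, m) * ?M $$ (p, q)) = 0" by (rule sum.neutral) (use col in auto)
      then show "(\<Sum>p<?n. P $$ (p, m) * ?M $$ (p, q)) * P $$ (q, m) =
        (P $$ (l, m) * ?M $$ (l, q) + P $$ (m, m) * ?M $$ (m, q)) * P $$ (q, m)" by (simp add: m)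
    qed
    also have "\<dots> = (P $$ (l, m) * ?M $$ (l, l) + P $$ (m, m) * ?M $$ (m, l)) * P $$ (l, m)
        + (P $$ (l, m) * ?M $$ (l, m) + P $$ (m, m) * ?M $$ (m, m)) * P $$ (m, m)"
    proof -
      have "(\<Sum>q<l. (P $$ (l, m) * ?M $$ (l, q) + P $$ (m, m) * ?M $$ (m, q)) * P $$ (q, m)) = 0"
        by (rule sum.neutral) (use col in auto)
      then show ?thesis by (simp add: m)
    qed
    also have "\<dots> = d * (g * g) + a * (x * x)" using M1c m by (simp add: osum_def g_def x_def d_def ac_simps)
    finally show ?thesis .
  qed
  show ?thesis
  proof (cases "g = 0")
    case True
    have pcol: "P $$ (i, m) = 0" if "i < m" for i using that col[of i] True m by (cases "i = l") (auto simp: g_def)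
    show ?thesis by (rule split_vector_fixed[OF IHm M1c N1 nz P pcol e rep])
  next
    case g: False
    show ?thesis
    proof (cases "d = 0")
      case False
      then obtain R A where R: "R \<in> carrier_mat 1 l" "A \<in> carrier_mat l l" "congr (lower_unip l 1 R) M1 = osum A (mat1 d)"
        using anisotropic_split[of l M1] M1 m unfolding d_def by (metis dvd_field_iff)
      have Lc: "lower_unip l 1 R \<in> carrier_mat m m" using lower_unip_carrier[OF R(1)] m by simp
      have "symnd m (osum A (mat1 d))" unfolding R(3)[symmetric] by (rule symnd_congr[OF M1 Lc]) (use R in simp)
      then have "symnd l A" using symnd_osumD[OF R(2) mat1_carrier(1)] m by simp
      then obtain rs where rs: "represents l A rs" using represents_exists by blast
      have rM1: "represents m M1 (d # rs)"
        by (rule represents_congrD[OF _ Lc _ M1c]) (use represents_One[OF rs False] R m in auto)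
      have nzrs: "all_nonzero rs" using represents_all_nonzero[OF rs] .
      show ?thesis
      proof (rule split_vector_via[OF IHm M1 N1 nz m P col e rep(2), where L = "lower_unip l 1 R" and ?M2.0 = A
            and C = "mat1 d" and C' = "mat1 (d * a / b)" and k = l and j = 1 and K = "rebase2 a d g x"
            and ts = "d * a / b # rs"])
        show "det (rebase2 a d g x) = 1" by (rule conn_det[OF rebase2(2)[OF b nz(2)]])
        show "congr (rebase2 a d g x) (osum (mat1 d) (mat1 a)) = osum (mat1 (d * a / b)) (mat1 b)"
          unfolding osum_mat1_mat1 by (rule rebase2(3)[OF b nz(2)])
        show "represents m (osum A (mat1 (d * a / b))) (d * a / b # rs)"
          using represents_One[OF rs, of "d * a / b"] False nz m by simp
        have "word_htp (a # zs) (a # d # rs)" using IHm[OF M1 rep(1) rM1] nz word_htp_Cons by blast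
        also have "word_htp (a # d # rs) (b # d * a / b # rs)"
          by (rule word_htp_head2[OF word_htp_move[OF _ b]]) (use nz False nzrs in auto)
        finally show "word_htp (a # zs) (b # d * a / b # rs)" .
        fix i assume "i < Suc 1"
        then show "rebase2 a d g x $$ (i, 1) =
            (if i = 1 then P $$ (m, m) else if Suc i = 1 then P $$ (l, m) else 0)"
          unfolding rebase2(1)[OF b nz(2)] by (auto simp: less_Suc_eq g_def x_def)
      next
        fix i assume "i < m"
        then show "lower_unip l 1 R $$ (i, l) = 1\<^sub>m m $$ (i, l)" using R(1) m by (auto simp: lower_unip_def)
      qed (use Lc R m conn_carrier[OF rebase2(2)[OF b nz(2)]] in \<open>auto simp: numeral_2_eq_2[symmetric]\<close>)
    next
      case d: True
      have ax: "b = a * (x * x)" using b d by simp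
      then have x: "x \<noteq> 0" using nz by auto
      obtain k L A c f where L: "l = Suc k" "L \<in> carrier_mat m m" "det L = 1"
        "\<And>i. i < m \<Longrightarrow> L $$ (i, l) = 1\<^sub>m m $$ (i, l)"
        "A \<in> carrier_mat k k" "c \<noteq> 0" "congr L M1 = osum A (mat2 f c c 0)"
        using isotropic_split_field[of l M1] M1 d m unfolding d_def by metis
      have "symnd m (osum A (mat2 f c c 0))" unfolding L(7)[symmetric] by (rule symnd_congr[OF M1 L(2)]) (use L in simp)
      then have "symnd k A" using symnd_osumD[OF L(5) mat2_carrier(1), of f c c 0] m L(1) by simp
      then obtain rs where rs: "represents k A rs" using represents_exists by blast
      have rM1: "represents m M1 (1 # - (c * c) # rs)"
        by (rule represents_congrD[OF _ L(2,3) M1c]) (use represents_Two[OF rs L(6), of f] L m in simp)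
      have nzrs: "all_nonzero rs" using represents_all_nonzero[OF rs] .
      \<comment> \<open>Chosen to make the first plane vector plus \<rho> v orthogonal to v: their
        product is c g + \<rho> b.\<close>
      define \<rho> where "\<rho> = - (c * g / b)"
      define f' where "f' = f + 2 * (\<rho> * (c * g)) + \<rho> * \<rho> * b"
      let ?C' = "mat2 f' (c / x) (c / x) 0"
      define R where "R = mat 1 2 (\<lambda>(i, j :: nat). if j = 0 then \<rho> else 0)"
      \<comment> \<open>Its columns are the first plane vector plus \<rho> v, the isotropic vector
        divided by x, and v; the division makes the determinant 1.\<close>
      define K where "K = osum (mat1 1) (mat2 (1 / x) g 0 x) * lower_unip 2 1 R"
      have Rc: "R \<in> carrier_mat 1 2" by (simp add: R_def)
      have oc: "osum (mat1 1) (mat2 (1 / x) g 0 x) \<in> carrier_mat 3 3" using osum_carrier[OF mat1_carrier(1) mat2_carrier(1)] by (simp add: numeral_3_eq_3)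
      have lc: "lower_unip 2 1 R \<in> carrier_mat 3 3" using lower_unip_carrier[OF Rc] by (simp add: numeral_3_eq_3)
      have K: "K = mat3 1 0 0 (\<rho> * g) (1 / x) g (\<rho> * x) 0 x" unfolding K_def R_def lower_unip_2_1 osum_mat1_mat2 by (simp add: mult.commute)
      have dK: "det K = 1" unfolding K_def using det_mult[OF oc lc] osum_det[OF mat1_carrier(1)[of 1] mat2_carrier(1)[of "1 / x" g 0 x]] Rc x by simp
      show ?thesis
      proof (rule split_vector_via[OF IHm M1 N1 nz m P col e rep(2) L(2-4,7,5), where C' = ?C' and j = 2 and K = K
            and ts = "1 # - (c / x * (c / x)) # rs"])
        have 1: "c * g + \<rho> * b = 0" using nz by (simp add: \<rho>_def)
        have h1: "c * g + a * (x * (x * \<rho>)) = 0" using 1 unfolding ax by (simp add: ac_simps)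
        show "congr K (osum (mat2 f c c 0) (mat1 a)) = osum ?C' (mat1 b)"
          unfolding K osum_mat2_mat1 congr_def using x h1 by (simp add: f'_def ax algebra_simps)
        show "represents m (osum A ?C') (1 # - (c / x * (c / x)) # rs)"
          using represents_Two[OF rs, of "c / x" f'] L m x by simp
        have "word_htp (a # zs) (a # 1 # - (c * c) # rs)" using IHm[OF M1 rep(1) rM1] nz word_htp_Cons by blast
        also have "word_htp (a # 1 # - (c * c) # rs) (a * (x * x) # 1 # - (c * c) / (x * x) # rs)"
          by (rule word_htp_scale3) (use nz L nzrs x in auto)
        finally show "word_htp (a # zs) (b # 1 # - (c / x * (c / x)) # rs)" by (simp add: ax)
        fix i assume "i < Suc 2"
        then show "K $$ (i, 2) = (if i = 2 then P $$ (m, m) else if Suc i = 2 then P $$ (l, m) else 0)"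
          unfolding K by (auto simp: less_Suc_eq g_def x_def mat3_def)
      qed (use L m dK in \<open>auto simp: K\<close>)
    qed
  qed
qed

text \<open>Euclidean reduction inside the complement of the first split vector brings the
  projection of the second to a multiple of one basis vector, the situation of
  \<open>split_vector_adapted\<close>.\<close>

lemma split_vector_unique: fixes M1 :: "'k::field mat"
  assumes IH: "\<And>k (M :: 'k mat) xs ys. k < Suc m \<Longrightarrow> symnd k M \<Longrightarrow> represents k M xs \<Longrightarrow> represents k M ys \<Longrightarrow> word_htp xs ys"
    and M1: "symnd m M1" and N1: "symnd m N1" and nz: "a \<noteq> 0" "b \<noteq> 0"
    and P: "P \<in> carrier_mat (Suc m) (Suc m)" "det P = 1"
    and e: "congr P (osum M1 (mat1 a)) = osum N1 (mat1 b)"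
    and rep: "represents m M1 zs" "represents m N1 zs'"
  shows "word_htp (a # zs) (b # zs')"
proof (cases m)
  case 0
  have M1c: "M1 \<in> carrier_mat m m" using M1 by (simp add: symnd_def)
  show ?thesis by (rule split_vector_fixed[OF IH[OF lessI] M1c N1 nz P _ e rep]) (use 0 in auto)
next
  case (Suc l)
  let ?n = "Suc m"
  have M1c: "M1 \<in> carrier_mat m m" using M1 by (simp add: symnd_def)
  have Mc: "osum M1 (mat1 a) \<in> carrier_mat ?n ?n" using osum_carrier[OF M1c mat1_carrier(1)] by simp
  define y where "y = mat m 1 (\<lambda>(i, _). P $$ (i, m))"
  obtain S where S: "S \<in> carrier_mat m m" "det S = 1" "\<And>j. j < l \<Longrightarrow> (S\<^sup>T * y) $$ (j, 0) = 0"
    using conn_euclid_field[of y l] Suc by (auto simp: y_def)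
  have ST: "S\<^sup>T \<in> carrier_mat m m" "det (S\<^sup>T) = 1" using S det_transpose[OF S(1)] by auto
  obtain R where R: "R \<in> carrier_mat m m" "det R = 1" "R * S\<^sup>T = 1\<^sub>m m" using SL_inv[OF ST] by metis
  define T where "T = osum R (1\<^sub>m 1)"
  define T' where "T' = osum (S\<^sup>T) (1\<^sub>m 1)"
  have Tc: "T \<in> carrier_mat ?n ?n" "T' \<in> carrier_mat ?n ?n" unfolding T_def T'_def
    using osum_carrier[OF R(1) one_carrier_mat[of 1]] osum_carrier[OF ST(1) one_carrier_mat[of 1]] by auto
  have TT: "T * T' = 1\<^sub>m ?n" unfolding T_def T'_def
    using osum_mult[OF R(1) one_carrier_mat ST(1) one_carrier_mat] R(3) osum_one[of m 1] by simp
  have dT': "det T' = 1" unfolding T'_def using osum_det[OF ST(1) one_carrier_mat[of 1]] ST(2) by simp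
  have TM: "congr T (osum M1 (mat1 a)) = osum (congr R M1) (mat1 a)"
    unfolding T_def using congr_osum[OF R(1) one_carrier_mat M1c mat1_carrier(1), of a] by simp
  show ?thesis
  proof (rule split_vector_adapted[OF _ _ N1 nz Suc, where ?M1.0 = "congr R M1" and P = "T' * P"])
    show "word_htp xs ys" if "k < Suc m" "symnd k M" "represents k M xs" "represents k M ys" for k and M :: "'k mat" and xs ys
      using IH that by blast
    show "symnd m (congr R M1)" by (rule symnd_congr[OF M1 R(1)]) (use R in simp)
    show "T' * P \<in> carrier_mat ?n ?n" using Tc P by simp
    show "det (T' * P) = 1" using det_mult[OF Tc(2) P(1)] dT' P by simp
    show "congr (T' * P) (osum (congr R M1) (mat1 a)) = osum N1 (mat1 b)"
      unfolding TM[symmetric] using congr_transfer[OF Tc P(1) Mc TT] e by simp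
    show "represents m (congr R M1) zs" by (rule represents_congr[OF rep(1) R(1,2)])
    show "represents m N1 zs'" by (rule rep(2))
    fix i assume i: "i < l"
    have "(T' * P) $$ (i, m) = (\<Sum>k<m. S\<^sup>T $$ (i, k) * P $$ (k, m))"
      unfolding T'_def using osum_one_last_col[OF ST(1) P(1), of i m] i Suc by simp
    also have "\<dots> = (S\<^sup>T * y) $$ (i, 0)"
      using mult_entry[OF ST(1), of y 1 i 0] i Suc by (simp add: y_def)
    finally show "(T' * P) $$ (i, m) = 0" using S(3)[OF i] by simp
  qed
qed

text \<open>Alternating forms in characteristic 2 have no orthogonal basis; their words are determined by the determinant.\<close>

definition alternating_blocks :: "'k::field block list \<Rightarrow> bool" where
  "alternating_blocks w \<longleftrightarrow> (\<forall>b\<in>set w. \<exists>c. b = Two c 0) \<and> (w = [] \<or> (2::'k) = 0)"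

section \<open>Lines split off and alternating forms\<close>

text \<open>The word is matched up to homotopy only, so that a line may be found inside a plane or
  at a later position of the given word.\<close>

definition line_split :: "nat \<Rightarrow> 'k::field mat \<Rightarrow> 'k list \<Rightarrow> bool" where
  "line_split n M xs \<longleftrightarrow> (\<exists>m Q N a zs. n = Suc m \<and> Q \<in> carrier_mat n n \<and> det Q = 1 \<and> N \<in> carrier_mat m m \<and>
     congr Q M = osum N (mat1 a) \<and> a \<noteq> 0 \<and> represents m N zs \<and> word_htp (a # zs) xs)"

lemma line_split_congrD: assumes "line_split n (congr P M) xs" "P \<in> carrier_mat n n" "det P = 1" "M \<in> carrier_mat n n"
  shows "line_split n M xs"
proof -
  obtain m Q N a zs where Q: "n = Suc m" "Q \<in> carrier_mat n n" "det Q = 1" "N \<in> carrier_mat m m"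
     "congr Q (congr P M) = osum N (mat1 a)" "a \<noteq> 0" "represents m N zs" "word_htp (a # zs) xs"
    using assms(1) unfolding line_split_def by blast
  have "congr (P * Q) M = osum N (mat1 a)" using congr_mult[OF assms(2) Q(2) assms(4)] Q(5) by simp
  moreover have "det (P * Q) = 1" using det_mult[OF assms(2) Q(2)] assms Q by simp
  moreover have "P * Q \<in> carrier_mat n n" using assms Q by simp
  ultimately show ?thesis unfolding line_split_def using Q by blast
qed

lemma line_split_Two: assumes "c \<noteq> 0" "f \<noteq> 0" "\<forall>b\<in>set w. block_ok b"
  shows "line_split (length (diag_entries w) + 2) (blocks_mat (Two c f # w)) (diag_entries (Two c f # w))"
proof -
  let ?k = "length (diag_entries w)"
  have wc: "blocks_mat w \<in> carrier_mat ?k ?k" by (rule blocks_mat_carrier)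
  have rw: "represents ?k (blocks_mat w) (diag_entries w)" unfolding represents_def
    using wc assms(3) by (intro conjI exI[of _ "1\<^sub>m ?k"] exI[of _ w]) auto
  let ?K = "mat2 (c / f) 1 (-1) 0" and ?d = "- (c * c / f)"
  have d: "?d \<noteq> 0" using assms by simp
  have "congr (osum (1\<^sub>m ?k) ?K) (blocks_mat (Two c f # w)) = osum (blocks_mat w) (congr ?K (mat2 f c c 0))"
    using congr_osum[OF one_carrier_mat mat2_carrier(1) wc mat2_carrier(1)] wc by simp
  also have "congr ?K (mat2 f c c 0) = osum (mat1 ?d) (mat1 f)"
    unfolding osum_mat1_mat1 congr_def using assms by (simp add: field_simps)
  finally have e: "congr (osum (1\<^sub>m ?k) ?K) (blocks_mat (Two c f # w)) = osum (osum (blocks_mat w) (mat1 ?d)) (mat1 f)"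
    by (simp add: osum_assoc)
  have 1: "det (osum (1\<^sub>m ?k) ?K) = 1" by (subst osum_det[OF one_carrier_mat mat2_carrier(1)]) simp
  have 2: "osum (1\<^sub>m ?k) ?K \<in> carrier_mat (?k + 2) (?k + 2)" using osum_carrier[OF one_carrier_mat mat2_carrier(1)] .
  have 3: "word_htp (f # ?d # diag_entries w) (diag_entries (Two c f # w))"
    using word_htp_head2[OF word_htp_plane[OF assms(1,2)] all_nonzero_diag_entries[OF assms(3)]] by simp
  show ?thesis unfolding line_split_def
    by (rule exI[of _ "Suc ?k"], rule exI, rule exI, rule exI, rule exI[of _ "?d # diag_entries w"])
      (use 1 2 3 e represents_One[OF rw d] osum_carrier[OF wc mat1_carrier(1), of ?d] assms in auto)
qed

text \<open>A plane with f = 0 contains a vector of value 2 c, which is nonzero outside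
  characteristic 2. In characteristic 2 a line found in the later blocks is moved past the plane, so
  only sums of planes with f = 0 resist.\<close>

lemma line_split_or_alternating: fixes w :: "'k::field block list"
  assumes "\<forall>b\<in>set w. block_ok b"
  shows "line_split (length (diag_entries w)) (blocks_mat w) (diag_entries w) \<or> alternating_blocks w"
  using assms
proof (induction w)
  case Nil
  then show ?case by (simp add: alternating_blocks_def)
next
  case (Cons b w)
  let ?k = "length (diag_entries w)"
  have wc: "blocks_mat w \<in> carrier_mat ?k ?k" by (rule blocks_mat_carrier)
  have ok: "\<forall>b\<in>set w. block_ok b" using Cons.prems by simp
  have rw: "represents ?k (blocks_mat w) (diag_entries w)" unfolding represents_def
    using wc ok by (intro conjI exI[of _ "1\<^sub>m ?k"] exI[of _ w]) auto
  show ?case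
  proof (cases b)
    case (One a)
    then have a: "a \<noteq> 0" using Cons.prems by auto
    have "osum (blocks_mat w) (mat1 a) \<in> carrier_mat (Suc ?k) (Suc ?k)" using osum_carrier[OF wc mat1_carrier(1)] by simp
    moreover have "all_nonzero (a # diag_entries w)" using a all_nonzero_diag_entries[OF ok] by simp
    ultimately have "line_split (Suc ?k) (osum (blocks_mat w) (mat1 a)) (a # diag_entries w)"
      unfolding line_split_def using wc a rw
      by (intro exI[of _ ?k] exI[of _ "1\<^sub>m (Suc ?k)"] exI[of _ "blocks_mat w"] exI[of _ a] exI[of _ "diag_entries w"]) auto
    then show ?thesis using One by simp
  next
    case (Two c f)
    then have c: "c \<noteq> 0" using Cons.prems by auto
    have bc: "blocks_mat (Two c f # w) \<in> carrier_mat (?k + 2) (?k + 2)"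
      using osum_carrier[OF wc mat2_carrier(1)] by simp
    consider (f) "f \<noteq> 0" | (odd) "f = 0" "(2::'k) \<noteq> 0" | (even) "f = 0" "(2::'k) = 0" by blast
    then show ?thesis
    proof cases
      case f
      then show ?thesis using line_split_Two[OF c f ok] Two by simp
    next
      case odd
      let ?P = "osum (1\<^sub>m ?k) (mat2 1 0 1 (1::'k))"
      have P: "?P \<in> carrier_mat (?k + 2) (?k + 2)" "det ?P = 1"
        using osum_carrier[OF one_carrier_mat mat2_carrier(1)] osum_det[OF one_carrier_mat[of ?k] mat2_carrier(1)[of 1 0 1 "1::'k"]] by auto
      have "congr (mat2 1 0 1 1) (mat2 0 c c 0) = mat2 (2 * c) c c 0" by (simp add: congr_def)
      then have "congr ?P (blocks_mat (Two c f # w)) = blocks_mat (Two c (2 * c) # w)"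
        using congr_osum[OF one_carrier_mat mat2_carrier(1) wc mat2_carrier(1), of 1 0 1 1 0 c c 0] wc odd by simp
      moreover have "line_split (?k + 2) (blocks_mat (Two c (2 * c) # w)) (diag_entries (Two c (2 * c) # w))"
        using line_split_Two[OF c _ ok, of "2 * c"] odd c by simp
      ultimately have "line_split (?k + 2) (blocks_mat (Two c f # w)) (diag_entries (Two c f # w))"
        using line_split_congrD[OF _ P bc] by simp
      then show ?thesis using Two by simp
    next
      case even
      show ?thesis
      proof (cases "alternating_blocks w")
        case True
        then have "alternating_blocks (b # w)" using Two even by (auto simp: alternating_blocks_def)
        then show ?thesis by blast
      next
        case False
        then obtain m Q N a zs where Q: "?k = Suc m" "Q \<in> carrier_mat ?k ?k" "det Q = 1" "N \<in> carrier_mat m m"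
          "congr Q (blocks_mat w) = osum N (mat1 a)" "a \<noteq> 0" "represents m N zs" "word_htp (a # zs) (diag_entries w)"
          using Cons.IH ok unfolding line_split_def by blast
        let ?P = "osum Q (1\<^sub>m 2)"
        have P: "?P \<in> carrier_mat (?k + 2) (?k + 2)" "det ?P = 1"
          using osum_carrier[OF Q(2) one_carrier_mat[of 2]] osum_det[OF Q(2) one_carrier_mat[of 2]] Q(3) by auto
        have e1: "congr ?P (blocks_mat (Two c f # w)) = osum N (osum (mat1 a) (mat2 0 c c 0))"
          using congr_osum[OF Q(2) one_carrier_mat wc mat2_carrier(1), of 0 c c 0] Q(5) even by (simp add: osum_assoc)
        \<comment> \<open>A cyclic permutation of the coordinates up to signs. The signs come from
          its factorization into two plane rotations, and on the plane they cancel.\<close>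
        let ?C = "mat3 0 0 1 (-1) 0 0 0 (-1) (0::'k)"
        have C: "?C = osum (mat2 0 1 (-1) 0) (mat1 1) * osum (mat1 1) (mat2 0 1 (-1) 0)"
          unfolding osum_mat2_mat1 osum_mat1_mat2 by simp
        have 21: "osum (mat2 0 1 (-1) 0) (mat1 (1::'k)) \<in> carrier_mat 3 3" and 12: "osum (mat1 (1::'k)) (mat2 0 1 (-1) 0) \<in> carrier_mat 3 3"
          unfolding osum_mat2_mat1 osum_mat1_mat2 by simp_all
        have dC: "det ?C = 1" unfolding C det_mult[OF 21 12]
          by (subst osum_det[OF mat2_carrier(1) mat1_carrier(1)], subst osum_det[OF mat1_carrier(1) mat2_carrier(1)]) simp
        let ?V = "osum (1\<^sub>m m) ?C"
        have V: "?V \<in> carrier_mat (?k + 2) (?k + 2)" "det ?V = 1"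
          using osum_carrier[OF one_carrier_mat[of m] mat3_carrier(1)[of 0 0 1 "-1" 0 0 0 "-1" "0::'k"]] Q(1) dC
            osum_det[OF one_carrier_mat[of m] mat3_carrier(1)[of 0 0 1 "-1" 0 0 0 "-1" "0::'k"]]
          by (auto simp: numeral_3_eq_3)
        have Cc: "congr ?C (osum (mat1 a) (mat2 0 c c 0)) = osum (mat2 0 c c 0) (mat1 a)"
          unfolding osum_mat2_mat1 osum_mat1_mat2 congr_def by simp
        have am: "osum (mat1 a) (mat2 0 c c 0) \<in> carrier_mat 3 3" unfolding osum_mat1_mat2 by simp
        have e2: "congr ?V (osum N (osum (mat1 a) (mat2 0 c c 0))) = osum (osum N (mat2 0 c c 0)) (mat1 a)"
          using congr_osum[OF one_carrier_mat mat3_carrier(1) Q(4) am] Q(4) Cc by (simp add: osum_assoc)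
        have Nc: "osum N (mat2 0 c c 0) \<in> carrier_mat (Suc ?k) (Suc ?k)"
          using osum_carrier[OF Q(4) mat2_carrier(1)] Q(1) by simp
        have nzs: "all_nonzero zs" using represents_all_nonzero[OF Q(7)] .
        have "word_htp ([a] @ [1, - (c * c)]) ([1, - (c * c)] @ [a])" by (rule word_htp_commute) (use Q c in auto)
        then have "word_htp (([a] @ [1, - (c * c)]) @ zs) (([1, - (c * c)] @ [a]) @ zs)" using word_htp_append nzs word_htp_refl by blast
        also have "([1, - (c * c)] @ [a]) @ zs = [1, - (c * c)] @ (a # zs)" by simp
        also have "word_htp ([1, - (c * c)] @ (a # zs)) ([1, - (c * c)] @ diag_entries w)"
          by (rule word_htp_append[OF _ Q(8)]) (use c in auto)
        finally have ev: "word_htp (a # 1 # - (c * c) # zs) (diag_entries (Two c f # w))" by simp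
        have r: "represents (Suc ?k) (osum N (mat2 0 c c 0)) (1 # - (c * c) # zs)"
          using represents_Two[OF Q(7) c, of 0] Q(1) by simp
        have Mc: "osum (osum N (mat2 0 c c 0)) (mat1 a) \<in> carrier_mat (?k + 2) (?k + 2)"
          using osum_carrier[OF Nc mat1_carrier(1)] by simp
        have "line_split (?k + 2) (osum (osum N (mat2 0 c c 0)) (mat1 a)) (diag_entries (Two c f # w))"
          unfolding line_split_def using Nc Mc r ev Q(6)
          by (intro exI[of _ "Suc ?k"] exI[of _ "1\<^sub>m (?k + 2)"] exI[of _ "osum N (mat2 0 c c 0)"] exI[of _ a] exI[of _ "1 # - (c * c) # zs"]) auto
        then have "line_split (?k + 2) (congr ?V (congr ?P (blocks_mat (Two c f # w)))) (diag_entries (Two c f # w))"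
          unfolding e1 e2 .
        then have "line_split (?k + 2) (blocks_mat (Two c f # w)) (diag_entries (Two c f # w))"
          using line_split_congrD[OF line_split_congrD[OF _ V] P bc] P(1) bc by simp
        then show ?thesis using Two by simp
      qed
    qed
  qed
qed

lemma char2_neg: "(2::'k::field) = 0 \<Longrightarrow> - x = (x::'k)"
  by (metis add_eq_0_iff mult_2 mult_zero_left)

text \<open>In characteristic 2 the letter -c^2 is a square, so each plane contributes a 1 and a
  square. The head letter of the later word absorbs the square and ends as the determinant.\<close>

lemma alternating_word_htp: fixes w :: "'k::field block list"
  assumes "alternating_blocks w" "\<forall>b\<in>set w. block_ok b" "w \<noteq> []"
  shows "word_htp (diag_entries w) (det (blocks_mat w) # replicate (length (diag_entries w) - 1) 1)"
  using assms
proof (induction w)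
  case (Cons b w)
  have two: "(2::'k) = 0" using Cons.prems by (simp add: alternating_blocks_def)
  obtain c where b: "b = Two c 0" using Cons.prems by (auto simp: alternating_blocks_def)
  then have c: "c \<noteq> 0" using Cons.prems by auto
  note neg = char2_neg[OF two]
  have cc: "- (c * c) = c * c" by (rule neg)
  have det: "det (blocks_mat (b # w)) = det (blocks_mat w) * (c * c)"
    using osum_det[OF blocks_mat_carrier[of w] mat2_carrier(1)[of 0 c c 0]] b cc by simp
  show ?case
  proof (cases "w = []")
    case True
    then have "diag_entries (b # w) = [1, c * c]" "det (blocks_mat (b # w)) = c * c" using b det cc by simp_all
    then show ?thesis using word_htp_swap[of 1 "c * c"] c by simp
  next
    case False
    let ?d = "det (blocks_mat w)" and ?r = "replicate (length (diag_entries w) - 1) (1::'k)"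
    have IH: "word_htp (diag_entries w) (?d # ?r)"
      using Cons.IH Cons.prems False by (auto simp: alternating_blocks_def)
    then have nz: "all_nonzero (?d # ?r)" using word_htp_all_nonzero by blast
    have lw: "length (diag_entries w) = Suc (length (diag_entries w) - 1)" using IH unfolding word_htp_def by simp
    have "word_htp (1 # c * c # diag_entries w) (1 # c * c # ?d # ?r)"
      by (rule word_htp_Cons[OF _ word_htp_Cons[OF _ IH]]) (use c in auto)
    also have "word_htp (1 # c * c # ?d # ?r) (1 # ?d # c * c # ?r)"
      by (rule word_htp_Cons[OF _ word_htp_head2[OF word_htp_swap]]) (use nz c in auto)
    also have "word_htp (1 # ?d # c * c # ?r) (1 # ?d * (c * c) # c * c / (c * c) # ?r)"
      by (rule word_htp_Cons[OF _ word_htp_head2[OF word_htp_scale]]) (use nz c in auto)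
    also have "word_htp (1 # ?d * (c * c) # c * c / (c * c) # ?r) (?d * (c * c) # 1 # c * c / (c * c) # ?r)"
      by (rule word_htp_head2[OF word_htp_swap]) (use nz c in auto)
    also have "?d * (c * c) # 1 # c * c / (c * c) # ?r = det (blocks_mat (b # w)) # replicate (length (diag_entries (b # w)) - 1) 1"
      unfolding det using c lw b by (metis diag_entries_simps(3) length_Cons diff_Suc_1 divide_self_if no_zero_divisors replicate_Suc)
    finally show ?thesis unfolding b diag_entries_simps cc .
  qed
qed simp

lemma alternating_diag: fixes w :: "'k::field block list"
  assumes "alternating_blocks w" shows "i < length (diag_entries w) \<Longrightarrow> blocks_mat w $$ (i, i) = 0"
  using assms
proof (induction w arbitrary: i)
  case (Cons b w)
  obtain c where b: "b = Two c 0" using Cons.prems by (auto simp: alternating_blocks_def)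
  let ?k = "length (diag_entries w)"
  have wc: "blocks_mat w \<in> carrier_mat ?k ?k" by (rule blocks_mat_carrier)
  have alt: "alternating_blocks w" using Cons.prems by (auto simp: alternating_blocks_def)
  show ?case
  proof (cases "i < ?k")
    case True
    then show ?thesis using Cons.IH[OF True alt] b wc by (simp add: osum_def)
  next
    case False
    then have "i - ?k = 0 \<or> i - ?k = 1" "i < ?k + 2" using Cons.prems b by auto
    then show ?thesis using False b wc by (auto simp: osum_def)
  qed
qed simp

lemma sum_sym_char2: fixes g :: "nat \<Rightarrow> nat \<Rightarrow> 'k::field"
  assumes "(2::'k) = 0" "\<And>i j. i < n \<Longrightarrow> j < n \<Longrightarrow> g i j = g j i" "\<And>i. i < n \<Longrightarrow> g i i = 0"
  shows "(\<Sum>i<n. \<Sum>j<n. g i j) = 0"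
  using assms(2,3)
proof (induction n)
  case (Suc n)
  have "(\<Sum>i<Suc n. \<Sum>j<Suc n. g i j) = (\<Sum>i<n. \<Sum>j<n. g i j) + (\<Sum>i<n. g i n) + (\<Sum>j<n. g n j) + g n n"
    by (simp add: sum.distrib)
  also have "(\<Sum>j<n. g n j) = (\<Sum>i<n. g i n)" by (rule sum.cong) (use Suc.prems in auto)
  also have "(\<Sum>i<n. \<Sum>j<n. g i j) = 0" by (rule Suc.IH) (use Suc.prems in auto)
  finally show ?case using Suc.prems(2)[of n] assms(1) by (simp flip: mult_2)
qed simp

text \<open>In characteristic 2 the mixed terms of a symmetric form cancel in pairs; with zero
  diagonal, every vector has value 0.\<close>

lemma alternating_not_split: fixes w :: "'k::field block list"
  assumes w: "alternating_blocks w" "\<forall>b\<in>set w. block_ok b" and n: "length (diag_entries w) = Suc m"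
    and Q: "Q \<in> carrier_mat (Suc m) (Suc m)" and N: "N \<in> carrier_mat m m" "congr Q (blocks_mat w) = osum N (mat1 a)"
  shows "a = 0"
proof -
  let ?M = "blocks_mat w"
  have two: "(2::'k) = 0" using w(1) n by (auto simp: alternating_blocks_def)
  have M: "?M \<in> carrier_mat (Suc m) (Suc m)" "?M\<^sup>T = ?M" using symnd_blocks[OF w(2)] n by (auto simp: symnd_def)
  have s: "?M $$ (p, q) = ?M $$ (q, p)" if "p < Suc m" "q < Suc m" for p q
    using arg_cong[OF M(2), of "\<lambda>A. A $$ (p, q)"] M(1) that by (subst (asm) index_transpose_mat) auto
  have "a = congr Q ?M $$ (m, m)" unfolding N(2) using N(1) by (simp add: osum_def)
  also have "\<dots> = (\<Sum>q<Suc m. (\<Sum>p<Suc m. Q $$ (p, m) * ?M $$ (p, q)) * Q $$ (q, m))"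
    by (rule congr_entry[OF Q M(1)]) auto
  also have "\<dots> = (\<Sum>q<Suc m. \<Sum>p<Suc m. Q $$ (p, m) * ?M $$ (p, q) * Q $$ (q, m))"
    by (simp only: sum_distrib_right)
  also have "\<dots> = 0"
    by (rule sum_sym_char2[OF two]) (use s alternating_diag[OF w(1)] n in \<open>auto simp: ac_simps\<close>)
  finally show ?thesis .
qed

section \<open>Uniqueness of the word of a form\<close>

text \<open>Whether a line with nonzero value splits off depends on M alone, so two decompositions
  are of the same kind. Two lines are compared inside the one form M by
  \<open>split_vector_unique\<close>; two alternating words both reduce to det M followed by
  ones.\<close>

lemma represents_unique: fixes M :: "'k::field mat"
  assumes "symnd n M" "represents n M xs" "represents n M ys" shows "word_htp xs ys"
  using assms
proof (induction n arbitrary: M xs ys rule: less_induct)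
  case (less n)
  have Mc: "M \<in> carrier_mat n n" using less.prems by (simp add: symnd_def)
  obtain P w where P: "P \<in> carrier_mat n n" "det P = 1" "\<forall>b\<in>set w. block_ok b" "congr P M = blocks_mat w" "xs = diag_entries w"
    using less.prems(2) unfolding represents_def by blast
  obtain P' w' where P': "P' \<in> carrier_mat n n" "det P' = 1" "\<forall>b\<in>set w'. block_ok b" "congr P' M = blocks_mat w'" "ys = diag_entries w'"
    using less.prems(3) unfolding represents_def by blast
  have lw: "length (diag_entries w) = n" "length (diag_entries w') = n" using represents_length less.prems P P' by auto
  have split: "line_split n M zs" if "line_split (length (diag_entries v)) (blocks_mat v) zs" "congr T M = blocks_mat v"
    "length (diag_entries v) = n" "T \<in> carrier_mat n n" "det T = 1" for zs T v
    using line_split_congrD[of n T M zs] that Mc by simp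
  have no_split: False if alt: "alternating_blocks v" "\<forall>b\<in>set v. block_ok b" "congr T M = blocks_mat v"
    "length (diag_entries v) = n" "T \<in> carrier_mat n n" "det T = 1" and sp: "line_split n M zs" for zs T v
  proof -
    obtain m Q N a zs where Q: "n = Suc m" "Q \<in> carrier_mat n n" "det Q = 1" "N \<in> carrier_mat m m"
       "congr Q M = osum N (mat1 a)" "a \<noteq> 0" using sp unfolding line_split_def by blast
    obtain R where R: "R \<in> carrier_mat n n" "T * R = 1\<^sub>m n" using SL_inv[OF alt(5,6)] by metis
    have "congr (R * Q) (blocks_mat v) = osum N (mat1 a)"
      using congr_transfer[OF alt(5) R(1) Q(2) Mc R(2)] Q(5) alt(3) by simp
    then have "a = 0" using alternating_not_split[OF alt(1,2), of m "R * Q" N a] alt(4) Q R by simp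
    then show False using Q(6) by simp
  qed
  have "line_split n M xs \<or> alternating_blocks w"
    using line_split_or_alternating[OF P(3)] split[of w] P lw by metis
  moreover have "line_split n M ys \<or> alternating_blocks w'"
    using line_split_or_alternating[OF P'(3)] split[of w'] P' lw by metis
  ultimately consider (s) "line_split n M xs" "line_split n M ys" | (a) "alternating_blocks w" "alternating_blocks w'"
    using no_split[OF _ P(3,4) lw(1) P(1,2)] no_split[OF _ P'(3,4) lw(2) P'(1,2)] by blast
  then show ?case
  proof cases
    case s
    obtain m Q N a zs where Q: "n = Suc m" "Q \<in> carrier_mat n n" "det Q = 1" "N \<in> carrier_mat m m"
       "congr Q M = osum N (mat1 a)" "a \<noteq> 0" "represents m N zs" "word_htp (a # zs) xs" using s(1) unfolding line_split_def by blast
    obtain m' Q' N' a' zs' where Q': "n = Suc m'" "Q' \<in> carrier_mat n n" "det Q' = 1" "N' \<in> carrier_mat m' m'"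
       "congr Q' M = osum N' (mat1 a')" "a' \<noteq> 0" "represents m' N' zs'" "word_htp (a' # zs') ys" using s(2) unfolding line_split_def by blast
    have mm: "m' = m" using Q(1) Q'(1) by simp
    obtain R where R: "R \<in> carrier_mat n n" "det R = 1" "Q * R = 1\<^sub>m n" using SL_inv[OF Q(2,3)] by metis
    have sN: "symnd m N" "symnd m N'"
    proof -
      have "symnd n (osum N (mat1 a))" unfolding Q(5)[symmetric] by (rule symnd_congr[OF less.prems(1) Q(2)]) (use Q in simp)
      then show "symnd m N" using symnd_osumD[OF Q(4) mat1_carrier(1)] Q(1) by simp
      have "symnd n (osum N' (mat1 a'))" unfolding Q'(5)[symmetric] by (rule symnd_congr[OF less.prems(1) Q'(2)]) (use Q' in simp)
      then show "symnd m N'" using symnd_osumD[OF Q'(4) mat1_carrier(1)] Q'(1) mm by simp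
    qed
    have "word_htp (a # zs) (a' # zs')"
    proof (rule split_vector_unique[OF _ sN Q(6) Q'(6)])
      show "R * Q' \<in> carrier_mat (Suc m) (Suc m)" using R Q' Q(1) by simp
      show "det (R * Q') = 1" using det_mult[OF R(1) Q'(2)] R Q' by simp
      show "congr (R * Q') (osum N (mat1 a)) = osum N' (mat1 a')"
        using congr_transfer[OF Q(2) R(1) Q'(2) Mc R(3)] Q(5) Q'(5) by simp
    qed (use Q Q' mm less.IH in auto)
    then show ?thesis using Q(8) Q'(8) word_htp_sym word_htp_trans by metis
  next
    case a
    have d: "det (blocks_mat w) = det M" "det (blocks_mat w') = det M"
      using congr_det[OF P(1) Mc] congr_det[OF P'(1) Mc] P P' by auto
    show ?thesis
    proof (cases "n = 0")
      case True
      then show ?thesis using P(5) P'(5) lw by simp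
    next
      case False
      then have "w \<noteq> []" "w' \<noteq> []" using lw by auto
      then have "word_htp xs (det M # replicate (n - 1) 1)" "word_htp ys (det M # replicate (n - 1) 1)"
        using alternating_word_htp[OF a(1) P(3)] alternating_word_htp[OF a(2) P'(3)] d lw P(5) P'(5) by auto
      then show ?thesis using word_htp_sym word_htp_trans by metis
    qed
  qed
qed

section \<open>The Bezout map on naive homotopy classes\<close>

lemma represents_blocks: "\<forall>b\<in>set w. block_ok b \<Longrightarrow> represents (length (diag_entries w)) (blocks_mat w) (diag_entries w)"
  unfolding represents_def using blocks_mat_carrier[of w]
  by (intro conjI exI[of _ "1\<^sub>m (length (diag_entries w))"] exI[of _ w]) auto

lemma diag_entries_One[simp]: "diag_entries (map One xs) = xs"
  by (induction xs) auto

lemma block_ok_One: "all_nonzero xs \<Longrightarrow> \<forall>b\<in>set (map One xs). block_ok (b :: 'k::field block)"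
  by (induction xs) (auto simp: dvd_field_iff)

lemma Bez_0: "Bez 0 f = 0\<^sub>m 0 0"
  by (cases f) (auto simp: Bez_def)

lemma Bez_word_point: "all_nonzero xs \<Longrightarrow> \<exists>P. conn (length xs) P \<and> Bez (length xs) (word_point xs) = congr P (blocks_mat (map One (xs :: 'k::field list)))"
proof (induction xs)
  case Nil
  then show ?case by (intro exI[of _ "1\<^sub>m 0"]) (auto simp: Bez_0 congr_def)
next
  case (Cons a xs)
  let ?k = "length xs"
  obtain P where P: "conn ?k P" "Bez ?k (word_point xs) = congr P (blocks_mat (map One xs))" using Cons by auto
  obtain Q where Q: "conn (Suc ?k) Q" "Bez (Suc ?k) (word_point (a # xs)) = congr Q (osum (Bez ?k (word_point xs)) (mat1 a))"
    using Bez_word_point_Cons[of a xs ?k] Cons.prems by auto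
  have D: "blocks_mat (map One xs) \<in> carrier_mat ?k ?k" using blocks_mat_carrier[of "map One xs"] by simp
  have Pc: "P \<in> carrier_mat ?k ?k" and Qc: "Q \<in> carrier_mat (Suc ?k) (Suc ?k)" using P Q conn_carrier by auto
  have P1: "conn (Suc ?k) (osum P (1\<^sub>m 1))" using conn_osum[OF P(1) conn_one[of 1]] by simp
  have Dc: "blocks_mat (map One (a # xs)) \<in> carrier_mat (Suc ?k) (Suc ?k)" using blocks_mat_carrier[of "map One (a # xs)"] by simp
  have "osum (Bez ?k (word_point xs)) (mat1 a) = congr (osum P (1\<^sub>m 1)) (blocks_mat (map One (a # xs)))"
    using congr_osum[OF Pc one_carrier_mat D mat1_carrier(1), of a] P(2) by simp
  then have "Bez (Suc ?k) (word_point (a # xs)) = congr (osum P (1\<^sub>m 1) * Q) (blocks_mat (map One (a # xs)))"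
    using Q(2) congr_mult[OF conn_carrier[OF P1] Qc Dc] by simp
  then show ?case using conn_mult[OF P1 Q(1)] by auto
qed

lemma represents_Bez_word_point: assumes "all_nonzero xs" shows "represents (length xs) (Bez (length xs) (word_point xs)) (xs :: 'k::field list)"
proof -
  obtain P where P: "conn (length xs) P" "Bez (length xs) (word_point xs) = congr P (blocks_mat (map One xs))"
    using Bez_word_point[OF assms] by blast
  then show ?thesis using represents_congr[OF represents_blocks[OF block_ok_One[OF assms]]] conn_carrier[OF P(1)] conn_det[OF P(1)] by simp
qed

lemma htpS_Bez_word_point: assumes "all_nonzero xs" shows "htpS (length xs) (blocks_mat (map One xs)) (Bez (length xs) (word_point (xs :: 'k::field list)))"
proof -
  obtain P where P: "conn (length xs) P" "Bez (length xs) (word_point xs) = congr P (blocks_mat (map One xs))"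
    using Bez_word_point[OF assms] by blast
  then show ?thesis using htpS_congr symnd_blocks[OF block_ok_One[OF assms]] by simp
qed

lemma htpS_symnd: "htpS n M N \<Longrightarrow> symnd n M \<Longrightarrow> symnd n (N :: 'k::field mat)"
  unfolding htpS_def by (induction rule: equivclp_induct) (auto intro: symnd_ev)

text \<open>Along the zigzag, the two ends of each homotopy share a word, and at every intermediate
  matrix uniqueness joins it to the word obtained so far.\<close>

lemma represents_htpS: assumes "htpS n M N" "symnd n M" "represents n M xs" "represents n (N :: 'k::field mat) ys" shows "word_htp xs ys"
proof -
  have "\<forall>ys. represents n N ys \<longrightarrow> word_htp xs ys"
    using assms(1) unfolding htpS_def
  proof (induction rule: equivclp_induct)
    case base
    then show ?case using represents_unique assms by blast
  next
    case (step y z)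
    then obtain H where H: "symnd n H" "(y = ev_mat 0 H \<and> z = ev_mat 1 H) \<or> (z = ev_mat 0 H \<and> y = ev_mat 1 H)" by blast
    obtain zs where zs: "represents n (ev_mat 0 H) zs" "represents n (ev_mat 1 H) zs" using represents_homotopy[OF H(1)] by blast
    then have "represents n y zs" "represents n z zs" "symnd n z" using H symnd_ev[OF H(1)] by auto
    then show ?case using step.IH represents_unique word_htp_trans by metis
  qed
  then show ?thesis using assms(4) by blast
qed

lemma htpS_blocks_units: fixes w :: "'k::field block list"
  assumes "\<forall>b\<in>set w. block_ok b"
  shows "htpS (length (diag_entries w)) (blocks_mat w) (blocks_mat (map One (diag_entries w)))"
  using assms
proof (induction w)
  case (Cons b w)
  let ?k = "length (diag_entries w)"
  have ok: "\<forall>b\<in>set w. block_ok b" using Cons.prems by simp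
  have s1: "symnd ?k (blocks_mat w)" by (rule symnd_blocks[OF ok])
  have IH: "htpS ?k (blocks_mat w) (blocks_mat (map One (diag_entries w)))" using Cons.IH ok by simp
  have s2: "symnd ?k (blocks_mat (map One (diag_entries w)))" using htpS_symnd[OF IH s1] .
  show ?case
  proof (cases b)
    case (One a)
    then have "symnd 1 (mat1 a)" using Cons.prems by (simp add: symnd_def)
    then show ?thesis using htpS_osum[OF s2 _ IH htpS_refl, of 1 "mat1 a"] One by simp
  next
    case (Two c f)
    then have c: "c \<noteq> 0" using Cons.prems by auto
    then have "symnd 2 (mat2 f c c 0)" by (simp add: symnd_mat2 dvd_field_iff)
    moreover have "htpS 2 (mat2 f c c 0) (mat2 (- (c * c)) 0 0 1)"
      using htpS_trans[OF htpS_plane_move[OF c, of f 1] htpS_plane[OF c, of 1]] by simp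
    ultimately have "htpS (?k + 2) (osum (blocks_mat w) (mat2 f c c 0)) (osum (blocks_mat (map One (diag_entries w))) (mat2 (- (c * c)) 0 0 1))"
      using htpS_osum[OF s2 _ IH] by blast
    then show ?thesis using Two by (simp add: osum_assoc osum_mat1_mat1)
  qed
qed simp

lemma blocks_mat_append: "blocks_mat (u @ w) = osum (blocks_mat w) (blocks_mat u)"
  by (induction u) (simp_all add: osum_assoc)

lemma Bez_injective: fixes f g :: "'k::field poly \<times> 'k poly"
  assumes "ratfun n f" "ratfun n g" "htpS n (Bez n f) (Bez n g)"
  shows "htpF n f g"
proof -
  obtain xs where xs: "length xs = n" "all_nonzero xs" "htpF n f (word_point xs)" using htpF_word_point[OF assms(1)] by blast
  obtain ys where ys: "length ys = n" "all_nonzero ys" "htpF n g (word_point ys)" using htpF_word_point[OF assms(2)] by blast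
  have rx: "represents n (Bez n (word_point xs)) xs" and ry: "represents n (Bez n (word_point ys)) ys"
    using represents_Bez_word_point[OF xs(2)] represents_Bez_word_point[OF ys(2)] xs(1) ys(1) by auto
  have "htpS n (Bez n (word_point xs)) (Bez n f)" using htpS_sym[OF htpS_Bez[OF xs(3)]] .
  also have "htpS n (Bez n f) (Bez n g)" by fact
  also have "htpS n (Bez n g) (Bez n (word_point ys))" using htpS_Bez[OF ys(3)] .
  finally have h: "htpS n (Bez n (word_point xs)) (Bez n (word_point ys))" .
  have "ratfun n (word_point xs)" using ratfun_word_point[OF xs(2)] xs(1) by simp
  then have "word_htp xs ys" using represents_htpS[OF h symnd_Bez rx ry] by simp
  then have "htpF n (word_point xs) (word_point ys)" unfolding word_htp_def xs(1) by blast
  then show ?thesis using htpF_trans[OF htpF_trans[OF xs(3)] htpF_sym[OF ys(3)]] by simp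
qed

lemma Bez_surjective: fixes M :: "'k::field mat"
  assumes "symnd n M" shows "\<exists>f. ratfun n f \<and> htpS n (Bez n f) M"
proof -
  obtain P w where P: "conn n P" "\<forall>b\<in>set w. block_ok b" "congr P M = blocks_mat w" using blocks_exist[OF assms] by blast
  have "blocks_mat w \<in> carrier_mat n n" unfolding P(3)[symmetric]
    using conn_carrier[OF P(1)] assms by (simp add: symnd_def)
  then have n: "length (diag_entries w) = n" using blocks_mat_carrier[of w] by auto
  let ?xs = "diag_entries w"
  have nzx: "all_nonzero ?xs" using all_nonzero_diag_entries[OF P(2)] .
  have "htpS n M (blocks_mat w)" using htpS_congr[OF assms P(1)] P(3) by simp
  also have "htpS n (blocks_mat w) (blocks_mat (map One ?xs))" using htpS_blocks_units[OF P(2)] n by simp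
  also have "htpS n (blocks_mat (map One ?xs)) (Bez n (word_point ?xs))" using htpS_Bez_word_point[OF nzx] n by simp
  finally have "htpS n (Bez n (word_point ?xs)) M" by (rule htpS_sym)
  then show ?thesis using ratfun_word_point[OF nzx] n by blast
qed

text \<open>Words are read from the last coordinate backwards, so concatenation corresponds to the
  orthogonal sum in the opposite order. Commutativity of words up to homotopy restores the
  order.\<close>

lemma Bez_oplusN: fixes f g :: "'k::field poly \<times> 'k poly"
  assumes "ratfun m f" "ratfun n g"
  shows "htpS (m + n) (Bez (m + n) (oplusN f g)) (osum (Bez m f) (Bez n g))"
proof -
  obtain xs where xs: "length xs = m" "all_nonzero xs" "htpF m f (word_point xs)" using htpF_word_point[OF assms(1)] by blast
  obtain ys where ys: "length ys = n" "all_nonzero ys" "htpF n g (word_point ys)" using htpF_word_point[OF assms(2)] by blast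
  let ?D = "\<lambda>xs. blocks_mat (map One xs)"
  have rx: "ratfun m (word_point xs)" using ratfun_word_point[OF xs(2)] xs(1) by simp
  have "htpF (m + n) (oplusN f g) (oplusN (word_point xs) (word_point ys))"
    by (rule htpF_oplus[OF rx assms(2) xs(3) ys(3)])
  also have "oplusN (word_point xs) (word_point ys) = word_point (xs @ ys)" using word_point_append[OF xs(2) ys(2)] by simp
  also have "htpF (m + n) (word_point (xs @ ys)) (word_point (ys @ xs))"
    using word_htp_commute[OF xs(2) ys(2)] xs(1) ys(1) by (simp add: word_htp_def)
  finally have "htpS (m + n) (Bez (m + n) (oplusN f g)) (Bez (m + n) (word_point (ys @ xs)))" by (rule htpS_Bez)
  also have "htpS (m + n) (Bez (m + n) (word_point (ys @ xs))) (?D (ys @ xs))"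
    using htpS_Bez_word_point[of "ys @ xs"] xs ys htpS_sym by (simp add: add.commute)
  also have "?D (ys @ xs) = osum (?D xs) (?D ys)" by (simp add: blocks_mat_append)
  also have "htpS (m + n) (osum (?D xs) (?D ys)) (osum (Bez m f) (Bez n g))"
  proof (rule htpS_osum)
    show "symnd m (Bez m f)" by (rule symnd_Bez[OF assms(1)])
    show "symnd n (?D ys)" using symnd_blocks[OF block_ok_One[OF ys(2)]] ys(1) by simp
    show "htpS m (?D xs) (Bez m f)" using htpS_trans[OF htpS_Bez_word_point[OF xs(2)]] htpS_sym[OF htpS_Bez[OF xs(3)]] xs(1) by simp
    show "htpS n (?D ys) (Bez n g)" using htpS_trans[OF htpS_Bez_word_point[OF ys(2)]] htpS_sym[OF htpS_Bez[OF ys(3)]] ys(1) by simp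
  qed
  finally show ?thesis .
qed

text \<open>The quotients are not formed: an isomorphism of graded monoids is expressed on
  representatives, as compatibility with homotopy, injectivity and surjectivity in each degree,
  additivity, and preservation of the neutral element.\<close>

theorem theorem3p7:
  fixes k_type :: "'k::field itself"
  shows
   "(\<forall>n (f::'k poly \<times> 'k poly) g. ratfun n f \<and> ratfun n g \<and> htpF n f g
        \<longrightarrow> htpS n (Bez n f) (Bez n g))
    \<and> (\<forall>n (f::'k poly \<times> 'k poly) g. ratfun n f \<and> ratfun n g \<and> htpS n (Bez n f) (Bez n g)
        \<longrightarrow> htpF n f g)
    \<and> (\<forall>n (M::'k mat). symnd n M \<longrightarrow> (\<exists>f. ratfun n f \<and> htpS n (Bez n f) M))
    \<and> (\<forall>n1 n2 (f::'k poly \<times> 'k poly) g. ratfun n1 f \<and> ratfun n2 g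
        \<longrightarrow> htpS (n1 + n2) (Bez (n1 + n2) (oplusN f g)) (osum (Bez n1 f) (Bez n2 g)))
    \<and> Bez 0 ((1, 0) :: 'k poly \<times> 'k poly) = (0\<^sub>m 0 0 :: 'k mat)"
  by (intro conjI allI impI; (elim conjE)?)
    (simp_all add: htpS_Bez Bez_injective Bez_surjective Bez_oplusN Bez_0 del: split_paired_Ex)

end
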